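(* Let $t\ge 2$ be an integer, and let $G$ be a $K_{2,t}$-free planar graph with maximum degree $\Delta$. If $t=2$ and $\Delta\ge 7$, or if $t\ge 3$ and $\Delta\ge 14(t-1)$, then $q_B(G)=\Delta$.
   Context: All graphs are finite, simple and undirected. An edge-coloring is proper if incident edges receive distinct colors. A B-coloring of a graph $G$ is a proper edge-coloring in which the four edges of every $4$-cycle (not necessarily induced) receive pairwise distinct colors. The B-coloring number $q_B(G)$ is the minimum number of colors in a B-coloring of $G$. For an integer $t\ge2$, a graph is $K_{2,t}$-free if any two distinct vertices have at most $t-1$ common neighbors. *)

theory Defs
  imports "HOL-Analysis.Analysis"
begin

locale simple_graph =
  fixes V :: "'a set" and E :: "'a set set"
  assumes finite_V: "finite V"
    and edges: "\<And>e. e \<in> E \<Longrightarrow> e \<subseteq> V \<and> card e = 2"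

definition common_neighbors :: "'a set \<Rightarrow> 'a set set \<Rightarrow> 'a \<Rightarrow> 'a \<Rightarrow> 'a set" where
  "common_neighbors V E u v = {w \<in> V. {u, w} \<in> E \<and> {v, w} \<in> E}"

definition K2_free :: "nat \<Rightarrow> 'a set \<Rightarrow> 'a set set \<Rightarrow> bool" where
  "K2_free t V E \<longleftrightarrow>
     (\<forall>u\<in>V. \<forall>v\<in>V. u \<noteq> v \<longrightarrow> card (common_neighbors V E u v) \<le> t - 1)"

definition vertex_degree :: "'a set set \<Rightarrow> 'a \<Rightarrow> nat" where
  "vertex_degree E v = card {e \<in> E. v \<in> e}"

text \<open>Inserting 0 only matters for the graph without vertices, where \<open>Max {}\<close> is unspecified.\<close>

definition max_degree :: "'a set \<Rightarrow> 'a set set \<Rightarrow> nat" where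
  "max_degree V E = Max (insert 0 (vertex_degree E ` V))"

text \<open>A drawing places vertices at distinct points \<open>p v\<close> of the plane and represents each edge by
  an arc (an injective continuous path) between its ends; an arc passes through no other vertex,
  and two arcs meet only in the images of common ends. The orientation of \<open>\<gamma> e\<close> is irrelevant.\<close>

definition plane_drawing ::
    "'a set \<Rightarrow> 'a set set \<Rightarrow> ('a \<Rightarrow> complex) \<Rightarrow> ('a set \<Rightarrow> real \<Rightarrow> complex) \<Rightarrow> bool" where
  "plane_drawing V E p \<gamma> \<longleftrightarrow>
     inj_on p V \<and>
     (\<forall>e\<in>E. arc (\<gamma> e) \<and> {pathstart (\<gamma> e), pathfinish (\<gamma> e)} = p ` e \<and>
             path_image (\<gamma> e) \<inter> p ` V = p ` e) \<and>
     (\<forall>e\<in>E. \<forall>f\<in>E. e \<noteq> f \<longrightarrow> path_image (\<gamma> e) \<inter> path_image (\<gamma> f) = p ` (e \<inter> f))"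

definition planar :: "'a set \<Rightarrow> 'a set set \<Rightarrow> bool" where
  "planar V E \<longleftrightarrow> (\<exists>p \<gamma>. plane_drawing V E p \<gamma>)"

definition proper_edge_coloring :: "'a set set \<Rightarrow> ('a set \<Rightarrow> nat) \<Rightarrow> bool" where
  "proper_edge_coloring E c \<longleftrightarrow>
     (\<forall>e\<in>E. \<forall>f\<in>E. e \<noteq> f \<and> e \<inter> f \<noteq> {} \<longrightarrow> c e \<noteq> c f)"

definition four_cycle :: "'a set set \<Rightarrow> 'a \<Rightarrow> 'a \<Rightarrow> 'a \<Rightarrow> 'a \<Rightarrow> bool" where
  "four_cycle E v w x y \<longleftrightarrow>
     distinct [v, w, x, y] \<and> {v, w} \<in> E \<and> {w, x} \<in> E \<and> {x, y} \<in> E \<and> {y, v} \<in> E"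

definition B_coloring :: "'a set set \<Rightarrow> ('a set \<Rightarrow> nat) \<Rightarrow> bool" where
  "B_coloring E c \<longleftrightarrow>
     proper_edge_coloring E c \<and>
     (\<forall>v w x y. four_cycle E v w x y \<longrightarrow>
        distinct [c {v, w}, c {w, x}, c {x, y}, c {y, v}])"

definition B_coloring_number :: "'a set set \<Rightarrow> nat" where
  "B_coloring_number E = (LEAST k. \<exists>c. B_coloring E c \<and> c ` E \<subseteq> {..<k})"

text \<open>The minimum in the definition of the B-coloring number is attained.\<close>

lemma (in simple_graph) ex_B_coloring_number:
  "\<exists>c. B_coloring E c \<and> c ` E \<subseteq> {..<B_coloring_number E}"
proof -
  have "E \<subseteq> Pow V" using edges by blast
  then have "finite E" using finite_V finite_subset by blast
  then obtain c where c: "bij_betw c E {0..<card E}" using ex_bij_betw_finite_nat by blast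
  then have inj: "inj_on c E" and "c ` E \<subseteq> {..<card E}"
    by (auto simp: bij_betw_def)
  moreover have "B_coloring E c"
    unfolding B_coloring_def
  proof (intro conjI allI impI)
    show "proper_edge_coloring E c"
      unfolding proper_edge_coloring_def by (simp add: inj_on_eq_iff[OF inj])
  next
    fix v w x y
    assume cyc: "four_cycle E v w x y"
    let ?es = "[{v, w}, {w, x}, {x, y}, {y, v}]"
    have "distinct ?es"
      using cyc unfolding four_cycle_def distinct.simps list.set insert_iff doubleton_eq_iff by blast
    moreover have "set ?es \<subseteq> E"
      using cyc by (simp add: four_cycle_def)
    then have "inj_on c (set ?es)"
      by (rule inj_on_subset[OF inj])
    ultimately have "distinct (map c ?es)"
      by (simp only: distinct_map)
    then show "distinct [c {v, w}, c {w, x}, c {x, y}, c {y, v}]" by simp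
  qed
  ultimately have "\<exists>k c. B_coloring E c \<and> c ` E \<subseteq> {..<k}" by blast
  then show ?thesis
    unfolding B_coloring_number_def by (rule LeastI_ex)
qed

end

theory Submission
  imports Defs "HOL-Complex_Analysis.Winding_Numbers"
begin

text \<open>
  Every proper colouring of the edges at a vertex of maximum degree needs \<open>\<Delta>\<close> colours, so the
  content is a B-colouring with \<open>\<Delta>\<close> colours. Both cases rest on the same sparsity of plane graphs,
  which is used in the form of MacLane's criterion: the even edge sets (the cycle space over the
  field with two elements) are generated by a family of even sets that covers each edge at most
  twice (\<open>maclane_of_drawing\<close>). The family consists of the boundaries of the faces of the drawing.
  Comparing the number of even sets with the number of sums of members bounds the number of edges:
  fewer than \<open>3 n\<close> in general (\<open>card_edges_planar\<close>), and average degree below \<open>30/7\<close> without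
  4-cycles (\<open>card_edges_planar_C4_free\<close>). Working with such families instead of drawings also makes
  it easy to add a chord across a vertex of degree at most three (\<open>maclane_add_chord\<close>).

  For \<open>t \<ge> 3\<close> the vertices are ordered so that, when \<open>v\<close> is reached, few earlier vertices \<open>B\<close> are
  near \<open>v\<close>; all edges from \<open>v\<close> to later vertices are then coloured at once. The order exists by
  \<open>sparse_vertex\<close>, a count in the plane graph on \<open>B\<close> in which the neighbours in \<open>B\<close> of
  every later vertex with at most three of them are joined. The star at \<open>v\<close> is coloured by a system of distinct
  representatives (\<open>star_extension\<close>): writing \<open>\<tau> = t - 1\<close>, an edge \<open>v u\<close> loses only a few multiples
  of \<open>\<tau>\<close> colours to earlier edges, and a colour is forbidden on only a few multiples of \<open>\<tau>\<close> edges
  of the star, because two vertices have at most \<open>\<tau>\<close> common neighbours. A violation of Hall's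
  condition would produce a set \<open>X\<close> of edges and a set \<open>F\<close> of colours, all forbidden on all of \<open>X\<close>,
  with \<open>card X + card F\<close> too large; this is what \<open>14 \<tau>\<close> excludes.

  For \<open>t = 2\<close> there are no 4-cycles, so a B-colouring is a proper edge-colouring and the claim is that
  the graph is of class one. A smallest counterexample satisfies Vizing's adjacency lemma
  (\<open>vizing_adjacency\<close>), and a discharging argument then pushes its average degree up to \<open>30/7\<close>
  (\<open>edge_colors_of_C4_free_maclane\<close>).
\<close>


section \<open>Even edge sets and two-fold bases\<close>

text \<open>Members of the cycle space over the field with two elements.\<close>

definition even_set :: "'a set set \<Rightarrow> bool" where
  "even_set Z \<longleftrightarrow> (\<forall>v. even (card {e \<in> Z. v \<in> e}))"

text \<open>Addition of vectors over the field with two elements, as a constant whose only simplification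
  rule is its membership rule.\<close>

definition sdiff :: "'b set \<Rightarrow> 'b set \<Rightarrow> 'b set" where
  "sdiff A B = {x. (x \<in> A) \<noteq> (x \<in> B)}"

lemma in_sdiff [simp]: "x \<in> sdiff A B \<longleftrightarrow> (x \<in> A) \<noteq> (x \<in> B)"
  by (simp add: sdiff_def)

lemma sdiff_insert_self: "h \<notin> T \<Longrightarrow> sdiff (insert h T) T = {h}"
  by auto

lemma sdiff_subset: "A \<subseteq> E \<Longrightarrow> B \<subseteq> E \<Longrightarrow> sdiff A B \<subseteq> E"
  by auto

lemma finite_sdiff [simp]: "finite A \<Longrightarrow> finite B \<Longrightarrow> finite (sdiff A B)"
  by (rule finite_subset[of _ "A \<union> B"]) auto

lemma sdiff_empty [simp]: "sdiff {} A = A" "sdiff A {} = A"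
  by auto

lemma even_card_sdiff:
  assumes "finite A" "finite B"
  shows "even (card (sdiff A B)) \<longleftrightarrow> (even (card A) \<longleftrightarrow> even (card B))"
proof -
  have "sdiff A B = (A - B) \<union> (B - A)" by auto
  then have "card (sdiff A B) = card (A - B) + card (B - A)"
    using assms by (simp add: card_Un_disjoint Diff_Int_distrib2 Int_Diff)
  moreover have "card A = card (A - B) + card (A \<inter> B)"
    using assms by (metis add.commute card_Int_Diff)
  moreover have "card B = card (B - A) + card (A \<inter> B)"
    using assms by (metis add.commute card_Int_Diff Int_commute)
  ultimately show ?thesis by simp presburger
qed

lemma even_set_empty [simp]: "even_set {}"
  by (simp add: even_set_def)

lemma even_incident_sdiff:
  assumes "finite A" "finite B"
  shows "even (card {e \<in> sdiff A B. v \<in> e}) \<longleftrightarrow>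
    (even (card {e \<in> A. v \<in> e}) \<longleftrightarrow> even (card {e \<in> B. v \<in> e}))"
proof -
  have eq: "{e \<in> sdiff A B. v \<in> e} = sdiff {e \<in> A. v \<in> e} {e \<in> B. v \<in> e}" by auto
  show ?thesis unfolding eq by (rule even_card_sdiff) (use assms in simp_all)
qed

lemma even_set_sdiff:
  "finite A \<Longrightarrow> finite B \<Longrightarrow> even_set A \<Longrightarrow> even_set B \<Longrightarrow> even_set (sdiff A B)"
  unfolding even_set_def by (simp only: even_incident_sdiff simp_thms)

text \<open>The linear span over the field with two elements, generated by adding one member at a time so
  that its elements come with an induction rule.\<close>

inductive_set span2 :: "'e set set \<Rightarrow> 'e set set" for F where
  span2_empty: "{} \<in> span2 F"
| span2_step: "C \<in> F \<Longrightarrow> Z \<in> span2 F \<Longrightarrow> sdiff C Z \<in> span2 F"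

lemma sdiff_assoc: "sdiff (sdiff A B) C = sdiff A (sdiff B C)"
  by auto

lemma sdiff_left_commute: "sdiff A (sdiff B C) = sdiff B (sdiff A C)"
  by auto

lemma sdiff_cancel: "sdiff A (sdiff A B) = B"
  by auto

lemma span2_sdiff:
  assumes "X \<in> span2 F" "Y \<in> span2 F"
  shows "sdiff X Y \<in> span2 F"
  using assms
proof (induction rule: span2.induct)
  case (span2_step C Z)
  then show ?case
    by (subst sdiff_assoc) (rule span2.span2_step)
qed simp

lemma span2_base: "C \<in> F \<Longrightarrow> C \<in> span2 F"
  using span2_step[OF _ span2_empty, of C F] by simp

lemma span2_least:
  assumes "\<And>C. C \<in> F \<Longrightarrow> C \<in> span2 G"
  shows "span2 F \<subseteq> span2 G"
proof
  fix Z assume "Z \<in> span2 F"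
  then show "Z \<in> span2 G"
    by (induction rule: span2.induct) (auto intro: span2_empty span2_sdiff assms)
qed

lemma span2_mono: "F \<subseteq> G \<Longrightarrow> span2 F \<subseteq> span2 G"
  by (rule span2_least) (auto intro: span2_base)

lemma span2_insert: "span2 (insert C F) \<subseteq> span2 F \<union> sdiff C ` span2 F"
proof
  fix Z assume "Z \<in> span2 (insert C F)"
  then show "Z \<in> span2 F \<union> sdiff C ` span2 F"
  proof (induction rule: span2.induct)
    case span2_empty
    then show ?case by (simp add: span2.span2_empty)
  next
    case (span2_step D Z)
    show ?case
    proof (cases "D = C")
      case True
      from span2_step.IH show ?thesis
      proof
        assume "Z \<in> span2 F" then show ?thesis using True by blast
      next
        assume "Z \<in> sdiff C ` span2 F"
        then obtain Y where Y: "Y \<in> span2 F" "Z = sdiff C Y" by blast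
        have "sdiff D Z = Y" unfolding True Y(2) by (rule sdiff_cancel)
        then show ?thesis using Y(1) by simp
      qed
    next
      case False
      then have D: "D \<in> F" using span2_step.hyps by auto
      from span2_step.IH show ?thesis
      proof
        assume "Z \<in> span2 F" then show ?thesis using D span2.span2_step by blast
      next
        assume "Z \<in> sdiff C ` span2 F"
        then obtain Y where Y: "Y \<in> span2 F" "Z = sdiff C Y" by blast
        have "sdiff D Z = sdiff C (sdiff D Y)" unfolding Y(2) by (rule sdiff_left_commute)
        then show ?thesis by (rule UnI2[OF image_eqI]) (rule span2.span2_step[OF D Y(1)])
      qed
    qed
  qed
qed

lemma card_span2_le:
  assumes "finite F"
  shows "finite (span2 F) \<and> card (span2 F) \<le> 2 ^ card F"
  using assms
proof (induction F rule: finite_induct)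
  case empty
  have "span2 {} \<subseteq> {{}::'a set}"
  proof
    fix Z :: "'a set" assume "Z \<in> span2 {}"
    then show "Z \<in> {{}}" by (induction rule: span2.induct) auto
  qed
  then show ?case using card_mono[of "{{}::'a set}"] finite_subset by fastforce
next
  case (insert C F)
  let ?U = "span2 F \<union> sdiff C ` span2 F"
  have fin: "finite ?U" using insert by simp
  have "card ?U \<le> card (span2 F) + card (sdiff C ` span2 F)" by (rule card_Un_le)
  also have "\<dots> \<le> card (span2 F) + card (span2 F)"
    using insert by (simp add: card_image_le)
  also have "\<dots> \<le> 2 ^ card (insert C F)" using insert by simp
  finally have "card ?U \<le> 2 ^ card (insert C F)" .
  then show ?case
    using fin span2_insert[of C F] by (meson card_mono finite_subset le_trans)
qed

definition graph_edges :: "'a set set \<Rightarrow> bool" where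
  "graph_edges E \<longleftrightarrow> finite E \<and> (\<forall>e\<in>E. card e = 2)"

lemma graph_edges_subset: "graph_edges E \<Longrightarrow> C \<subseteq> E \<Longrightarrow> graph_edges C"
  unfolding graph_edges_def using finite_subset by blast

text \<open>MacLane's criterion: \<open>F\<close> generates the cycle space of \<open>E\<close> and covers each edge at most twice.
  A generating family, in place of a basis, is stable under the operations below.\<close>

definition two_basis :: "'a set set \<Rightarrow> 'a set set set \<Rightarrow> bool" where
  "two_basis E F \<longleftrightarrow> finite F \<and> (\<forall>C\<in>F. C \<subseteq> E \<and> even_set C) \<and>
     (\<forall>e\<in>E. card {C \<in> F. e \<in> C} \<le> 2) \<and> (\<forall>Z. Z \<subseteq> E \<longrightarrow> even_set Z \<longrightarrow> Z \<in> span2 F)"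

definition maclane :: "'a set set \<Rightarrow> bool" where
  "maclane E \<longleftrightarrow> graph_edges E \<and> (\<exists>F. two_basis E F)"

lemma two_basisD:
  assumes "two_basis E F"
  shows "finite F" "\<And>C. C \<in> F \<Longrightarrow> C \<subseteq> E" "\<And>C. C \<in> F \<Longrightarrow> even_set C"
    "\<And>e. e \<in> E \<Longrightarrow> card {C \<in> F. e \<in> C} \<le> 2" "\<And>Z. Z \<subseteq> E \<Longrightarrow> even_set Z \<Longrightarrow> Z \<in> span2 F"
  using assms by (auto simp: two_basis_def)

lemma sum_degree_edges:
  assumes "finite V" "finite E" "\<And>e. e \<in> E \<Longrightarrow> e \<subseteq> V \<and> card e = 2"
  shows "(\<Sum>v\<in>V. card {e \<in> E. v \<in> e}) = 2 * card E"
proof -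
  have "\<forall>e\<in>E. card {v \<in> V. v \<in> e} = 2"
  proof
    fix e assume "e \<in> E"
    then have "{v \<in> V. v \<in> e} = e" "card e = 2" using assms(3) by auto
    then show "card {v \<in> V. v \<in> e} = 2" by simp
  qed
  then show ?thesis
    by (rule sum_multicount[OF assms(1,2), of "\<lambda>v e. v \<in> e"])
qed

text \<open>Assign to a subset of \<open>E\<close> the set of its odd-degree vertices other than \<open>v0\<close>. By the handshake
  lemma two subsets with the same image differ by an even set, so every fibre has at most as many
  elements as there are even sets, and there are only \<open>2 ^ (card V - 1)\<close> fibres.\<close>

lemma even_sets_many:
  assumes "finite V" "finite E" "\<And>e. e \<in> E \<Longrightarrow> e \<subseteq> V \<and> card e = 2" "V \<noteq> {}"
  shows "2 ^ card E \<le> 2 ^ (card V - 1) * card {Z. Z \<subseteq> E \<and> even_set Z}"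
proof -
  obtain v0 where v0: "v0 \<in> V" using assms(4) by blast
  let ?Ev = "{Z. Z \<subseteq> E \<and> even_set Z}"
  define d where "d Z = {v \<in> V - {v0}. odd (card {e \<in> Z. v \<in> e})}" for Z
  have finPE: "finite (Pow E)" using assms(2) by simp
  have finEv: "finite ?Ev" by (rule finite_subset[OF _ finPE]) auto
  have even_diff: "even_set (sdiff X Y)" if "X \<subseteq> E" "Y \<subseteq> E" "d X = d Y" for X Y
  proof -
    have fin: "finite X" "finite Y" using that assms(2) finite_subset by blast+
    let ?Z = "sdiff X Y"
    have sub: "?Z \<subseteq> E" using that by (intro sdiff_subset)
    have par: "even (card {e \<in> ?Z. v \<in> e}) \<longleftrightarrow>
        (even (card {e \<in> X. v \<in> e}) \<longleftrightarrow> even (card {e \<in> Y. v \<in> e}))" for v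
      by (rule even_incident_sdiff[OF fin])
    have ev1: "even (card {e \<in> ?Z. v \<in> e})" if "v \<in> V - {v0}" for v
    proof -
      have "v \<in> d X \<longleftrightarrow> v \<in> d Y" using \<open>d X = d Y\<close> by simp
      then show ?thesis using that unfolding par by (simp add: d_def)
    qed
    have "(\<Sum>v\<in>V. card {e \<in> ?Z. v \<in> e}) = 2 * card ?Z"
      using assms(3)[OF subsetD[OF sub]] assms(1) fin by (intro sum_degree_edges finite_sdiff)
    moreover have "(\<Sum>v\<in>V. card {e \<in> ?Z. v \<in> e}) =
        card {e \<in> ?Z. v0 \<in> e} + (\<Sum>v\<in>V-{v0}. card {e \<in> ?Z. v \<in> e})"
      using assms(1) v0 by (simp add: sum.remove)
    moreover have "even (\<Sum>v\<in>V-{v0}. card {e \<in> ?Z. v \<in> e})"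
      using ev1 by (intro dvd_sum) auto
    ultimately have ev0: "even (card {e \<in> ?Z. v0 \<in> e})" by presburger
    show ?thesis unfolding even_set_def
    proof
      fix v
      consider "v \<in> V - {v0}" | "v = v0" | "v \<notin> V" by blast
      then show "even (card {e \<in> ?Z. v \<in> e})"
      proof cases
        case 3
        then have "{e \<in> ?Z. v \<in> e} = {}" using sub assms(3) by blast
        show ?thesis by (subst \<open>{e \<in> ?Z. v \<in> e} = {}\<close>) simp
      qed (use ev1 ev0 in auto)
    qed
  qed
  have fib: "card {Z \<in> Pow E. d Z = D} \<le> card ?Ev" for D
  proof (cases "{Z \<in> Pow E. d Z = D} = {}")
    case False
    then obtain Z0 where Z0: "Z0 \<subseteq> E" "d Z0 = D" by blast
    show ?thesis
    proof (rule card_inj_on_le[of "sdiff Z0"])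
      show "inj_on (sdiff Z0) {Z \<in> Pow E. d Z = D}"
      proof (rule inj_onI)
        fix X Y assume "sdiff Z0 X = sdiff Z0 Y"
        then have "sdiff Z0 (sdiff Z0 X) = sdiff Z0 (sdiff Z0 Y)" by (simp only:)
        then show "X = Y" by (simp only: sdiff_cancel)
      qed
      show "sdiff Z0 ` {Z \<in> Pow E. d Z = D} \<subseteq> ?Ev"
      proof (rule image_subsetI)
        fix Z assume "Z \<in> {Z \<in> Pow E. d Z = D}"
        then have Z: "Z \<subseteq> E" "d Z0 = d Z" using Z0(2) by auto
        then show "sdiff Z0 Z \<in> ?Ev"
          using sdiff_subset[OF Z0(1) Z(1)] even_diff[OF Z0(1) Z] by simp
      qed
    qed (rule finEv)
  qed (simp only: card.empty)
  have "card (Pow E) = card (\<Union>D\<in>Pow (V - {v0}). {Z \<in> Pow E. d Z = D})"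
    by (rule arg_cong[where f = card]) (auto simp: d_def)
  also have "\<dots> \<le> (\<Sum>D\<in>Pow (V - {v0}). card {Z \<in> Pow E. d Z = D})"
    using assms(1) by (intro card_UN_le) simp
  also have "\<dots> \<le> (\<Sum>D\<in>Pow (V - {v0}). card ?Ev)"
    by (rule sum_mono) (rule fib)
  also have "\<dots> = 2 ^ (card V - 1) * card ?Ev"
    using assms(1) v0 by (simp add: card_Pow)
  finally show ?thesis using assms(2) by (simp add: card_Pow)
qed

text \<open>One half of Euler's formula, with the members of \<open>F\<close> in the role of faces: their sums must
  include the even sets, whose number is bounded below by \<open>even_sets_many\<close>.\<close>

lemma card_edges_le_two_basis:
  assumes "finite V" "finite E" "\<And>e. e \<in> E \<Longrightarrow> e \<subseteq> V \<and> card e = 2" "V \<noteq> {}" "two_basis E F"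
  shows "card E + 1 \<le> card V + card (F - {{}})"
proof -
  note F = two_basisD[OF assms(5)]
  have "span2 F \<subseteq> span2 (F - {{}})"
    by (rule span2_least) (metis Diff_iff singletonD span2_base span2_empty)
  then have sub: "{Z. Z \<subseteq> E \<and> even_set Z} \<subseteq> span2 (F - {{}})" using F(5) by blast
  have c: "finite (span2 (F - {{}}))" "card (span2 (F - {{}})) \<le> 2 ^ card (F - {{}})"
    using card_span2_le[of "F - {{}}"] F(1) by auto
  have "(2::nat) ^ card E \<le> 2 ^ (card V - 1) * card {Z. Z \<subseteq> E \<and> even_set Z}"
    by (rule even_sets_many[OF assms(1-4)])
  also have "\<dots> \<le> 2 ^ (card V - 1) * 2 ^ card (F - {{}})"
    using card_mono[OF c(1) sub] c(2) by simp
  finally have "(2::nat) ^ card E \<le> 2 ^ (card V - 1 + card (F - {{}}))" by (simp add: power_add)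
  then have "card E \<le> card V - 1 + card (F - {{}})" by (rule power_le_imp_le_exp[rotated]) simp
  moreover have "card V \<ge> 1" using assms(1,4) by (simp add: Suc_leI card_gt_0_iff)
  ultimately show ?thesis by simp
qed

lemma sum_card_members:
  assumes "finite E" "two_basis E F"
  shows "(\<Sum>C\<in>F - {{}}. card C) \<le> 2 * card E"
proof -
  note F = two_basisD[OF assms(2)]
  have "(\<Sum>C\<in>F - {{}}. card C) = (\<Sum>C\<in>F - {{}}. card {e \<in> E. e \<in> C})"
  proof (rule sum.cong[OF refl])
    fix C assume "C \<in> F - {{}}"
    then have "{e \<in> E. e \<in> C} = C" using F(2)[of C] by auto
    then show "card C = card {e \<in> E. e \<in> C}" by simp
  qed
  also have "\<dots> = (\<Sum>e\<in>E. card {C \<in> F - {{}}. e \<in> C})"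
    using assms(1) F(1) by (intro sum_multicount_gen) auto
  also have "\<dots> \<le> (\<Sum>e\<in>E. 2)"
  proof (rule sum_mono)
    fix e assume "e \<in> E"
    have "{C \<in> F - {{}}. e \<in> C} = {C \<in> F. e \<in> C}" by auto
    then show "card {C \<in> F - {{}}. e \<in> C} \<le> 2" using F(4)[OF \<open>e \<in> E\<close>] by simp
  qed
  finally show ?thesis by simp
qed

lemma even_set_other_edge:
  assumes "finite Z" "even_set Z" "e \<in> Z" "v \<in> e"
  obtains f where "f \<in> Z" "v \<in> f" "f \<noteq> e"
proof -
  have "even (card {f \<in> Z. v \<in> f})" using assms(2) by (simp add: even_set_def)
  moreover have "e \<in> {f \<in> Z. v \<in> f}" using assms by simp
  ultimately have "{f \<in> Z. v \<in> f} \<noteq> {e}" by (metis card_1_singleton_iff One_nat_def odd_one)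
  then show thesis using \<open>e \<in> {f \<in> Z. v \<in> f}\<close> that by blast
qed

lemma even_set_other_end:
  assumes "graph_edges Z" "even_set Z" "{u, v} \<in> Z"
  obtains w where "{v, w} \<in> Z" "w \<noteq> v" "w \<noteq> u"
proof -
  have fin: "finite Z" and c2: "\<And>e. e \<in> Z \<Longrightarrow> card e = 2" using assms(1) by (auto simp: graph_edges_def)
  obtain f where f: "f \<in> Z" "v \<in> f" "f \<noteq> {u, v}"
    by (rule even_set_other_edge[OF fin assms(2,3), of v]) simp_all
  obtain a b where ab: "f = {a, b}" "a \<noteq> b" using c2[OF f(1)] by (meson card_2_iff)
  then consider "f = {v, b}" "b \<noteq> v" | "f = {v, a}" "a \<noteq> v" using f(2) by (auto simp: insert_commute)
  then show thesis
    using that f(1,3) by cases (metis insert_commute)+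
qed

lemma card_triangle:
  assumes "distinct [u,v,w]" shows "card {{u,v},{v,w},{w,u}} = 3"
proof -
  have "{u,v} \<noteq> {v,w}" "{u,v} \<noteq> {w,u}" "{v,w} \<noteq> {w,u}"
    using assms by (auto simp add: doubleton_eq_iff)
  then show ?thesis by simp
qed

lemma card_four_cycle:
  assumes "distinct [u,v,w,x]" shows "card {{u,v},{v,w},{w,x},{x,u}} = 4"
proof -
  have "{u,v} \<noteq> {v,w}" "{u,v} \<noteq> {w,x}" "{u,v} \<noteq> {x,u}" "{v,w} \<noteq> {w,x}" "{v,w} \<noteq> {x,u}" "{w,x} \<noteq> {x,u}"
    using assms by (auto simp add: doubleton_eq_iff)
  then show ?thesis by simp
qed

lemma even_triangle:
  assumes "distinct [u, v, w]"
  shows "even_set {{u,v},{v,w},{w,u}}"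
proof -
  let ?T = "{{u,v},{v,w},{w,u}}"
  have ne: "{u,v} \<noteq> {w,u}" "{u,v} \<noteq> {v,w}" "{v,w} \<noteq> {w,u}"
    using assms by (auto simp: doubleton_eq_iff)
  have evT: "even (card {e \<in> ?T. z \<in> e})" for z
  proof -
    consider "z = u" | "z = v" | "z = w" | "z \<notin> {u,v,w}" by blast
    then show ?thesis
    proof cases
      case 1
      then have "{e \<in> ?T. z \<in> e} = {{u,v},{w,u}}" using assms by auto
      then show ?thesis using ne by simp
    next
      case 2
      then have "{e \<in> ?T. z \<in> e} = {{u,v},{v,w}}" using assms by auto
      then show ?thesis using ne by simp
    next
      case 3
      then have "{e \<in> ?T. z \<in> e} = {{v,w},{w,u}}" using assms by auto
      then show ?thesis using ne by simp
    next
      case 4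
      then have "{e \<in> ?T. z \<in> e} = {}" by auto
      then show ?thesis by (simp only: card.empty) simp
    qed
  qed
  then show ?thesis by (simp add: even_set_def)
qed

text \<open>Walk along the set without turning back. After three steps the walk has closed up to a triangle
  or it needs a fourth edge; a triangle cannot be completed by a single further edge, since one edge
  is not an even set.\<close>

lemma even_set_short:
  assumes "graph_edges Z" "even_set Z" "Z \<noteq> {}"
  shows "(\<exists>u v w. distinct [u, v, w] \<and> Z = {{u,v},{v,w},{w,u}}) \<or>
    (\<exists>u v w x. distinct [u,v,w,x] \<and> Z = {{u,v},{v,w},{w,x},{x,u}}) \<or> card Z \<ge> 5"
proof -
  have fin: "finite Z" and c2: "\<And>e. e \<in> Z \<Longrightarrow> card e = 2" using assms(1) by (auto simp: graph_edges_def)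
  note oth = even_set_other_end[OF assms(1,2)]
  obtain e where e: "e \<in> Z" using assms(3) by blast
  obtain u v where uv: "e = {u,v}" "u \<noteq> v" using c2[OF e] by (meson card_2_iff)
  have uvZ: "{u,v} \<in> Z" using e uv(1) by simp
  obtain w where w: "{v,w} \<in> Z" "w \<noteq> v" "w \<noteq> u" by (rule oth[OF uvZ])
  obtain x where x: "{w,x} \<in> Z" "x \<noteq> w" "x \<noteq> v" by (rule oth[OF w(1)])
  show ?thesis
  proof (cases "card Z \<ge> 5")
    case small: False
    show ?thesis
    proof (cases "x = u")
      case True
      let ?T = "{{u,v},{v,w},{w,u}}"
      have T: "?T \<subseteq> Z" using uvZ w(1) x(1) True by simp
      have dist: "distinct [u, v, w]" using uv(2) w(2,3) by auto
      have cT: "card ?T = 3" by (rule card_triangle[OF dist])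
      have "Z = ?T"
      proof (rule ccontr)
        assume "Z \<noteq> ?T"
        then obtain h where h: "h \<in> Z" "h \<notin> ?T" using T by blast
        have ci: "card (insert h ?T) = 4" using cT h(2) by (subst card_insert_disjoint) auto
        have "Z = insert h ?T"
          using small ci h(1) T fin by (intro card_seteq[symmetric]) auto
        have "even_set ?T" by (rule even_triangle[OF dist])
        then have "even_set (sdiff Z ?T)" using fin assms(2) by (intro even_set_sdiff) auto
        moreover have "sdiff Z ?T = {h}"
          unfolding \<open>Z = insert h ?T\<close> using h(2) by (rule sdiff_insert_self)
        ultimately have "even_set {h}" by simp
        moreover obtain y where "y \<in> h" using c2[OF h(1)] by fastforce
        ultimately show False using even_set_other_edge[of "{h}" h y] by auto
      qed
      then show ?thesis using dist by blast
    next
      case False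
      have dist: "distinct [u,v,w,x]" using uv(2) w(2,3) x(2,3) False by auto
      obtain y where y: "{x,y} \<in> Z" "y \<noteq> x" "y \<noteq> w" by (rule oth[OF x(1)])
      have vu: "{v,u} \<in> Z" using uvZ by (simp add: insert_commute)
      obtain z where z: "{u,z} \<in> Z" "z \<noteq> u" "z \<noteq> v" by (rule oth[OF vu])
      let ?P = "{{u,v},{v,w},{w,x}}"
      have ne: "{u,v} \<noteq> {v,w}" "{u,v} \<noteq> {w,x}" "{v,w} \<noteq> {w,x}" "{x,y} \<notin> ?P" "{u,z} \<notin> ?P"
        using dist y(2,3) z(2,3) by (auto simp: doubleton_eq_iff)
      have c4: "card (insert {x,y} ?P) = 4" using ne by simp
      have Z: "Z = insert {x,y} ?P"
        using small c4 uvZ w(1) x(1) y(1) fin by (intro card_seteq[symmetric]) auto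
      have "{u,z} = {x,y}" using Z z(1) ne(5) by blast
      then have "y = u" using False by (simp add: doubleton_eq_iff)
      then have "Z = {{u,v},{v,w},{w,x},{x,u}}" using Z by (simp add: insert_commute)
      then show ?thesis using dist by blast
    qed
  qed simp
qed

lemma card_edges_planar:
  assumes "finite V" "\<And>e. e \<in> E \<Longrightarrow> e \<subseteq> V" "V \<noteq> {}" "maclane E"
  shows "card E + 3 \<le> 3 * card V"
proof -
  obtain F where F: "two_basis E F" and g: "graph_edges E" using assms(4) by (auto simp: maclane_def)
  have fin: "finite E" and c2: "\<And>e. e \<in> E \<Longrightarrow> card e = 2" using g by (auto simp: graph_edges_def)
  have "3 * card (F - {{}}) = (\<Sum>C\<in>F - {{}}. 3)" by simp
  also have "\<dots> \<le> (\<Sum>C\<in>F - {{}}. card C)"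
  proof (rule sum_mono)
    fix C assume C: "C \<in> F - {{}}"
    then have "graph_edges C" "even_set C" "C \<noteq> {}"
      using two_basisD[OF F] graph_edges_subset[OF g] by auto
    from even_set_short[OF this] show "3 \<le> card C"
      by (elim disjE exE conjE) (simp_all only: card_triangle card_four_cycle)
  qed
  also have "\<dots> \<le> 2 * card E" by (rule sum_card_members[OF fin F])
  finally have "3 * card (F - {{}}) \<le> 2 * card E" .
  moreover have "card E + 1 \<le> card V + card (F - {{}})"
    using assms c2 fin F by (intro card_edges_le_two_basis) auto
  ultimately show ?thesis by linarith
qed

text \<open>Members of size three are triangles, and these are edge-disjoint because two triangles with a common
  edge contain a 4-cycle; all other nonempty members have at least five edges.\<close>

lemma card_edges_planar_C4_free:
  assumes "finite V" "\<And>e. e \<in> E \<Longrightarrow> e \<subseteq> V" "V \<noteq> {}" "maclane E"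
    and C4: "\<And>u v w x. distinct [u,v,w,x] \<Longrightarrow> \<not> ({u,v} \<in> E \<and> {v,w} \<in> E \<and> {w,x} \<in> E \<and> {x,u} \<in> E)"
  shows "7 * card E + 15 \<le> 15 * card V"
proof -
  obtain F where F: "two_basis E F" and g: "graph_edges E" using assms(4) by (auto simp: maclane_def)
  note FD = two_basisD[OF F]
  have fin: "finite E" and c2: "\<And>e. e \<in> E \<Longrightarrow> card e = 2" using g by (auto simp: graph_edges_def)
  define F3 where "F3 = {C \<in> F - {{}}. card C = 3}"
  have finF: "finite (F - {{}})" "finite F3" using FD(1) by (auto simp: F3_def)
  have cases: "(\<exists>u v w. distinct [u, v, w] \<and> C = {{u,v},{v,w},{w,u}}) \<or> card C \<ge> 5" if "C \<in> F - {{}}" for C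
  proof -
    have "graph_edges C" "even_set C" "C \<noteq> {}"
      using FD graph_edges_subset[OF g] that by auto
    from even_set_short[OF this] show ?thesis
    proof (elim disjE)
      assume "\<exists>u v w x. distinct [u,v,w,x] \<and> C = {{u,v},{v,w},{w,x},{x,u}}"
      then obtain u v w x where *: "distinct [u,v,w,x]" "C = {{u,v},{v,w},{w,x},{x,u}}" by blast
      have "C \<subseteq> E" using that FD(2) by blast
      then show ?thesis using C4[OF *(1)] *(2) by simp
    qed blast+
  qed
  have tri: "\<exists>u v w. distinct [u, v, w] \<and> C = {{u,v},{v,w},{w,u}}" if "C \<in> F3" for C
    using cases[of C] that by (auto simp: F3_def)
  have tri_e: "\<exists>w. w \<noteq> u \<and> w \<noteq> v \<and> C = {{u,v},{v,w},{w,u}}" if C: "C \<in> F3" "{u,v} \<in> C" "u \<noteq> v" for C u v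
  proof -
    obtain a b c where *: "distinct [a,b,c]" "C = {{a,b},{b,c},{c,a}}" using tri[OF C(1)] by blast
    have "(u = a \<and> v = b) \<or> (u = b \<and> v = a) \<or> (u = b \<and> v = c) \<or> (u = c \<and> v = b) \<or> (u = c \<and> v = a) \<or> (u = a \<and> v = c)"
      using C(2) unfolding * by (simp add: doubleton_eq_iff)
    moreover have "a \<noteq> b" "b \<noteq> a" "a \<noteq> c" "c \<noteq> a" "b \<noteq> c" "c \<noteq> b" using *(1) by auto
    moreover note *(2)
    ultimately show ?thesis
    proof (elim disjE conjE)
      assume "u = a" "v = b" "C = {{a,b},{b,c},{c,a}}" "c \<noteq> a" "c \<noteq> b"
      then show ?thesis by (intro exI[of _ c]) (simp add: insert_commute)
    next
      assume "u = b" "v = a" "C = {{a,b},{b,c},{c,a}}" "c \<noteq> b" "c \<noteq> a"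
      then show ?thesis by (intro exI[of _ c]) (simp add: insert_commute)
    next
      assume "u = b" "v = c" "C = {{a,b},{b,c},{c,a}}" "a \<noteq> b" "a \<noteq> c"
      then show ?thesis by (intro exI[of _ a]) (simp add: insert_commute)
    next
      assume "u = c" "v = b" "C = {{a,b},{b,c},{c,a}}" "a \<noteq> c" "a \<noteq> b"
      then show ?thesis by (intro exI[of _ a]) (simp add: insert_commute)
    next
      assume "u = c" "v = a" "C = {{a,b},{b,c},{c,a}}" "b \<noteq> c" "b \<noteq> a"
      then show ?thesis by (intro exI[of _ b]) (simp add: insert_commute)
    next
      assume "u = a" "v = c" "C = {{a,b},{b,c},{c,a}}" "b \<noteq> a" "b \<noteq> c"
      then show ?thesis by (intro exI[of _ b]) (simp add: insert_commute)
    qed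
  qed
  have disj: "C \<inter> D = {}" if CD: "C \<in> F3" "D \<in> F3" "C \<noteq> D" for C D
  proof (rule ccontr)
    assume "C \<inter> D \<noteq> {}"
    then obtain e where e: "e \<in> C" "e \<in> D" by blast
    have "C \<subseteq> E" "D \<subseteq> E" using CD FD(2) by (auto simp: F3_def)
    then obtain u v where uv: "e = {u,v}" "u \<noteq> v" using c2 e by (meson card_2_iff subsetD)
    obtain w where w: "w \<noteq> u" "w \<noteq> v" "C = {{u,v},{v,w},{w,u}}" using tri_e[OF CD(1)] e uv by blast
    obtain x where x: "x \<noteq> u" "x \<noteq> v" "D = {{u,v},{v,x},{x,u}}" using tri_e[OF CD(2)] e uv by blast
    have "w \<noteq> x" using w x CD(3) by auto
    then have "distinct [u,w,v,x]" using w x uv by auto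
    from C4[OF this] \<open>C \<subseteq> E\<close> \<open>D \<subseteq> E\<close> w x show False by (auto simp: insert_commute)
  qed
  have "3 * card F3 = (\<Sum>C\<in>F3. card C)" by (simp add: F3_def)
  also have "\<dots> = card (\<Union>F3)"
    using disj fin FD(2) by (intro card_Union_disjoint[symmetric]) (auto simp: F3_def pairwise_def disjnt_def dest: finite_subset)
  also have "\<dots> \<le> card E" using fin FD(2) by (intro card_mono) (auto simp: F3_def)
  finally have f3: "3 * card F3 \<le> card E" .
  have "5 * card (F - {{}}) = 5 * card (F - {{}} - F3) + 5 * card F3"
  proof -
    have sub: "F3 \<subseteq> F - {{}}" by (auto simp: F3_def)
    show ?thesis
      using card_Diff_subset[OF finF(2) sub] card_mono[OF finF(1) sub] by simp
  qed
  also have "\<dots> \<le> (\<Sum>C\<in>F - {{}} - F3. card C) + (\<Sum>C\<in>F3. card C) + 2 * card F3"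
  proof -
    have "5 * card (F - {{}} - F3) = (\<Sum>C\<in>F - {{}} - F3. 5)" by simp
    also have "\<dots> \<le> (\<Sum>C\<in>F - {{}} - F3. card C)"
    proof (rule sum_mono)
      fix C assume C: "C \<in> F - {{}} - F3"
      have "\<not> (\<exists>u v w. distinct [u, v, w] \<and> C = {{u,v},{v,w},{w,u}})"
      proof
        assume "\<exists>u v w. distinct [u, v, w] \<and> C = {{u,v},{v,w},{w,u}}"
        then have "card C = 3" by (elim exE conjE) (simp only: card_triangle)
        then show False using C by (auto simp: F3_def)
      qed
      then show "5 \<le> card C" using cases[of C] C by blast
    qed
    finally show ?thesis by (simp add: F3_def)
  qed
  also have "(\<Sum>C\<in>F - {{}} - F3. card C) + (\<Sum>C\<in>F3. card C) = (\<Sum>C\<in>F - {{}}. card C)"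
    using finF by (intro sum.subset_diff[symmetric]) (auto simp: F3_def)
  also have "\<dots> \<le> 2 * card E" by (rule sum_card_members[OF fin F])
  finally have "5 * card (F - {{}}) \<le> 2 * card E + 2 * card F3" by simp
  moreover have "card E + 1 \<le> card V + card (F - {{}})"
    using assms c2 fin F by (intro card_edges_le_two_basis) auto
  ultimately show ?thesis using f3 by linarith
qed

section \<open>Union, deletion and chords\<close>

lemma maclane_Un:
  assumes "maclane E1" "maclane E2" "\<Union>E1 \<inter> \<Union>E2 = {}"
  shows "maclane (E1 \<union> E2)"
proof -
  obtain F1 F2 where F: "two_basis E1 F1" "two_basis E2 F2" and g: "graph_edges E1" "graph_edges E2"
    using assms by (auto simp: maclane_def)
  have disj: "e \<notin> E2" if "e \<in> E1" for e
  proof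
    assume "e \<in> E2"
    moreover have "card e = 2" using g that by (simp add: graph_edges_def)
    then obtain v where "v \<in> e" by fastforce
    ultimately show False using that assms(3) by blast
  qed
  have fin: "finite E1" "finite E2" using g by (auto simp: graph_edges_def)
  note D1 = two_basisD[OF F(1)] and D2 = two_basisD[OF F(2)]
  have split: "even_set (Z \<inter> E1)" "even_set (Z \<inter> E2)" if Z: "Z \<subseteq> E1 \<union> E2" "even_set Z" for Z
  proof -
    have 1: "even (card {e \<in> Z \<inter> E1. v \<in> e}) \<and> even (card {e \<in> Z \<inter> E2. v \<in> e})" for v
    proof -
      have ev: "even (card {e \<in> Z. v \<in> e})" using Z(2) by (simp add: even_set_def)
      consider "v \<notin> \<Union>E1" | "v \<notin> \<Union>E2" using assms(3) by blast
      then show ?thesis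
      proof cases
        case 1
        then have eq: "{e \<in> Z \<inter> E1. v \<in> e} = {}" "{e \<in> Z \<inter> E2. v \<in> e} = {e \<in> Z. v \<in> e}"
          using Z(1) by blast+
        show ?thesis unfolding eq using ev by simp
      next
        case 2
        then have eq: "{e \<in> Z \<inter> E2. v \<in> e} = {}" "{e \<in> Z \<inter> E1. v \<in> e} = {e \<in> Z. v \<in> e}"
          using Z(1) by blast+
        show ?thesis unfolding eq using ev by simp
      qed
    qed
    then show "even_set (Z \<inter> E1)" "even_set (Z \<inter> E2)" by (auto simp: even_set_def)
  qed
  have "two_basis (E1 \<union> E2) (F1 \<union> F2)"
    unfolding two_basis_def
  proof (intro conjI ballI allI impI)
    show "finite (F1 \<union> F2)" using D1 D2 by simp
  next
    fix C assume "C \<in> F1 \<union> F2" then show "C \<subseteq> E1 \<union> E2" "even_set C" using D1(2,3) D2(2,3) by blast+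
  next
    fix e assume "e \<in> E1 \<union> E2"
    then show "card {C \<in> F1 \<union> F2. e \<in> C} \<le> 2"
    proof
      assume e: "e \<in> E1"
      then have "{C \<in> F1 \<union> F2. e \<in> C} = {C \<in> F1. e \<in> C}" using D2(2) disj by blast
      then show ?thesis using D1(4)[OF e] by simp
    next
      assume e: "e \<in> E2"
      then have "{C \<in> F1 \<union> F2. e \<in> C} = {C \<in> F2. e \<in> C}" using D1(2) disj by blast
      then show ?thesis using D2(4)[OF e] by simp
    qed
  next
    fix Z assume Z: "Z \<subseteq> E1 \<union> E2" "even_set Z"
    have "Z \<inter> E1 \<in> span2 (F1 \<union> F2)" "Z \<inter> E2 \<in> span2 (F1 \<union> F2)"
      using D1(5)[OF _ split(1)[OF Z]] D2(5)[OF _ split(2)[OF Z]] span2_mono[of F1 "F1 \<union> F2"]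
        span2_mono[of F2 "F1 \<union> F2"] by blast+
    then have "sdiff (Z \<inter> E1) (Z \<inter> E2) \<in> span2 (F1 \<union> F2)" by (rule span2_sdiff)
    moreover have "sdiff (Z \<inter> E1) (Z \<inter> E2) = Z" using Z(1) disj by auto
    ultimately show "Z \<in> span2 (F1 \<union> F2)" by simp
  qed
  moreover have "graph_edges (E1 \<union> E2)" using g by (auto simp: graph_edges_def)
  ultimately show ?thesis by (auto simp: maclane_def)
qed

lemma card_le_2_doubleton:
  assumes "finite A" "card A \<le> 2" "x \<in> A" "y \<in> A" "x \<noteq> y"
  shows "A = {x, y}"
proof -
  have "card {x,y} = 2" using assms by simp
  then show ?thesis using assms by (intro card_seteq[symmetric]) auto
qed

lemma card_replace_le:
  assumes "finite S" "C \<in> S"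
  shows "card (insert X (S - {C})) \<le> card S"
proof -
  have "card (insert X (S - {C})) \<le> Suc (card (S - {C}))" by (rule card_insert_le_m1) simp_all
  also have "\<dots> = card S" using assms by (rule card_Suc_Diff1)
  finally show ?thesis .
qed

lemma span2_insertE:
  assumes "Z \<in> span2 (insert C F)"
  obtains "Z \<in> span2 F" | Y where "Y \<in> span2 F" "Z = sdiff C Y"
  using subsetD[OF span2_insert assms] that by auto

lemma span2_insert2E:
  assumes "Z \<in> span2 (insert C (insert C' F))"
  obtains "Z \<in> span2 F" | Y where "Y \<in> span2 F" "Z = sdiff C' Y" |
    Y where "Y \<in> span2 F" "Z = sdiff C Y" | Y where "Y \<in> span2 F" "Z = sdiff C (sdiff C' Y)"
proof (rule span2_insertE[OF assms])
  assume Z: "Z \<in> span2 (insert C' F)"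
  show thesis by (rule span2_insertE[OF Z]) (fact that(1), rule that(2))
next
  fix Y assume Y: "Y \<in> span2 (insert C' F)" "Z = sdiff C Y"
  show thesis
  proof (rule span2_insertE[OF Y(1)])
    assume "Y \<in> span2 F" then show thesis using Y(2) by (rule that(3))
  next
    fix X assume X: "X \<in> span2 F" "Y = sdiff C' X"
    show thesis using Y(2) unfolding X(2) by (rule that(4)[OF X(1)])
  qed
qed

lemma not_mem_span2:
  assumes "Y \<in> span2 F" "\<And>B. B \<in> F \<Longrightarrow> e \<notin> B"
  shows "e \<notin> Y"
  using assms(1) by (induction rule: span2.induct) (simp_all add: assms(2))

text \<open>Deleting an edge merges the two faces at its sides.\<close>

lemma maclane_remove:
  assumes "maclane E"
  shows "maclane (E - {e})"
proof (cases "e \<in> E")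
  case e: True
  obtain F where F: "two_basis E F" and g: "graph_edges E" using assms by (auto simp: maclane_def)
  note D = two_basisD[OF F]
  have fin: "finite E" using g by (simp add: graph_edges_def)
  have finC: "finite C" if "C \<in> F" for C using D(2)[OF that] fin finite_subset by blast
  have g': "graph_edges (E - {e})" using g by (auto simp: graph_edges_def)
  have finF: "finite {C \<in> F. P C}" for P using D(1) by simp
  consider "\<forall>C\<in>F. e \<notin> C" | C where "C \<in> F" "e \<in> C" "\<And>D. D \<in> F \<Longrightarrow> e \<in> D \<Longrightarrow> D = C" |
    C C' where "C \<in> F" "e \<in> C" "C' \<in> F" "e \<in> C'" "C' \<noteq> C"
  proof (cases "\<forall>C\<in>F. e \<notin> C")
    case False
    then obtain C where C: "C \<in> F" "e \<in> C" by blast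
    show ?thesis
    proof (cases "\<exists>C'\<in>F. e \<in> C' \<and> C' \<noteq> C")
      case True
      then show ?thesis using that(3)[OF C] by blast
    next
      case False
      then show ?thesis using that(2)[OF C] by blast
    qed
  qed (rule that(1))
  then show ?thesis
  proof cases
    case 1
    have "two_basis (E - {e}) F"
      unfolding two_basis_def
    proof (intro conjI ballI allI impI)
      fix C assume C: "C \<in> F"
      show "C \<subseteq> E - {e}" using 1 D(2)[OF C] C by auto
      show "even_set C" by (rule D(3)[OF C])
    next
      fix f assume "f \<in> E - {e}" then show "card {C \<in> F. f \<in> C} \<le> 2" using D(4)[of f] by simp
    next
      fix Z assume "Z \<subseteq> E - {e}" "even_set Z" then show "Z \<in> span2 F" using D(5)[of Z] by blast
    qed (rule D(1))
    then show ?thesis using g' by (auto simp: maclane_def)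
  next
    case 2
    have "two_basis (E - {e}) (F - {C})"
      unfolding two_basis_def
    proof (intro conjI ballI allI impI)
      show "finite (F - {C})" using D by simp
    next
      fix B assume B: "B \<in> F - {C}"
      show "B \<subseteq> E - {e}" using 2(3)[of B] D(2)[of B] B by auto
      show "even_set B" using D(3)[of B] B by simp
    next
      fix f assume "f \<in> E - {e}"
      have "card {B \<in> F - {C}. f \<in> B} \<le> card {B \<in> F. f \<in> B}"
        using finF by (intro card_mono) auto
      then show "card {B \<in> F - {C}. f \<in> B} \<le> 2" using D(4)[of f] \<open>f \<in> E - {e}\<close> by simp
    next
      fix Z assume Z: "Z \<subseteq> E - {e}" "even_set Z"
      then have "Z \<in> span2 F" using D(5) by blast
      moreover have "F = insert C (F - {C})" using 2 by blast
      ultimately have "Z \<in> span2 (F - {C}) \<union> sdiff C ` span2 (F - {C})"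
        using span2_insert by (metis subsetD)
      moreover have "Z \<notin> sdiff C ` span2 (F - {C})"
      proof
        assume "Z \<in> sdiff C ` span2 (F - {C})"
        then obtain Y where Y: "Y \<in> span2 (F - {C})" "Z = sdiff C Y" by (rule imageE)
        have "e \<notin> B" if "B \<in> F - {C}" for B using 2(3)[of B] that by auto
        then have "e \<notin> Y" by (rule not_mem_span2[OF Y(1)])
        then show False using Y(2) 2(2) Z(1) by auto
      qed
      ultimately show "Z \<in> span2 (F - {C})" by (simp only: Un_iff simp_thms)
    qed
    then show ?thesis using g' by (auto simp: maclane_def)
  next
    case 3
    let ?S = "sdiff C C'" and ?R = "F - {C, C'}"
    have two: "{B \<in> F. e \<in> B} = {C, C'}"
      using 3 D(4)[OF e] finF by (intro card_le_2_doubleton) auto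
    have "two_basis (E - {e}) (insert ?S ?R)"
      unfolding two_basis_def
    proof (intro conjI ballI allI impI)
      show "finite (insert ?S ?R)" using D by simp
    next
      fix B assume B: "B \<in> insert ?S ?R"
      have "?S \<subseteq> E" using D(2) 3 by (intro sdiff_subset) auto
      then have "?S \<subseteq> E - {e}" using 3 by auto
      then show "B \<subseteq> E - {e}" using B two D(2) by blast
      show "even_set B" using B D(3) even_set_sdiff[OF finC finC] 3 by auto
    next
      fix f assume f: "f \<in> E - {e}"
      show "card {B \<in> insert ?S ?R. f \<in> B} \<le> 2"
      proof (cases "f \<in> ?S")
        case True
        then obtain A where A: "A \<in> {C, C'}" "f \<in> A" by auto
        have "{B \<in> insert ?S ?R. f \<in> B} \<subseteq> insert ?S ({B \<in> F. f \<in> B} - {A})" using A by auto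
        then have "card {B \<in> insert ?S ?R. f \<in> B} \<le> card (insert ?S ({B \<in> F. f \<in> B} - {A}))"
          using finF by (intro card_mono) simp_all
        also have "\<dots> \<le> card {B \<in> F. f \<in> B}" using A 3 finF by (intro card_replace_le) auto
        also have "\<dots> \<le> 2" using D(4)[of f] f by simp
        finally show ?thesis .
      next
        case False
        then have "{B \<in> insert ?S ?R. f \<in> B} \<subseteq> {B \<in> F. f \<in> B}" by auto
        then have "card {B \<in> insert ?S ?R. f \<in> B} \<le> card {B \<in> F. f \<in> B}" by (rule card_mono[OF finF])
        also have "\<dots> \<le> 2" using D(4)[of f] f by simp
        finally show ?thesis .
      qed
    next
      fix Z assume Z: "Z \<subseteq> E - {e}" "even_set Z"
      then have "Z \<in> span2 F" using D(5) by blast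
      moreover have "F = insert C (insert C' ?R)" using 3 by blast
      ultimately have Zsp: "Z \<in> span2 (insert C (insert C' ?R))" by simp
      have noR: "e \<notin> B" if "B \<in> ?R" for B using two that by blast
      have noe: "e \<notin> Y" if "Y \<in> span2 ?R" for Y by (rule not_mem_span2[OF that noR])
      have eC: "e \<in> C" "e \<in> C'" "e \<notin> Z" using 3 Z by auto
      have sub: "span2 ?R \<subseteq> span2 (insert ?S ?R)" by (rule span2_mono) blast
      consider "Z \<in> span2 ?R" | Y where "Y \<in> span2 ?R" "Z = sdiff C' Y" |
        Y where "Y \<in> span2 ?R" "Z = sdiff C Y" | Y where "Y \<in> span2 ?R" "Z = sdiff C (sdiff C' Y)"
        using Zsp
        by (rule span2_insert2E)
      then show "Z \<in> span2 (insert ?S ?R)"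
      proof cases
        case 1 then show ?thesis using sub by blast
      next
        case 2 then show ?thesis using noe[OF 2(1)] eC in_sdiff by metis
      next
        case 3 then show ?thesis using noe[OF 3(1)] eC in_sdiff by metis
      next
        case 4
        then have "Z = sdiff ?S Y" by (simp add: sdiff_assoc)
        then show ?thesis using 4(1) sub span2_step[of ?S "insert ?S ?R" Y] by blast
      qed
    qed
    then show ?thesis using g' by (auto simp: maclane_def)
  qed
qed (use assms in simp)


lemma maclane_Diff:
  assumes "finite D" "maclane E"
  shows "maclane (E - D)"
  using assms
proof (induction D rule: finite_induct)
  case (insert x D)
  have "E - insert x D = E - D - {x}" by blast
  then show ?case using maclane_remove[of "E - D" x] insert by simp
qed simp

lemma maclane_subset:
  assumes "maclane E" "E' \<subseteq> E"
  shows "maclane E'"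
proof -
  have "finite E" using assms(1) by (simp add: maclane_def graph_edges_def)
  then have "maclane (E - (E - E'))" using assms(1) by (intro maclane_Diff) simp_all
  moreover have "E - (E - E') = E'" using assms(2) by blast
  ultimately show ?thesis by simp
qed

lemma span2_add_triangle:
  assumes F: "two_basis E F" "finite E" and T: "n \<in> T" "T \<subseteq> insert n E" "even_set T"
    and F': "T \<in> F'" "F \<subseteq> span2 F'" and Z: "Z \<subseteq> insert n E" "even_set Z"
  shows "Z \<in> span2 F'"
proof -
  have sp: "span2 F \<subseteq> span2 F'" using F'(2) by (intro span2_least) blast
  show ?thesis
  proof (cases "n \<in> Z")
    case False
    then have "Z \<subseteq> E" using Z by blast
    then show ?thesis using two_basisD(5)[OF F(1) _ Z(2)] sp by blast
  next
    case True
    have fin: "finite T" "finite Z" using F(2) T(2) Z(1) by (meson finite_insert finite_subset)+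
    have "sdiff T Z \<subseteq> E" using T Z True by auto
    then have "sdiff T Z \<in> span2 F'"
      using two_basisD(5)[OF F(1) _ even_set_sdiff[OF fin T(3) Z(2)]] sp by blast
    from span2_step[OF F'(1) this] show ?thesis by (simp only: sdiff_cancel)
  qed
qed

text \<open>The face \<open>C\<close> is cut by the new edge \<open>n\<close> into \<open>T\<close> and \<open>T + C\<close>. An edge of \<open>T\<close> outside \<open>C\<close>
  gains two faces, hence must have had none.\<close>

lemma two_basis_split_member:
  assumes F: "two_basis E F" "finite E" and n: "n \<notin> E" and T: "n \<in> T" "T \<subseteq> insert n E" "even_set T"
    and C: "C \<in> F" and CT: "\<And>e. e \<in> T \<Longrightarrow> e \<notin> C \<Longrightarrow> {B \<in> F. e \<in> B} = {}"
  shows "two_basis (insert n E) (insert T (insert (sdiff T C) (F - {C})))" (is "two_basis _ ?F")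
proof -
  note D = two_basisD[OF F(1)]
  have CE: "C \<subseteq> E" using D(2) C by blast
  have fin: "finite T" "finite C" using F(2) T(2) CE by (meson finite_insert finite_subset)+
  have finM: "finite {B \<in> F. e \<in> B}" for e using D(1) by simp
  show ?thesis
    unfolding two_basis_def
  proof (intro conjI ballI allI impI)
    show "finite ?F" using D by simp
  next
    fix B assume B: "B \<in> ?F"
    have "sdiff T C \<subseteq> insert n E" using T(2) CE by (intro sdiff_subset) auto
    then show "B \<subseteq> insert n E" using B D(2) T(2) by blast
    show "even_set B" using B D(3) T(3) even_set_sdiff[OF fin T(3) D(3)[OF C]] by blast
  next
    fix e assume e: "e \<in> insert n E"
    consider "{B \<in> F. e \<in> B} = {}" | "e \<in> E" "e \<in> T" "e \<in> C" | "e \<in> E" "e \<notin> T" "e \<in> C" | "e \<in> E" "e \<notin> T" "e \<notin> C"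
      using e n D(2) CT by blast
    then show "card {B \<in> ?F. e \<in> B} \<le> 2"
    proof cases
      case 1
      then have "{B \<in> ?F. e \<in> B} \<subseteq> {T, sdiff T C}" by blast
      then have "card {B \<in> ?F. e \<in> B} \<le> card {T, sdiff T C}" by (intro card_mono) auto
      also have "\<dots> \<le> 2" by (simp add: card_insert_if)
      finally show ?thesis .
    next
      case 2
      have "{B \<in> ?F. e \<in> B} \<subseteq> insert T ({B \<in> F. e \<in> B} - {C})"
        by (rule subsetI, elim CollectE conjE insertE) (use 2 in simp_all)
      then have "card {B \<in> ?F. e \<in> B} \<le> card (insert T ({B \<in> F. e \<in> B} - {C}))"
        using finM by (intro card_mono) auto
      also have "\<dots> \<le> card {B \<in> F. e \<in> B}" using 2 C finM by (intro card_replace_le) auto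
      finally show ?thesis using D(4)[OF 2(1)] by simp
    next
      case 3
      have "{B \<in> ?F. e \<in> B} \<subseteq> insert (sdiff T C) ({B \<in> F. e \<in> B} - {C})"
        by (rule subsetI, elim CollectE conjE insertE) (use 3 in simp_all)
      then have "card {B \<in> ?F. e \<in> B} \<le> card (insert (sdiff T C) ({B \<in> F. e \<in> B} - {C}))"
        using finM by (intro card_mono) auto
      also have "\<dots> \<le> card {B \<in> F. e \<in> B}" using 3 C finM by (intro card_replace_le) auto
      finally show ?thesis using D(4)[OF 3(1)] by simp
    next
      case 4
      have "{B \<in> ?F. e \<in> B} \<subseteq> {B \<in> F. e \<in> B}"
        by (rule subsetI, elim CollectE conjE insertE) (use 4 in simp_all)
      then have "card {B \<in> ?F. e \<in> B} \<le> card {B \<in> F. e \<in> B}" using finM by (intro card_mono)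
      then show ?thesis using D(4)[OF 4(1)] by simp
    qed
  next
    fix Z assume Z: "Z \<subseteq> insert n E" "even_set Z"
    have "C \<in> span2 ?F"
      using span2_step[of T ?F, OF _ span2_base[of "sdiff T C" ?F]] by (simp add: sdiff_cancel)
    then have "F \<subseteq> span2 ?F" by (auto intro: span2_base)
    then show "Z \<in> span2 ?F" using span2_add_triangle[OF F T _ _ Z, of ?F] by blast
  qed
qed

lemma two_basis_add_member:
  assumes F: "two_basis E F" "finite E" and n: "n \<notin> E" and T: "n \<in> T" "T \<subseteq> insert n E" "even_set T"
    and CT: "\<And>e. e \<in> T \<Longrightarrow> card {B \<in> F. e \<in> B} \<le> 1"
  shows "two_basis (insert n E) (insert T F)"
proof -
  note D = two_basisD[OF F(1)]
  have finM: "finite {B \<in> F. e \<in> B}" for e using D(1) by simp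
  show ?thesis
    unfolding two_basis_def
  proof (intro conjI ballI allI impI)
    show "finite (insert T F)" using D by simp
  next
    fix B assume B: "B \<in> insert T F"
    then show "B \<subseteq> insert n E" "even_set B" using D(2,3) T by blast+
  next
    fix e assume e: "e \<in> insert n E"
    show "card {B \<in> insert T F. e \<in> B} \<le> 2"
    proof (cases "e \<in> T")
      case True
      have "{B \<in> insert T F. e \<in> B} \<subseteq> insert T {B \<in> F. e \<in> B}" by blast
      then have "card {B \<in> insert T F. e \<in> B} \<le> card (insert T {B \<in> F. e \<in> B})"
        using finM by (intro card_mono) auto
      also have "\<dots> \<le> Suc (card {B \<in> F. e \<in> B})" by (rule card_insert_le_m1) simp_all
      finally show ?thesis using CT[OF True] by simp
    next
      case False
      then have "{B \<in> insert T F. e \<in> B} = {B \<in> F. e \<in> B}" by blast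
      moreover have "e \<in> E" using False e T by blast
      ultimately show ?thesis using D(4)[of e] by simp
    qed
  next
    fix Z assume Z: "Z \<subseteq> insert n E" "even_set Z"
    have "F \<subseteq> span2 (insert T F)" by (auto intro: span2_base)
    then show "Z \<in> span2 (insert T F)" using span2_add_triangle[OF F T _ _ Z, of "insert T F"] by blast
  qed
qed

lemma card_gt_1_other:
  assumes "card S > 1" "x \<in> S"
  obtains y where "y \<in> S" "y \<noteq> x"
proof -
  have "S \<noteq> {x}" using assms(1) by auto
  then show thesis using assms(2) that by blast
qed

text \<open>In a drawing, the chord \<open>a b\<close> runs along the path \<open>a w b\<close>, inside a face that contains this corner.
  If no member contains both edges of the corner, then parity at \<open>w\<close> forces each member through one of
  them to use the third edge at \<open>w\<close>, so at most two members meet the corner at all. Then either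
  there is room for the triangle \<open>a w b\<close> as an additional member, or one of the two edges lies in no
  member and the triangle can be split off from a member through the other.\<close>

lemma maclane_add_chord:
  assumes "maclane E" "{a, w} \<in> E" "{b, w} \<in> E" "a \<noteq> b" "a \<noteq> w" "b \<noteq> w" "card {e \<in> E. w \<in> e} \<le> 3"
  shows "maclane (insert {a, b} E)"
proof (cases "{a, b} \<in> E")
  case True
  then show ?thesis using assms by (simp add: insert_absorb)
next
  case n: False
  obtain F where F: "two_basis E F" and g: "graph_edges E" using assms(1) by (auto simp: maclane_def)
  note D = two_basisD[OF F]
  have fin: "finite E" using g by (simp add: graph_edges_def)
  have finC: "finite C" if "C \<in> F" for C using D(2)[OF that] fin finite_subset by blast
  have finM: "finite {B \<in> F. e \<in> B}" for e using D(1) by simp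
  define T where "T = {{a,b},{b,w},{w,a}}"
  have evT: "even_set T" unfolding T_def using assms(4-6) by (intro even_triangle) simp
  have T: "{a,b} \<in> T" "T \<subseteq> insert {a,b} E" using assms(2,3) by (auto simp: T_def insert_commute)
  have memT: "e \<in> T \<Longrightarrow> e = {a,b} \<or> e = {a,w} \<or> e = {b,w}" for e by (auto simp: T_def insert_commute)
  have noab: "{B \<in> F. {a,b} \<in> B} = {}" using n D(2) by blast
  have g': "graph_edges (insert {a,b} E)" using g assms(4) by (simp add: graph_edges_def)
  have *: "\<exists>F'. two_basis (insert {a,b} E) F'"
    if C: "C \<in> F" "{a',w} \<in> C" "{B \<in> F. {b',w} \<in> B} = {}" and ab: "{a',b'} = {a,b}" for C a' b'
  proof -
    have "{B \<in> F. e \<in> B} = {}" if "e \<in> T" "e \<notin> C" for e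
      using memT[OF that(1)] that(2) noab C ab by (auto simp: doubleton_eq_iff)
    then show ?thesis using two_basis_split_member[OF F fin n T evT C(1)] by blast
  qed
  have saturated: "\<exists>F'. two_basis (insert {a,b} E) F'"
    if no: "\<And>C. C \<in> F \<Longrightarrow> {a,w} \<in> C \<Longrightarrow> {b,w} \<notin> C" and big: "card {B \<in> F. {a',w} \<in> B} > 1"
      and ab: "{a',b'} = {a,b}" for a' b'
  proof -
    have no': "{a',w} \<in> C \<Longrightarrow> {b',w} \<in> C \<Longrightarrow> C \<in> F \<Longrightarrow> False" for C
      using no[of C] ab by (auto simp: doubleton_eq_iff)
    have E': "{a',w} \<in> E" "{b',w} \<in> E" "{a',w} \<noteq> {b',w}" using assms(2-4) ab by (auto simp: doubleton_eq_iff)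
    have "{B \<in> F. {a',w} \<in> B} \<noteq> {}" using big by (metis card.empty not_less_zero)
    then obtain C1 where C1': "C1 \<in> {B \<in> F. {a',w} \<in> B}" by (meson equals0I)
    obtain C2 where C2': "C2 \<in> {B \<in> F. {a',w} \<in> B}" "C2 \<noteq> C1"
      by (rule card_gt_1_other[OF big C1'])
    have C1: "C1 \<in> F" "{a',w} \<in> C1" and C2: "C2 \<in> F" "{a',w} \<in> C2" "C2 \<noteq> C1"
      using C1' C2' by simp_all
    obtain f where f: "f \<in> C1" "w \<in> f" "f \<noteq> {a',w}"
      by (rule even_set_other_edge[OF finC[OF C1(1)] D(3)[OF C1(1)] C1(2), of w]) simp_all
    have fE: "f \<in> E" "f \<noteq> {b',w}" using f C1 D(2) no' by blast+
    have three: "{e \<in> E. w \<in> e} = {f, {a',w}, {b',w}}"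
    proof (rule card_seteq[symmetric])
      show "card {e \<in> E. w \<in> e} \<le> card {f, {a',w}, {b',w}}" using assms(7) f(3) fE(2) E'(3) by simp
    qed (use fin E' fE f in auto)
    have other: "f \<in> B" if B: "B \<in> F" "{x,w} \<in> B" "{x,w} = {a',w} \<or> {x,w} = {b',w}" for B x
    proof -
      obtain h where h: "h \<in> B" "w \<in> h" "h \<noteq> {x,w}"
        by (rule even_set_other_edge[OF finC[OF B(1)] D(3)[OF B(1)] B(2), of w]) simp_all
      then have "h \<in> {f, {a',w}, {b',w}}" using three D(2)[OF B(1)] by blast
      then consider "h = f" | "h = {a',w}" | "h = {b',w}" by (elim insertE) simp_all
      then show ?thesis
      proof cases
        case 1
        then show ?thesis using h(1) by simp
      next
        case 2
        then have "{x,w} = {b',w}" using B(3) h(3) by metis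
        then show ?thesis using no'[of B] 2 h(1) B(1,2) by simp
      next
        case 3
        then have "{x,w} = {a',w}" using B(3) h(3) by metis
        then show ?thesis using no'[of B] 3 h(1) B(1,2) by simp
      qed
    qed
    have M: "{B \<in> F. f \<in> B} = {C1, C2}"
      using D(4)[OF fE(1)] finM C1 C2 f other[OF C2(1,2)] by (intro card_le_2_doubleton) auto
    have "{B \<in> F. {b',w} \<in> B} = {}"
    proof (rule ccontr)
      assume "{B \<in> F. {b',w} \<in> B} \<noteq> {}"
      then obtain B where B: "B \<in> F" "{b',w} \<in> B" by blast
      then have "f \<in> B" using other[of B b'] by blast
      then have "{a',w} \<in> B" using M B C1 C2 by blast
      then show False using no' B by blast
    qed
    from *[OF C1 this ab] show ?thesis .
  qed
  have "\<exists>F'. two_basis (insert {a,b} E) F'"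
  proof (cases "\<exists>C\<in>F. {a,w} \<in> C \<and> {b,w} \<in> C")
    case True
    then obtain C where C: "C \<in> F" "{a,w} \<in> C" "{b,w} \<in> C" by blast
    have "{B \<in> F. e \<in> B} = {}" if "e \<in> T" "e \<notin> C" for e
      using memT[OF that(1)] that(2) noab C by auto
    then show ?thesis using two_basis_split_member[OF F fin n T evT C(1)] by blast
  next
    case False
    show ?thesis
    proof (cases "card {B \<in> F. {a,w} \<in> B} > 1 \<or> card {B \<in> F. {b,w} \<in> B} > 1")
      case True
      then show ?thesis using saturated[of a b] saturated[of b a] False by (auto simp: insert_commute)
    next
      case f2: False
      have "card {B \<in> F. e \<in> B} \<le> 1" if "e \<in> T" for e
      proof -
        have "card {B \<in> F. {a,b} \<in> B} = 0" unfolding noab by simp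
        then show ?thesis using memT[OF that] f2 by (elim disjE) simp_all
      qed
      then show ?thesis using two_basis_add_member[OF F fin n T evT] by blast
    qed
  qed
  then show ?thesis using g' by (auto simp: maclane_def)
qed

section \<open>Spanning trees and bases from face codes\<close>

text \<open>Trees in \<open>E\<close> grown from the root \<open>v\<close>, with vertex set \<open>W\<close> and edge set \<open>T\<close>. Growing by leaves
  gives the induction used for arcs in drawn trees, and the same notion serves for Kempe chains.\<close>

inductive tree_in :: "'a set set \<Rightarrow> 'a \<Rightarrow> 'a set \<Rightarrow> 'a set set \<Rightarrow> bool" for E v where
  root: "tree_in E v {v} {}"
| leaf: "tree_in E v W T \<Longrightarrow> x \<in> W \<Longrightarrow> u \<notin> W \<Longrightarrow> {x, u} \<in> E \<Longrightarrow>
    tree_in E v (insert u W) (insert {x, u} T)"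

lemma tree_in_basic:
  assumes "tree_in E v W T"
  shows "v \<in> W" "finite W" "finite T" "T \<subseteq> E" "\<Union>T \<subseteq> W" "card W = card T + 1"
  using assms
proof (induction rule: tree_in.induct)
  case (leaf W T x u)
  {
    case 1 then show ?case using leaf by simp
  next
    case 2 then show ?case using leaf by simp
  next
    case 3 then show ?case using leaf by simp
  next
    case 4 then show ?case using leaf by simp
  next
    case 5 then show ?case using leaf by auto
  next
    case 6
    have "{x, u} \<notin> T" using leaf by blast
    then show ?case using leaf by simp
  }
qed simp_all

text \<open>A largest tree is closed under adjacency, since an edge leaving it would be a further leaf.\<close>

lemma tree_in_spanning:
  assumes "finite E" "\<And>e. e \<in> E \<Longrightarrow> card e = 2"
  obtains W T where "tree_in E v W T" "\<And>e. e \<in> E \<Longrightarrow> e \<inter> W \<noteq> {} \<Longrightarrow> e \<subseteq> W"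
proof -
  let ?P = "\<lambda>(W, T). tree_in E v W T"
  have bound: "\<forall>y. ?P y \<longrightarrow> card (snd y) < Suc (card E)"
  proof (intro allI impI)
    fix y assume "?P y"
    then have "snd y \<subseteq> E" using tree_in_basic(4)[of E v "fst y" "snd y"] by (cases y) simp
    then show "card (snd y) < Suc (card E)" using assms(1) by (simp add: card_mono less_Suc_eq_le)
  qed
  have "?P ({v}, {})" by (simp add: tree_in.root)
  then obtain y where y: "?P y" "\<forall>z. ?P z \<longrightarrow> card (snd z) \<le> card (snd y)"
    using ex_has_greatest_nat[of ?P "({v}, {})" "\<lambda>y. card (snd y)" "Suc (card E)"] bound by blast
  obtain W T where WT: "y = (W, T)" by (cases y)
  have tr: "tree_in E v W T" using y(1) WT by simp
  note B = tree_in_basic[OF tr]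
  show thesis
  proof (rule that[OF tr])
    fix e assume e: "e \<in> E" "e \<inter> W \<noteq> {}"
    then obtain x where x: "x \<in> e" "x \<in> W" by blast
    obtain a b where ab: "e = {a, b}" "a \<noteq> b" using assms(2)[OF e(1)] by (meson card_2_iff)
    obtain u where u: "e = {x, u}" "u \<noteq> x" using ab x(1) by auto
    show "e \<subseteq> W"
    proof (rule ccontr)
      assume "\<not> e \<subseteq> W"
      then have uW: "u \<notin> W" using u x by simp
      have "tree_in E v (insert u W) (insert {x,u} T)"
        using tr x(2) uW e(1) u(1) by (intro tree_in.leaf) simp_all
      then have "card (insert {x,u} T) \<le> card T" using y(2) WT by force
      moreover have "{x,u} \<notin> T" using uW B(5) by blast
      ultimately show False using B(3) by simp
    qed
  qed
qed

lemma tree_in_acyclic: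
  assumes "tree_in E v W T" "Z \<subseteq> T" "even_set Z"
  shows "Z = {}"
  using assms
proof (induction arbitrary: Z rule: tree_in.induct)
  case (leaf W T x u)
  note B = tree_in_basic[OF leaf.hyps(1)]
  have "{x,u} \<notin> Z"
  proof
    assume m: "{x,u} \<in> Z"
    have "finite Z" using leaf.prems(1) B(3) finite_subset by (metis finite_insert)
    then obtain f where "f \<in> Z" "u \<in> f" "f \<noteq> {x,u}"
      by (rule even_set_other_edge[OF _ leaf.prems(2) m, of u]) simp_all
    then show False using leaf.prems(1) leaf.hyps(3) B(5) by blast
  qed
  then have "Z \<subseteq> T" using leaf.prems(1) by blast
  then show ?case using leaf.IH leaf.prems(2) by blast
qed simp

text \<open>The combinatorial core of MacLane's theorem. The elements of \<open>Cd\<close> stand for the faces, described by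
  their winding numbers about the fundamental cycles \<open>Zc e\<close>, and \<open>d0 g\<close>, \<open>d1 g\<close> for the faces on the
  two sides of \<open>g\<close>. Each sum of fundamental cycles is the boundary of the set of faces on which the
  sum of winding numbers is odd. There are \<open>2 ^ card S\<close> such sums, and, because complementary sets of
  faces have equal boundaries, no more than \<open>2 ^ card S\<close> boundaries. So every boundary is such a sum;
  in particular it is even. This avoids any local study of the drawing at a vertex.\<close>

lemma two_basis_of_codes:
  fixes d0 d1 :: "'a set \<Rightarrow> 'a set \<Rightarrow> int" and Zc :: "'a set \<Rightarrow> 'a set set"
  assumes fin: "finite E" and SE: "S \<subseteq> E"
    and cyc: "\<And>e. e \<in> S \<Longrightarrow> Zc e \<subseteq> E" "\<And>e. e \<in> S \<Longrightarrow> even_set (Zc e)"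
      "\<And>e e'. e \<in> S \<Longrightarrow> e' \<in> S \<Longrightarrow> e' \<in> Zc e \<longleftrightarrow> e' = e"
    and det: "\<And>Z. Z \<subseteq> E \<Longrightarrow> even_set Z \<Longrightarrow> Z \<inter> S = {} \<Longrightarrow> Z = {}"
    and Cd: "finite Cd" "card Cd \<le> card S + 1" "Cd \<noteq> {}"
    and d: "\<And>g. g \<in> E \<Longrightarrow> d0 g \<in> Cd" "\<And>g. g \<in> E \<Longrightarrow> d1 g \<in> Cd"
    and jump: "\<And>g e. g \<in> E \<Longrightarrow> e \<in> S \<Longrightarrow> odd (d1 g e - d0 g e) \<longleftrightarrow> g \<in> Zc e"
  shows "\<exists>F. two_basis E F"
proof -
  define bd where "bd I = {g \<in> E. (d0 g \<in> I) \<noteq> (d1 g \<in> I)}" for I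
  define side where "side S' = {c \<in> Cd. odd (\<Sum>e\<in>S'. c e)}" for S'
  have finS: "finite S" using SE fin finite_subset by blast
  have bdE: "bd I \<subseteq> E" for I by (auto simp: bd_def)
  have finbd: "finite (bd I)" for I using bdE fin finite_subset by blast
  have bd_sdiff: "bd (sdiff I J) = sdiff (bd I) (bd J)" for I J
    by (rule set_eqI) (auto simp: bd_def)
  have bd_empty: "bd {} = {}" by (simp add: bd_def)
  have bd_compl: "bd (sdiff Cd I) = bd I" for I
    by (rule set_eqI) (use d in \<open>auto simp: bd_def\<close>)
  have side_single: "bd (side {e}) = Zc e" if "e \<in> S" for e
  proof (rule set_eqI)
    fix g
    show "g \<in> bd (side {e}) \<longleftrightarrow> g \<in> Zc e"
    proof (cases "g \<in> E")
      case True
      have "g \<in> bd (side {e}) \<longleftrightarrow> odd (d0 g e) \<noteq> odd (d1 g e)"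
        using True d[OF True] by (simp add: bd_def side_def) blast
      also have "\<dots> \<longleftrightarrow> odd (d1 g e - d0 g e)" by auto
      finally show ?thesis using jump[OF True that] by simp
    next
      case False
      then show ?thesis using cyc(1)[OF that] by (auto simp: bd_def)
    qed
  qed
  have side_insert: "side (insert e S') = sdiff (side {e}) (side S')" if "finite S'" "e \<notin> S'" for e S'
    by (rule set_eqI) (use that in \<open>auto simp: side_def\<close>)
  have side_props: "even_set (bd (side S')) \<and> bd (side S') \<inter> S = S'" if "S' \<subseteq> S" for S'
    using finite_subset[OF that finS] that
  proof (induction S' rule: finite_induct)
    case empty
    have "side {} = {}" by (simp add: side_def)
    then show ?case using bd_empty by simp
  next
    case (insert e S')
    have eq: "bd (side (insert e S')) = sdiff (Zc e) (bd (side S'))"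
      unfolding side_insert[OF insert.hyps] bd_sdiff using insert.prems by (simp add: side_single)
    have IH: "even_set (bd (side S'))" "bd (side S') \<inter> S = S'" using insert by simp_all
    have eS: "e \<in> S" using insert by simp
    have "finite (Zc e)" using cyc(1)[OF eS] fin finite_subset by blast
    then have "even_set (sdiff (Zc e) (bd (side S')))"
      using cyc(2)[OF eS] IH finbd by (intro even_set_sdiff)
    moreover have "x \<in> sdiff (Zc e) (bd (side S')) \<inter> S \<longleftrightarrow> x \<in> insert e S'" for x
    proof (cases "x \<in> S")
      case True
      then have "x \<in> bd (side S') \<longleftrightarrow> x \<in> S'" using IH(2) by blast
      then show ?thesis using cyc(3)[OF eS True] True insert.hyps(2) by auto
    next
      case False
      then show ?thesis using insert.prems by blast
    qed
    ultimately show ?case unfolding eq by blast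
  qed
  \<comment> \<open>\<open>?B\<close> collects all boundaries and \<open>?Z\<close> those that are sums of fundamental cycles.\<close>
  let ?B = "bd ` Pow Cd" and ?Z = "(\<lambda>S'. bd (side S')) ` Pow S"
  have ZB: "?Z \<subseteq> ?B" by (auto simp: side_def)
  have finB: "finite ?B" using Cd(1) by simp
  have "inj_on (\<lambda>S'. bd (side S')) (Pow S)"
  proof (rule inj_onI)
    fix X Y assume XY: "X \<in> Pow S" "Y \<in> Pow S" and eq: "bd (side X) = bd (side Y)"
    have "X = bd (side X) \<inter> S" using side_props[of X] XY(1) by blast
    also have "\<dots> = Y" unfolding eq using side_props[of Y] XY(2) by blast
    finally show "X = Y" .
  qed
  then have cZ: "card ?Z = 2 ^ card S" using finS by (simp add: card_image card_Pow)
  obtain c0 where c0: "c0 \<in> Cd" using Cd(3) by blast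
  have "?B \<subseteq> bd ` Pow (Cd - {c0})"
  proof
    fix X assume "X \<in> ?B"
    then obtain I where I: "I \<subseteq> Cd" "X = bd I" by blast
    show "X \<in> bd ` Pow (Cd - {c0})"
    proof (cases "c0 \<in> I")
      case True
      have "sdiff Cd I \<in> Pow (Cd - {c0})" using I True c0 by auto
      then show ?thesis using I(2) bd_compl[of I] by (metis imageI)
    next
      case False
      then show ?thesis using I by blast
    qed
  qed
  then have "card ?B \<le> card (bd ` Pow (Cd - {c0}))" using Cd(1) by (intro card_mono) simp_all
  also have "\<dots> \<le> card (Pow (Cd - {c0}))" using Cd(1) by (intro card_image_le) simp
  also have "\<dots> = 2 ^ (card Cd - 1)" using Cd(1) c0 by (simp add: card_Pow)
  also have "\<dots> \<le> 2 ^ card S" using Cd(2) by (intro power_increasing) simp_all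
  finally have "?Z = ?B" using ZB finB cZ by (intro card_seteq) simp_all
  then have even_bd: "even_set (bd I)" if "I \<subseteq> Cd" for I
  proof -
    have "bd I \<in> ?Z" using \<open>?Z = ?B\<close> that by blast
    then show ?thesis using side_props by auto
  qed
  let ?F = "(\<lambda>c. bd {c}) ` Cd"
  have span: "bd I \<in> span2 ?F" if "I \<subseteq> Cd" for I
    using finite_subset[OF that Cd(1)] that
  proof (induction I rule: finite_induct)
    case empty
    then show ?case using bd_empty span2_empty by simp
  next
    case (insert c I)
    have "sdiff {c} I = insert c I" using insert.hyps by auto
    then have "bd (insert c I) = sdiff (bd {c}) (bd I)" using bd_sdiff[of "{c}" I] by simp
    moreover have "bd {c} \<in> ?F" using insert.prems by blast
    ultimately show ?case using insert.IH insert.prems span2_step by (metis insert_subset)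
  qed
  have "two_basis E ?F"
    unfolding two_basis_def
  proof (intro conjI ballI allI impI)
    show "finite ?F" using Cd(1) by simp
  next
    fix C assume "C \<in> ?F"
    then obtain c where c: "c \<in> Cd" "C = bd {c}" by blast
    show "C \<subseteq> E" using c bdE by simp
    show "even_set C" using c even_bd[of "{c}"] by simp
  next
    fix g assume "g \<in> E"
    have "{C \<in> ?F. g \<in> C} \<subseteq> {bd {d0 g}, bd {d1 g}}"
      by (auto simp: bd_def)
    then have "card {C \<in> ?F. g \<in> C} \<le> card {bd {d0 g}, bd {d1 g}}" by (intro card_mono) simp_all
    also have "\<dots> \<le> 2" by (simp add: card_insert_if)
    finally show "card {C \<in> ?F. g \<in> C} \<le> 2" .
  next
    fix Z assume Z: "Z \<subseteq> E" "even_set Z"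
    let ?Y = "bd (side (Z \<inter> S))"
    have Y: "even_set ?Y" "?Y \<inter> S = Z \<inter> S" using side_props[of "Z \<inter> S"] by auto
    have finZ: "finite Z" using Z(1) fin finite_subset by blast
    have "even_set (sdiff Z ?Y)" by (rule even_set_sdiff[OF finZ finbd Z(2) Y(1)])
    moreover have "sdiff Z ?Y \<subseteq> E" using Z(1) bdE by (rule sdiff_subset)
    moreover have "x \<notin> sdiff Z ?Y \<inter> S" for x
    proof (cases "x \<in> S")
      case True
      then have "x \<in> ?Y \<longleftrightarrow> x \<in> Z" using Y(2) by blast
      then show ?thesis by simp
    qed simp
    ultimately have e: "sdiff Z ?Y = {}" using det[of "sdiff Z ?Y"] by blast
    have "x \<in> Z \<longleftrightarrow> x \<in> ?Y" for x using e in_sdiff[of x Z ?Y] by simp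
    then have "Z = ?Y" by blast
    then show "Z \<in> span2 ?F" using span[of "side (Z \<inter> S)"] by (simp add: side_def)
  qed
  then show ?thesis by blast
qed

section \<open>Trees and fundamental cycles in a plane drawing\<close>

text \<open>An arc with interior would embed an open subset of the plane into the line.\<close>

lemma arc_misses_open:
  fixes c :: "real \<Rightarrow> complex"
  assumes "arc c" "open U" "U \<noteq> {}"
  obtains a where "a \<in> U" "a \<notin> path_image c"
proof (rule ccontr)
  assume neg: "\<not> thesis"
  have sub: "U \<subseteq> path_image c" using neg that by blast
  obtain h where h: "homeomorphism {0..1} (path_image c) c h"
    using homeomorphism_arc[OF assms(1)] by blast
  have "continuous_on U h" using h sub by (meson continuous_on_subset homeomorphism_cont2)
  moreover have "inj_on h U"
    using h sub by (meson homeomorphism_def inj_on_inverseI inj_on_subset)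
  ultimately have "DIM(complex) \<le> DIM(real)"
    using assms(2,3) by (intro invariance_of_dimension[of U h])
  then show False by simp
qed

lemma simple_closed_same_side:
  assumes "simple_path c" "pathfinish c = pathstart c" "a \<notin> path_image c" "b \<notin> path_image c"
    and "winding_number c a = winding_number c b"
  shows "connected_component (- path_image c) a b"
proof -
  note J = Jordan_inside_outside[OF assms(1,2)]
  have in1: "winding_number c z \<noteq> 0" if "z \<in> inside (path_image c)" for z
    using simple_closed_path_norm_winding_number_inside[OF assms(1) that] by auto
  have out0: "winding_number c z = 0" if "z \<in> outside (path_image c)" for z
    using winding_number_zero_in_outside[OF _ assms(2) that] assms(1) simple_path_imp_path by blast
  have io: "z \<in> inside (path_image c) \<or> z \<in> outside (path_image c)" if "z \<notin> path_image c" for z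
    using J that by blast
  have sub: "inside (path_image c) \<subseteq> - path_image c" "outside (path_image c) \<subseteq> - path_image c"
    using J by blast+
  show ?thesis
  proof (cases "a \<in> inside (path_image c)")
    case True
    then have "b \<in> inside (path_image c)" using in1[of a] out0[of b] io[OF assms(4)] assms(5) by auto
    then show ?thesis using True sub(1) J unfolding connected_component_def by blast
  next
    case False
    then have a: "a \<in> outside (path_image c)" using io[OF assms(3)] by blast
    then have "b \<in> outside (path_image c)" using in1[of b] out0[of a] io[OF assms(4)] assms(5) by auto
    then show ?thesis using a sub(2) J unfolding connected_component_def by blast
  qed
qed

text \<open>A fixed drawing. Arcs are only continuous, so the faces are studied through winding numbers and
  Janiszewski's theorem and never through local pictures of the arcs.\<close>

locale plane_graph =
  fixes V :: "'a set" and E :: "'a set set" and p :: "'a \<Rightarrow> complex" and \<gamma> :: "'a set \<Rightarrow> real \<Rightarrow> complex"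
  assumes finV: "finite V" and edgeE: "\<And>e. e \<in> E \<Longrightarrow> e \<subseteq> V \<and> card e = 2"
    and draw: "plane_drawing V E p \<gamma>"
begin

abbreviation im :: "'a set \<Rightarrow> complex set" where "im e \<equiv> path_image (\<gamma> e)"

abbreviation wn :: "'a set \<Rightarrow> complex \<Rightarrow> complex" where "wn e \<equiv> winding_number (\<gamma> e)"

lemma finE: "finite E"
proof -
  have "E \<subseteq> Pow V" using edgeE by blast
  then show ?thesis using finV finite_subset by blast
qed

lemma inj_p: "inj_on p V" using draw by (simp add: plane_drawing_def)

lemma p_eq: "x \<in> V \<Longrightarrow> y \<in> V \<Longrightarrow> p x = p y \<longleftrightarrow> x = y"
  using inj_p by (simp add: inj_on_eq_iff)

lemma arcE: "e \<in> E \<Longrightarrow> arc (\<gamma> e)" using draw by (simp add: plane_drawing_def)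

lemma ends: "e \<in> E \<Longrightarrow> {pathstart (\<gamma> e), pathfinish (\<gamma> e)} = p ` e"
  using draw by (simp add: plane_drawing_def)

lemma im_vertices: "e \<in> E \<Longrightarrow> im e \<inter> p ` V = p ` e" using draw by (simp add: plane_drawing_def)

lemma im_Int: "e \<in> E \<Longrightarrow> f \<in> E \<Longrightarrow> e \<noteq> f \<Longrightarrow> im e \<inter> im f = p ` (e \<inter> f)"
  using draw by (simp add: plane_drawing_def)

lemma p_in_im: "e \<in> E \<Longrightarrow> x \<in> e \<Longrightarrow> p x \<in> im e"
  using im_vertices by blast

lemma compact_im: "e \<in> E \<Longrightarrow> compact (im e)"
  using arcE by (simp add: compact_arc_image)

lemma oriented_arc:
  assumes "{x, y} \<in> E"
  obtains \<delta> s where "arc \<delta>" "pathstart \<delta> = p x" "pathfinish \<delta> = p y" "path_image \<delta> = im {x, y}"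
    "s = 1 \<or> s = (- 1 :: int)"
    "\<And>a. a \<notin> im {x, y} \<Longrightarrow> winding_number \<delta> a = of_int s * wn {x, y} a"
proof -
  note arc = arcE[OF assms]
  have e: "{pathstart (\<gamma> {x,y}), pathfinish (\<gamma> {x,y})} = {p x, p y}" using ends[OF assms] by simp
  consider "pathstart (\<gamma> {x,y}) = p x" "pathfinish (\<gamma> {x,y}) = p y"
    | "pathstart (\<gamma> {x,y}) = p y" "pathfinish (\<gamma> {x,y}) = p x"
    using e by (auto simp: doubleton_eq_iff)
  then show thesis
  proof cases
    case 1
    then show ?thesis using that[of "\<gamma> {x,y}" 1] arc by simp
  next
    case 2
    then show ?thesis
      using that[of "reversepath (\<gamma> {x,y})" "-1"] arc
      by (simp add: arc_reversepath winding_number_reversepath arc_imp_path)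
  qed
qed

definition supp :: "('a set \<Rightarrow> int) \<Rightarrow> 'a set set" where "supp z = {e. z e \<noteq> 0}"

text \<open>The winding number of an integral 1-chain of edges. A single summand is the winding number of an
  open arc and is not an integer; only its continuity off the arc matters.\<close>

definition chain_wn :: "('a set \<Rightarrow> int) \<Rightarrow> complex \<Rightarrow> complex" where
  "chain_wn z a = (\<Sum>e\<in>E. of_int (z e) * wn e a)"

text \<open>\<open>A\<close> is the arc from \<open>x\<close> to \<open>y\<close> in the drawn tree, and \<open>z\<close> the corresponding chain: it
  records which edges are traversed and in which direction relative to \<open>\<gamma>\<close>.\<close>

definition tree_arc :: "'a set set \<Rightarrow> ('a set \<Rightarrow> int) \<Rightarrow> (real \<Rightarrow> complex) \<Rightarrow> 'a \<Rightarrow> 'a \<Rightarrow> bool" where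
  "tree_arc T z A x y \<longleftrightarrow> arc A \<and> pathstart A = p x \<and> pathfinish A = p y \<and> supp z \<subseteq> T \<and>
     path_image A = (\<Union>e\<in>supp z. im e) \<and> (\<forall>e. z e \<in> {-1, 0, 1}) \<and>
     (\<forall>a. a \<notin> path_image A \<longrightarrow> winding_number A a = chain_wn z a) \<and>
     (\<forall>v. odd (card {e \<in> supp z. v \<in> e}) \<longleftrightarrow> v = x \<or> v = y)"

lemma chain_wn_upd:
  assumes "e \<in> E" "z e = 0"
  shows "chain_wn (z(e := s)) a = chain_wn z a + of_int s * wn e a"
proof -
  have "(\<Sum>h\<in>E. of_int ((z(e := s)) h) * wn h a) =
    of_int s * wn e a + (\<Sum>h\<in>E - {e}. of_int ((z(e := s)) h) * wn h a)"
    using finE assms(1) by (subst sum.remove[of E e]) auto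
  also have "(\<Sum>h\<in>E - {e}. of_int ((z(e := s)) h) * wn h a) = (\<Sum>h\<in>E - {e}. of_int (z h) * wn h a)"
    by (intro sum.cong) auto
  also have "\<dots> = (\<Sum>h\<in>E. of_int (z h) * wn h a)"
    using finE assms by (simp add: sum.remove[of E e "\<lambda>h. of_int (z h) * wn h a"])
  finally show ?thesis by (simp add: chain_wn_def)
qed

lemma supp_upd: "z e = 0 \<Longrightarrow> s \<noteq> 0 \<Longrightarrow> supp (z(e := s)) = insert e (supp z)"
  by (auto simp: supp_def)

lemma odd_card_supp_upd:
  assumes "finite (supp z)" "z e = 0" "s \<noteq> 0"
  shows "odd (card {h \<in> supp (z(e := s)). v \<in> h}) \<longleftrightarrow> odd (card {h \<in> supp z. v \<in> h}) \<noteq> (v \<in> e)"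
proof -
  have e: "e \<notin> supp z" using assms by (simp add: supp_def)
  have "{h \<in> supp (z(e := s)). v \<in> h} = (if v \<in> e then insert e {h \<in> supp z. v \<in> h} else {h \<in> supp z. v \<in> h})"
    using supp_upd[of z e s, OF assms(2,3)] by auto
  then show ?thesis using e assms(1) by simp
qed

lemma tree_arc_reverse:
  assumes "tree_arc T z A x y"
  shows "tree_arc T (\<lambda>e. - z e) (reversepath A) y x"
proof -
  have s: "supp (\<lambda>e. - z e) = supp z" by (simp add: supp_def)
  have c: "chain_wn (\<lambda>e. - z e) a = - chain_wn z a" for a
    by (simp add: chain_wn_def sum_negf)
  show ?thesis
    using assms unfolding tree_arc_def s c
    by (auto simp: arc_reversepath winding_number_reversepath arc_imp_path)
qed

lemma tree_arc_single:
  assumes "{x, u} \<in> E"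
  shows "\<exists>z A. tree_arc (insert {x, u} T) z A x u"
proof -
  obtain \<delta> s where \<delta>: "arc \<delta>" "pathstart \<delta> = p x" "pathfinish \<delta> = p u" "path_image \<delta> = im {x, u}"
    "s = 1 \<or> s = (- 1 :: int)" "\<And>a. a \<notin> im {x, u} \<Longrightarrow> winding_number \<delta> a = of_int s * wn {x, u} a"
    by (rule oriented_arc[OF assms]) blast
  let ?z = "(\<lambda>_. 0)({x,u} := s)"
  have s0: "s \<noteq> 0" using \<delta>(5) by auto
  have s: "supp ?z = {{x,u}}" using s0 by (auto simp: supp_def)
  have c: "chain_wn ?z a = of_int s * wn {x,u} a" for a
    by (subst chain_wn_upd[OF assms]) (simp_all add: chain_wn_def)
  have deg: "odd (card {e. e = {x,u} \<and> v \<in> e}) \<longleftrightarrow> v = x \<or> v = u" for v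
  proof -
    have "{e. e = {x,u} \<and> v \<in> e} = (if v \<in> {x,u} then {{x,u}} else {})" by auto
    then show ?thesis by simp
  qed
  have "tree_arc (insert {x,u} T) ?z \<delta> x u"
    unfolding tree_arc_def s c using \<delta> deg by auto
  then show ?thesis by blast
qed

lemma tree_arc_snoc:
  assumes A: "tree_arc T z A y x" and e: "{x, u} \<in> E" and T: "T \<subseteq> E" "u \<notin> \<Union>T"
  shows "\<exists>z' A'. tree_arc (insert {x, u} T) z' A' y u"
proof -
  obtain \<delta> s where \<delta>: "arc \<delta>" "pathstart \<delta> = p x" "pathfinish \<delta> = p u" "path_image \<delta> = im {x, u}"
    "s = 1 \<or> s = (- 1 :: int)" "\<And>a. a \<notin> im {x, u} \<Longrightarrow> winding_number \<delta> a = of_int s * wn {x, u} a"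
    by (rule oriented_arc[OF e]) blast
  let ?e = "{x,u}" and ?z = "z({x,u} := s)"
  note A' = A[unfolded tree_arc_def]
  have sT: "supp z \<subseteq> T" and imA: "path_image A = (\<Union>e\<in>supp z. im e)" using A' by blast+
  have s0: "s \<noteq> 0" using \<delta>(5) by auto
  have eT: "?e \<notin> T" using T(2) by blast
  then have z0: "z ?e = 0" using sT by (auto simp: supp_def)
  have fs: "finite (supp z)" using sT T(1) finE by (meson finite_subset)
  have inter: "path_image A \<inter> im ?e \<subseteq> {p x}"
  proof
    fix a assume a: "a \<in> path_image A \<inter> im ?e"
    then obtain f where f: "f \<in> supp z" "a \<in> im f" using imA by blast
    have fT: "f \<in> T" using f sT by blast
    then have "f \<noteq> ?e" using eT by blast
    then have "a \<in> p ` (f \<inter> ?e)" using im_Int[of f ?e] f fT T(1) e a by blast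
    moreover have "f \<inter> ?e \<subseteq> {x}" using fT T(2) by blast
    ultimately show "a \<in> {p x}" by blast
  qed
  have join: "pathfinish A = pathstart \<delta>" using A' \<delta>(2) by simp
  have yx: "y \<noteq> x"
  proof
    assume "y = x"
    then have "pathstart A = pathfinish A" "arc A" using A' by simp_all
    then show False using arc_distinct_ends[of A] by simp
  qed
  have ux: "u \<noteq> x" using edgeE[OF e] by auto
  have uy: "u \<noteq> y"
  proof
    assume "u = y"
    then have "odd (card {e \<in> supp z. u \<in> e})" using A' by blast
    moreover have "{e \<in> supp z. u \<in> e} = {}" using sT T(2) by blast
    ultimately show False by (metis card.empty even_zero)
  qed
  have "tree_arc (insert ?e T) ?z (A +++ \<delta>) y u"
    unfolding tree_arc_def
  proof (intro conjI allI impI)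
    show "arc (A +++ \<delta>)" using A' \<delta> inter join by (intro arc_join) auto
    show "pathstart (A +++ \<delta>) = p y" "pathfinish (A +++ \<delta>) = p u" using A' \<delta> by simp_all
    show "supp ?z \<subseteq> insert ?e T" unfolding supp_upd[of z ?e s, OF z0 s0] using sT by blast
    show im: "path_image (A +++ \<delta>) = (\<Union>e\<in>supp ?z. im e)"
      unfolding supp_upd[of z ?e s, OF z0 s0] path_image_join[OF join] imA \<delta>(4) by blast
  next
    fix f show "?z f \<in> {-1, 0, 1}" using A' \<delta>(5) by auto
  next
    fix a assume "a \<notin> path_image (A +++ \<delta>)"
    then have a: "a \<notin> path_image A" "a \<notin> path_image \<delta>" unfolding path_image_join[OF join] by blast+
    then have "winding_number (A +++ \<delta>) a = winding_number A a + winding_number \<delta> a"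
      using A' \<delta>(1) join by (intro winding_number_join) (auto simp: arc_imp_path)
    also have "\<dots> = chain_wn ?z a"
      using A' a \<delta>(4,6) chain_wn_upd[of ?e z s, OF e z0] by simp
    finally show "winding_number (A +++ \<delta>) a = chain_wn ?z a" .
  next
    fix v
    have "odd (card {e \<in> supp z. v \<in> e}) \<longleftrightarrow> v = y \<or> v = x" using A' by blast
    then show "odd (card {h \<in> supp ?z. v \<in> h}) \<longleftrightarrow> v = y \<or> v = u"
      unfolding odd_card_supp_upd[of z ?e s, OF fs z0 s0] using yx ux uy by auto
  qed
  then show ?thesis by blast
qed

lemma tree_arc_mono: "tree_arc T z A x y \<Longrightarrow> T \<subseteq> T' \<Longrightarrow> tree_arc T' z A x y"
  unfolding tree_arc_def by blast

lemma tree_arc_exists: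
  assumes "tree_in E v W T" "x \<in> W" "y \<in> W" "x \<noteq> y"
  shows "\<exists>z A. tree_arc T z A x y"
  using assms
proof (induction arbitrary: x y rule: tree_in.induct)
  case (leaf W T w u)
  note B = tree_in_basic[OF leaf.hyps(1)]
  have uT: "u \<notin> \<Union>T" using B(5) leaf.hyps(3) by blast
  have to_u: "\<exists>z A. tree_arc (insert {w,u} T) z A x' u" if x': "x' \<in> W" for x'
  proof (cases "x' = w")
    case True
    then show ?thesis using tree_arc_single[OF leaf.hyps(4)] by blast
  next
    case False
    then obtain z A where "tree_arc T z A x' w" using leaf.IH[OF x' leaf.hyps(2)] by blast
    then show ?thesis using tree_arc_snoc[OF _ leaf.hyps(4) B(4) uT] by blast
  qed
  consider "x = u" "y \<in> W" | "y = u" "x \<in> W" | "x \<in> W" "y \<in> W" using leaf.prems by blast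
  then show ?case
  proof cases
    case 1
    then show ?thesis using to_u[of y] tree_arc_reverse by blast
  next
    case 2
    then show ?thesis using to_u[of x] by blast
  next
    case 3
    then show ?thesis using leaf.IH[of x y] leaf.prems(3) tree_arc_mono by blast
  qed
qed simp

text \<open>The closed curve \<open>c\<close> formed by the edge \<open>e\<close> and the tree path between its ends. The last two
  conditions say that its part in the tree is connected and contains the ends of \<open>e\<close>; they are what
  Janiszewski's theorem needs.\<close>

definition fund_cycle :: "'a set set \<Rightarrow> 'a set \<Rightarrow> ('a set \<Rightarrow> int) \<Rightarrow> (real \<Rightarrow> complex) \<Rightarrow> bool" where
  "fund_cycle T e z c \<longleftrightarrow> simple_path c \<and> pathfinish c = pathstart c \<and>
     path_image c = (\<Union>g\<in>supp z. im g) \<and> supp z \<subseteq> insert e T \<and> z e \<noteq> 0 \<and> (\<forall>g. z g \<in> {-1, 0, 1}) \<and>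
     (\<forall>a. a \<notin> path_image c \<longrightarrow> winding_number c a = chain_wn z a) \<and> even_set (supp z) \<and>
     connected (\<Union>g\<in>supp z - {e}. im g) \<and> p ` e \<subseteq> (\<Union>g\<in>supp z - {e}. im g)"

lemma fund_cycle_exists:
  assumes tr: "tree_in E v W T" and e: "e \<in> E" "e \<notin> T" "e \<subseteq> W"
  shows "\<exists>z c. fund_cycle T e z c"
proof -
  note B = tree_in_basic[OF tr]
  obtain x y where xy: "e = {x, y}" "x \<noteq> y" using edgeE[OF e(1)] by (meson card_2_iff)
  obtain z A where A: "tree_arc T z A x y" using tree_arc_exists[OF tr _ _ xy(2)] e(3) xy(1) by blast
  note A' = A[unfolded tree_arc_def]
  have yx: "{y, x} \<in> E" "{y, x} = e" using e(1) xy(1) by (auto simp: insert_commute)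
  obtain \<delta> s where \<delta>: "arc \<delta>" "pathstart \<delta> = p y" "pathfinish \<delta> = p x" "path_image \<delta> = im e"
    "s = 1 \<or> s = (- 1 :: int)" "\<And>a. a \<notin> im e \<Longrightarrow> winding_number \<delta> a = of_int s * wn e a"
    by (rule oriented_arc[OF yx(1)]) (use yx(2) in blast)
  let ?z = "z(e := s)"
  have sT: "supp z \<subseteq> T" and imA: "path_image A = (\<Union>e\<in>supp z. im e)" using A' by blast+
  have s0: "s \<noteq> 0" using \<delta>(5) by auto
  have z0: "z e = 0" using sT e(2) by (auto simp: supp_def)
  have es: "e \<notin> supp z" using z0 by (simp add: supp_def)
  have fs: "finite (supp z)" using sT B(3) by (meson finite_subset)
  have join: "pathfinish A = pathstart \<delta>" and join': "pathfinish \<delta> = pathstart A" using A' \<delta> by simp_all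
  have inter: "path_image A \<inter> im e \<subseteq> {p x, p y}"
  proof
    fix a assume a: "a \<in> path_image A \<inter> im e"
    then obtain f where f: "f \<in> supp z" "a \<in> im f" using imA by blast
    have "f \<noteq> e" using f es by blast
    then have "a \<in> p ` (f \<inter> e)" using im_Int[of f e] f sT B(4) e(1) a by blast
    then show "a \<in> {p x, p y}" using xy(1) by blast
  qed
  have sd: "supp ?z - {e} = supp z" unfolding supp_upd[of z e s, OF z0 s0] using es by blast
  have "fund_cycle T e ?z (A +++ \<delta>)"
    unfolding fund_cycle_def sd
  proof (intro conjI allI impI)
    show "simple_path (A +++ \<delta>)" using A' \<delta> inter join join' by (intro simple_path_join_loop) auto
    show "pathfinish (A +++ \<delta>) = pathstart (A +++ \<delta>)" using A' \<delta> by simp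
    show "path_image (A +++ \<delta>) = (\<Union>g\<in>supp ?z. im g)"
      unfolding supp_upd[of z e s, OF z0 s0] path_image_join[OF join] imA \<delta>(4) by blast
    show "supp ?z \<subseteq> insert e T" unfolding supp_upd[of z e s, OF z0 s0] using sT by blast
    show "?z e \<noteq> 0" using s0 by simp
  next
    fix g show "?z g \<in> {-1, 0, 1}" using A' \<delta>(5) by auto
  next
    fix a assume "a \<notin> path_image (A +++ \<delta>)"
    then have a: "a \<notin> path_image A" "a \<notin> path_image \<delta>" unfolding path_image_join[OF join] by blast+
    then have "winding_number (A +++ \<delta>) a = winding_number A a + winding_number \<delta> a"
      using A' \<delta>(1) join by (intro winding_number_join) (auto simp: arc_imp_path)
    also have "\<dots> = chain_wn ?z a"
      using A' a \<delta>(4,6) chain_wn_upd[of e z s, OF e(1) z0] by simp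
    finally show "winding_number (A +++ \<delta>) a = chain_wn ?z a" .
  next
    show "even_set (supp ?z)"
      unfolding even_set_def
    proof
      fix v
      have "odd (card {e \<in> supp z. v \<in> e}) \<longleftrightarrow> v = x \<or> v = y" using A' by blast
      then have "\<not> odd (card {h \<in> supp ?z. v \<in> h})"
        unfolding odd_card_supp_upd[of z e s, OF fs z0 s0] using xy(1) by auto
      then show "even (card {h \<in> supp ?z. v \<in> h})" by simp
    qed
    have "connected (path_image A)" using A' connected_arc_image by blast
    then show "connected (\<Union>g\<in>supp z. im g)" by (simp only: imA)
    have "p x \<in> path_image A" "p y \<in> path_image A" using A' by (metis pathstart_in_path_image pathfinish_in_path_image)+
    then have "p ` e \<subseteq> path_image A" unfolding xy(1) by simp
    then show "p ` e \<subseteq> (\<Union>g\<in>supp z. im g)" by (simp only: imA)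
  qed
  then show ?thesis by blast
qed

definition drawn :: "'a set \<Rightarrow> 'a set set \<Rightarrow> complex set" where
  "drawn W F = p ` W \<union> (\<Union>e\<in>F. im e)"

lemma compact_drawn: "finite W \<Longrightarrow> F \<subseteq> E \<Longrightarrow> compact (drawn W F)"
proof -
  assume W: "finite W" and F: "F \<subseteq> E"
  have "compact (\<Union>e\<in>F. im e)"
    using finite_subset[OF F finE] F by (intro compact_UN) (auto intro: compact_im)
  moreover have "compact (p ` W)" using W by (intro finite_imp_compact) simp
  ultimately show ?thesis unfolding drawn_def by (intro compact_Un)
qed

text \<open>Adding a leaf attaches an arc in a single point, and arcs do not separate the plane.\<close>

lemma tree_complement_connected:
  assumes "tree_in E v W T" "v \<in> V"
  shows "connected (- drawn W T) \<and> W \<subseteq> V"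
  using assms
proof (induction rule: tree_in.induct)
  case root
  then show ?case by (simp add: drawn_def connected_punctured_universe)
next
  case (leaf W T x u)
  note B = tree_in_basic[OF leaf.hyps(1)]
  let ?e = "{x,u}"
  have IH: "connected (- drawn W T)" "W \<subseteq> V" using leaf by simp_all
  have uV: "u \<in> V" and ux: "u \<noteq> x" using edgeE[OF leaf.hyps(4)] by auto
  have eq: "drawn (insert u W) (insert ?e T) = drawn W T \<union> im ?e"
    using p_in_im[OF leaf.hyps(4), of u] by (auto simp: drawn_def)
  have "drawn W T \<inter> im ?e = {p x}"
  proof
    show "{p x} \<subseteq> drawn W T \<inter> im ?e"
      using leaf.hyps(2) p_in_im[OF leaf.hyps(4), of x] by (auto simp: drawn_def)
    show "drawn W T \<inter> im ?e \<subseteq> {p x}"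
    proof
      fix a assume a: "a \<in> drawn W T \<inter> im ?e"
      then consider w where "w \<in> W" "a = p w" | f where "f \<in> T" "a \<in> im f" by (auto simp: drawn_def)
      then show "a \<in> {p x}"
      proof cases
        case 1
        then have "a \<in> p ` ?e" using a im_vertices[OF leaf.hyps(4)] IH(2) by blast
        then obtain b where b: "b \<in> ?e" "a = p b" by blast
        then have "b = w" using 1 IH(2) edgeE[OF leaf.hyps(4)] p_eq[of b w] by blast
        then show ?thesis using b 1 leaf.hyps(3) by auto
      next
        case 2
        then have "f \<noteq> ?e" using B(5) leaf.hyps(3) by blast
        then have "a \<in> p ` (f \<inter> ?e)" using im_Int[of f ?e] 2 B(4) leaf.hyps(4) a by blast
        moreover have "f \<inter> ?e \<subseteq> {x}" using 2 B(5) leaf.hyps(3) by blast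
        ultimately show ?thesis by blast
      qed
    qed
  qed
  then have ci: "connected (drawn W T \<inter> im ?e)" by simp
  have "connected (- (drawn W T \<union> im ?e))"
    using compact_drawn[OF B(2,4)] compact_imp_closed[OF compact_im[OF leaf.hyps(4)]] ci IH(1)
      connected_arc_complement[OF arcE[OF leaf.hyps(4)]]
    by (intro Janiszewski_connected) simp_all
  then show ?case unfolding eq using IH(2) uV by simp
qed

end

section \<open>Faces of a connected plane graph\<close>

lemma tree_in_restrict:
  assumes "tree_in E v W T" "T \<subseteq> E'"
  shows "tree_in E' v W T"
  using assms
proof (induction rule: tree_in.induct)
  case root
  show ?case by (rule tree_in.root)
next
  case (leaf W T x u)
  then show ?case by (intro tree_in.leaf) auto
qed

text \<open>A spanning tree \<open>T\<close> together with a fundamental cycle for every edge outside it.\<close>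

locale connected_plane_graph = plane_graph +
  fixes r :: 'a and W :: "'a set" and T :: "'a set set"
    and z :: "'a set \<Rightarrow> 'a set \<Rightarrow> int" and C :: "'a set \<Rightarrow> real \<Rightarrow> complex"
  assumes tree: "tree_in E r W T" and rV: "r \<in> V" and inW: "\<And>e. e \<in> E \<Longrightarrow> e \<subseteq> W"
    and fund: "\<And>e. e \<in> E - T \<Longrightarrow> fund_cycle T e (z e) (C e)"
begin

lemma tree_facts: "finite W" "finite T" "T \<subseteq> E" "\<Union>T \<subseteq> W" "W \<subseteq> V"
  using tree_in_basic[OF tree] tree_complement_connected[OF tree rV] by blast+

text \<open>The winding number about the fundamental cycle of \<open>e\<close>, which is an integer off the curve.\<close>

definition nu :: "'a set \<Rightarrow> complex \<Rightarrow> int" where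
  "nu e a = \<lfloor>Re (winding_number (C e) a)\<rfloor>"

lemma nu_eqI: "winding_number (C e) a = of_int n \<Longrightarrow> nu e a = n"
  by (simp add: nu_def)

abbreviation K :: "'a set set \<Rightarrow> complex set" where
  "K S \<equiv> drawn W (T \<union> S)"

context
  fixes e assumes e: "e \<in> E - T"
begin

lemma C_simple: "simple_path (C e)" "pathfinish (C e) = pathstart (C e)" "path (C e)"
proof -
  show 1: "simple_path (C e)" and "pathfinish (C e) = pathstart (C e)"
    using fund[OF e] by (simp_all add: fund_cycle_def)
  show "path (C e)" using 1 by (rule simple_path_imp_path)
qed

lemma C_image: "path_image (C e) = (\<Union>g\<in>supp (z e). im g)" "supp (z e) \<subseteq> insert e T"
  using fund[OF e] by (simp_all add: fund_cycle_def)

lemma z_vals: "z e e \<noteq> 0" "z e g \<in> {-1, 0, 1}" "even_set (supp (z e))"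
  using fund[OF e] by (simp_all add: fund_cycle_def)

lemma z_other: "e' \<in> E - T \<Longrightarrow> e' \<noteq> e \<Longrightarrow> z e e' = 0"
  using C_image(2) unfolding supp_def by blast

lemma nu_wn:
  assumes "a \<notin> path_image (C e)"
  shows "winding_number (C e) a = of_int (nu e a)" "of_int (nu e a) = chain_wn (z e) a"
proof -
  have "winding_number (C e) a \<in> \<int>"
    using integer_winding_number[OF C_simple(3,2) assms] .
  then obtain n where n: "winding_number (C e) a = of_int n" by (auto elim: Ints_cases)
  then show 1: "winding_number (C e) a = of_int (nu e a)" by (simp add: nu_def)
  show "of_int (nu e a) = chain_wn (z e) a"
    using fund[OF e] assms 1 unfolding fund_cycle_def by simp
qed

lemma nu_sign:
  obtains \<epsilon> where "\<epsilon> = 1 \<or> \<epsilon> = -1" "\<And>a. a \<in> inside (path_image (C e)) \<Longrightarrow> nu e a = \<epsilon>"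
    "\<And>a. a \<in> outside (path_image (C e)) \<Longrightarrow> nu e a = 0"
    "\<And>a. a \<notin> path_image (C e) \<Longrightarrow> nu e a = 0 \<or> nu e a = \<epsilon>"
proof -
  have out: "nu e a = 0" if "a \<in> outside (path_image (C e))" for a
    using winding_number_zero_in_outside[OF C_simple(3,2) that] by (simp add: nu_def)
  obtain \<epsilon> :: int where \<epsilon>: "\<epsilon> = 1 \<or> \<epsilon> = -1" "\<And>a. a \<in> inside (path_image (C e)) \<Longrightarrow> nu e a = \<epsilon>"
  proof (rule simple_closed_path_winding_number_inside[OF C_simple(1)])
    assume "\<And>z. z \<in> inside (path_image (C e)) \<Longrightarrow> winding_number (C e) z = 1"
    then show thesis by (intro that[of 1]) (simp_all add: nu_def)
  next
    assume "\<And>z. z \<in> inside (path_image (C e)) \<Longrightarrow> winding_number (C e) z = -1"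
    then have "nu e a = -1" if "a \<in> inside (path_image (C e))" for a
      using nu_eqI[of e a "-1"] that by simp
    then show thesis by (intro that[of "-1"]) simp_all
  qed
  have io: "a \<in> inside (path_image (C e)) \<or> a \<in> outside (path_image (C e))" if "a \<notin> path_image (C e)" for a
    using Jordan_inside_outside[OF C_simple(1,2)] that by blast
  show thesis
    by (rule that[OF \<epsilon> out]) (use io out \<epsilon>(2) in blast)+
qed

lemma nu_const:
  assumes "connected X" "X \<inter> path_image (C e) = {}" "a \<in> X" "b \<in> X"
  shows "nu e a = nu e b"
proof -
  have "winding_number (C e) constant_on X"
    using C_simple assms by (intro winding_number_constant) auto
  then have "winding_number (C e) a = winding_number (C e) b"
    using assms(3,4) unfolding constant_on_def by metis
  then show ?thesis by (simp add: nu_def)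
qed

lemma C_in_drawing: "path_image (C e) \<subseteq> drawn W T \<union> im e"
  using C_image by (auto simp: drawn_def)

end

text \<open>Edges outside the tree are added one at a time. The old drawing meets the fundamental cycle of the
  new edge exactly in its tree path, which is connected, so by Janiszewski's theorem two points that
  neither of them separates are not separated by their union.\<close>

lemma same_code_connected:
  assumes "finite S" "S \<subseteq> E - T" "a \<notin> K S" "b \<notin> K S" "\<And>e. e \<in> S \<Longrightarrow> nu e a = nu e b"
  shows "connected_component (- K S) a b"
  using assms
proof (induction S rule: finite_induct)
  case empty
  then show ?case
    using tree_complement_connected[OF tree rV] unfolding connected_iff_connected_component by simp
next
  case (insert e S)
  have e: "e \<in> E - T" and SE: "S \<subseteq> E" using insert.prems(1) by auto
  have eq: "K (insert e S) = K S \<union> path_image (C e)"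
  proof
    show "K (insert e S) \<subseteq> K S \<union> path_image (C e)"
      using C_image(1)[OF e] z_vals(1)[OF e] by (auto simp: drawn_def supp_def)
    show "K S \<union> path_image (C e) \<subseteq> K (insert e S)"
      using C_in_drawing[OF e] by (auto simp: drawn_def)
  qed
  have disj: "K S \<inter> im e \<subseteq> p ` e"
  proof
    fix x assume x: "x \<in> K S \<inter> im e"
    then consider "x \<in> p ` W" | f where "f \<in> T \<union> S" "x \<in> im f" by (auto simp: drawn_def)
    then show "x \<in> p ` e"
    proof cases
      case 1
      then show ?thesis using im_vertices[of e] e tree_facts(5) x by blast
    next
      case 2
      then have "f \<noteq> e" "f \<in> E" using insert.hyps(2) e tree_facts(3) SE by auto
      then show ?thesis using im_Int[of f e] 2(2) x e by blast
    qed
  qed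
  let ?P = "\<Union>g\<in>supp (z e) - {e}. im g"
  have P: "connected ?P" "p ` e \<subseteq> ?P" using fund[OF e] by (simp_all add: fund_cycle_def)
  have "K S \<inter> path_image (C e) = ?P"
  proof
    have "supp (z e) - {e} \<subseteq> T" using C_image(2)[OF e] by blast
    then show "?P \<subseteq> K S \<inter> path_image (C e)" using C_image(1)[OF e] by (auto simp: drawn_def)
    show "K S \<inter> path_image (C e) \<subseteq> ?P"
    proof
      fix x assume x: "x \<in> K S \<inter> path_image (C e)"
      then obtain g where g: "g \<in> supp (z e)" "x \<in> im g" using C_image(1)[OF e] by blast
      show "x \<in> ?P"
      proof (cases "g = e")
        case True
        then show ?thesis using x g disj P(2) by blast
      next
        case False
        then show ?thesis using g by blast
      qed
    qed
  qed
  then have conn: "connected (K S \<inter> path_image (C e))" using P(1) by simp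
  have ab: "a \<notin> K S" "b \<notin> K S" "a \<notin> path_image (C e)" "b \<notin> path_image (C e)"
    using insert.prems(2,3) unfolding eq by blast+
  show ?case
    unfolding eq
  proof (rule Janiszewski)
    show "compact (K S)" using tree_facts SE by (intro compact_drawn) auto
    show "closed (path_image (C e))" using C_simple[OF e] by (simp add: closed_path_image)
    show "connected (K S \<inter> path_image (C e))" by (rule conn)
    show "connected_component (- K S) a b"
      using insert.IH insert.prems ab by simp
    have "nu e a = nu e b" using insert.prems(4) by simp
    then have "winding_number (C e) a = winding_number (C e) b"
      using nu_wn(1)[OF e ab(3)] nu_wn(1)[OF e ab(4)] by simp
    then show "connected_component (- path_image (C e)) a b"
      using C_simple[OF e] ab by (intro simple_closed_same_side)
  qed
qed

text \<open>The name of the face of a point: its winding numbers about the fundamental cycles of \<open>S\<close>. By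
  \<open>same_code_connected\<close> different faces have different names.\<close>

definition code :: "'a set set \<Rightarrow> complex \<Rightarrow> 'a set \<Rightarrow> int" where
  "code S a = (\<lambda>e. if e \<in> S then nu e a else 0)"

lemma code_eq_iff: "code S a = code S b \<longleftrightarrow> (\<forall>e\<in>S. nu e a = nu e b)"
  unfolding code_def fun_eq_iff by auto

lemma midpoint:
  assumes "g \<in> E"
  shows "\<gamma> g (1/2) \<in> im g" "\<gamma> g (1/2) \<notin> p ` g" "\<gamma> g (1/2) \<notin> p ` V"
    "h \<in> E \<Longrightarrow> h \<noteq> g \<Longrightarrow> \<gamma> g (1/2) \<notin> im h"
proof -
  show 1: "\<gamma> g (1/2) \<in> im g" by (simp add: path_image_def)
  have inj: "inj_on (\<gamma> g) {0..1}" using arcE[OF assms] by (simp add: arc_def)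
  have "\<gamma> g (1/2) \<noteq> \<gamma> g 0" "\<gamma> g (1/2) \<noteq> \<gamma> g 1"
    using inj_onD[OF inj, of "1/2" 0] inj_onD[OF inj, of "1/2" 1] by auto
  then have "\<gamma> g (1/2) \<notin> {pathstart (\<gamma> g), pathfinish (\<gamma> g)}" by (simp add: pathstart_def pathfinish_def)
  then show 2: "\<gamma> g (1/2) \<notin> p ` g" using ends[OF assms] by simp
  show "\<gamma> g (1/2) \<notin> p ` V" using 1 2 im_vertices[OF assms] by blast
  show "\<gamma> g (1/2) \<notin> im h" if "h \<in> E" "h \<noteq> g"
    using 1 2 im_Int[OF that(1) assms that(2)] by blast
qed

lemma interior_connected:
  assumes "g \<in> E"
  shows "connected (im g - p ` g)"
proof -
  have "connected (path_image (\<gamma> g) - {pathstart (\<gamma> g), pathfinish (\<gamma> g)})"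
    using arcE[OF assms] by (intro connected_simple_path_endless) (simp add: arc_imp_simple_path)
  then show ?thesis using ends[OF assms] by simp
qed

text \<open>A new edge lies in a single face, and only the name of this face can split, into at most two, as a
  simple closed curve has at most two winding numbers.\<close>

lemma card_codes:
  assumes "finite S" "S \<subseteq> E - T"
  shows "finite (code S ` (- K S)) \<and> card (code S ` (- K S)) \<le> card S + 1"
  using assms
proof (induction S rule: finite_induct)
  case empty
  have "code {} ` (- K {}) \<subseteq> {\<lambda>_. 0}" by (auto simp: code_def)
  then have "finite (code {} ` (- K {})) \<and> card (code {} ` (- K {})) \<le> card {\<lambda>_::'a set. 0::int}"
    by (intro conjI card_mono) (auto intro: finite_subset)
  then show ?case by simp
next
  case (insert e S)
  have e: "e \<in> E - T" and S: "S \<subseteq> E - T" using insert.prems by auto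
  let ?A = "code S ` (- K S)" and ?B = "code (insert e S) ` (- K (insert e S))"
  let ?\<kappa> = "code S (\<gamma> e (1/2))"
  let ?r = "\<lambda>f::'a set \<Rightarrow> int. f(e := 0)"
  have IH: "finite ?A" "card ?A \<le> card S + 1" using insert.IH S by blast+
  have KK: "K (insert e S) = K S \<union> im e" by (auto simp: drawn_def)
  have r_code: "?r (code (insert e S) a) = code S a" for a
    using insert.hyps(2) by (auto simp: code_def fun_eq_iff)
  have mid: "\<gamma> e (1/2) \<notin> K S"
  proof
    have eE: "e \<in> E" using e by blast
    assume "\<gamma> e (1/2) \<in> K S"
    then consider "\<gamma> e (1/2) \<in> p ` W" | f where "f \<in> T \<union> S" "\<gamma> e (1/2) \<in> im f" by (auto simp: drawn_def)
    then show False
    proof cases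
      case 1
      then show ?thesis using midpoint(3)[OF eE] tree_facts(5) by blast
    next
      case 2
      then have "f \<noteq> e" "f \<in> E" using insert.hyps(2) e tree_facts(3) S by auto
      then show ?thesis using midpoint(4)[OF eE] 2(2) by blast
    qed
  qed
  have \<kappa>: "?\<kappa> \<in> ?A" using mid by blast
  obtain \<epsilon> where \<epsilon>: "\<And>a. a \<notin> path_image (C e) \<Longrightarrow> nu e a = 0 \<or> nu e a = \<epsilon>"
    by (rule nu_sign[OF e]) blast
  have CK: "path_image (C f) \<subseteq> K S" if "f \<in> S" for f
  proof -
    have "path_image (C f) \<subseteq> drawn W T \<union> im f" using that S by (intro C_in_drawing) blast
    then show ?thesis using that by (auto simp: drawn_def)
  qed
  have CK': "path_image (C e) \<subseteq> K S \<union> im e" using C_in_drawing[OF e] by (auto simp: drawn_def)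
  have inj: "nu e a = nu e b"
    if a: "a \<notin> K (insert e S)" and b: "b \<notin> K (insert e S)" and ab: "code S a = code S b"
      and ne: "code S a \<noteq> ?\<kappa>" for a b
  proof -
    have "connected_component (- K S) a b"
      using a b ab S insert.hyps(1) unfolding KK by (intro same_code_connected) (auto simp: code_eq_iff)
    then obtain X where X: "connected X" "X \<subseteq> - K S" "a \<in> X" "b \<in> X"
      unfolding connected_component_def by blast
    have endK: "p ` e \<subseteq> K S" using inW[of e] e by (auto simp: drawn_def)
    have "X \<inter> im e = {}"
    proof (rule ccontr)
      assume "X \<inter> im e \<noteq> {}"
      then obtain q where q: "q \<in> X" "q \<in> im e" by blast
      let ?Y = "X \<union> (im e - p ` e)"
      have "q \<in> im e - p ` e" using q X(2) endK by blast
      then have Y: "connected ?Y" using q X(1) interior_connected[of e] e by (intro connected_Un) auto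
      have YK: "?Y \<inter> K S = {}"
      proof -
        have "x \<notin> K S" if x: "x \<in> im e - p ` e" for x
        proof
          assume "x \<in> K S"
          then consider "x \<in> p ` W" | f where "f \<in> T \<union> S" "x \<in> im f" by (auto simp: drawn_def)
          then show False
          proof cases
            case 1
            then show ?thesis using im_vertices[of e] e tree_facts(5) x by blast
          next
            case 2
            then have "f \<noteq> e" "f \<in> E" using insert.hyps(2) e tree_facts(3) S by auto
            then show ?thesis using im_Int[of f e] 2(2) x e by blast
          qed
        qed
        then show ?thesis using X(2) by blast
      qed
      have "nu f a = nu f (\<gamma> e (1/2))" if f: "f \<in> S" for f
      proof (rule nu_const[OF _ Y])
        show "f \<in> E - T" using f S by blast
        show "?Y \<inter> path_image (C f) = {}" using YK CK[OF f] by blast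
        show "a \<in> ?Y" using X by blast
        show "\<gamma> e (1/2) \<in> ?Y" using midpoint(1,2)[of e] e by blast
      qed
      then show False using ne by (simp add: code_eq_iff)
    qed
    then show ?thesis using CK' X by (intro nu_const[OF e X(1) _ X(3,4)]) blast
  qed
  define B1 where "B1 = {f \<in> ?B. ?r f \<noteq> ?\<kappa>}"
  define B2 where "B2 = {f \<in> ?B. ?r f = ?\<kappa>}"
  have "inj_on ?r B1"
  proof (rule inj_onI)
    fix f g assume fg: "f \<in> B1" "g \<in> B1" "?r f = ?r g"
    obtain a where a: "a \<notin> K (insert e S)" "f = code (insert e S) a" using fg(1) by (auto simp: B1_def)
    obtain b where b: "b \<notin> K (insert e S)" "g = code (insert e S) b" using fg(2) by (auto simp: B1_def)
    have eq: "code S a = code S b" using fg(3) unfolding a(2) b(2) r_code .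
    have "?r f \<noteq> ?\<kappa>" using fg(1) unfolding B1_def by blast
    then have ne: "code S a \<noteq> ?\<kappa>" unfolding a(2) r_code .
    have "nu e a = nu e b" by (rule inj[OF a(1) b(1) eq ne])
    then show "f = g" using eq unfolding a(2) b(2) code_eq_iff by auto
  qed
  moreover have "?r ` B1 \<subseteq> ?A - {?\<kappa>}"
  proof
    fix h assume "h \<in> ?r ` B1"
    then obtain f where f: "f \<in> B1" "h = ?r f" by blast
    then obtain a where a: "a \<notin> K (insert e S)" "f = code (insert e S) a" by (auto simp: B1_def)
    have "h = code S a" using f(2) unfolding a(2) r_code .
    moreover have "a \<notin> K S" using a(1) unfolding KK by blast
    moreover have "h \<noteq> ?\<kappa>" using f by (simp add: B1_def)
    ultimately show "h \<in> ?A - {?\<kappa>}" by blast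
  qed
  ultimately have "finite B1 \<and> card B1 \<le> card (?A - {?\<kappa>})"
    using IH(1) by (meson card_inj_on_le finite_Diff inj_on_finite)
  then have b1: "finite B1" "card B1 \<le> card S" using IH \<kappa> by (auto simp: card_Diff_singleton)
  have "B2 \<subseteq> {?\<kappa>(e := 0), ?\<kappa>(e := \<epsilon>)}"
  proof
    fix f assume f: "f \<in> B2"
    then obtain a where a: "a \<notin> K (insert e S)" "f = code (insert e S) a" by (auto simp: B2_def)
    have "?r f = ?\<kappa>" using f by (simp add: B2_def)
    then have "f = ?\<kappa>(e := f e)" by (metis fun_upd_triv fun_upd_upd)
    moreover have "f e = nu e a" using a(2) by (simp add: code_def)
    moreover have "nu e a = 0 \<or> nu e a = \<epsilon>" using \<epsilon> CK' a(1) KK by blast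
    ultimately show "f \<in> {?\<kappa>(e := 0), ?\<kappa>(e := \<epsilon>)}" by auto
  qed
  then have "finite B2 \<and> card B2 \<le> card {?\<kappa>(e := 0), ?\<kappa>(e := \<epsilon>)}"
    by (meson card_mono finite.emptyI finite_insert finite_subset)
  moreover have "card {?\<kappa>(e := 0), ?\<kappa>(e := \<epsilon>)} \<le> 2" by (simp add: card_insert_if)
  ultimately have b2: "finite B2" "card B2 \<le> 2" by auto
  have "?B = B1 \<union> B2" by (auto simp: B1_def B2_def)
  moreover have "card (B1 \<union> B2) \<le> card B1 + card B2" by (rule card_Un_le)
  moreover have "card (insert e S) = card S + 1" using insert.hyps by simp
  ultimately show ?case using b1 b2 by simp
qed

text \<open>If the chain avoids \<open>g\<close>, its winding number is continuous across \<open>g\<close>. Being integral off \<open>g\<close>, and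
  hence by density on the whole ball, it is constant.\<close>

lemma chain_wn_near_edge:
  assumes g: "g \<in> E" and f: "f g = 0" and \<rho>: "\<rho> > 0"
    and avoid: "\<And>h. h \<in> E \<Longrightarrow> h \<noteq> g \<Longrightarrow> ball x \<rho> \<inter> im h = {}"
    and int: "\<And>a. a \<in> ball x \<rho> - im g \<Longrightarrow> chain_wn f a \<in> \<int>"
    and ab: "a \<in> ball x \<rho>" "b \<in> ball x \<rho>"
  shows "chain_wn f a = chain_wn f b"
proof -
  have eq: "chain_wn f a = (\<Sum>h\<in>E - {g}. of_int (f h) * wn h a)" for a
    unfolding chain_wn_def using finE g f by (subst sum.remove[of E g]) auto
  have cont: "continuous_on (ball x \<rho>) (chain_wn f)"
    unfolding eq
  proof (intro continuous_intros)
    fix h assume "h \<in> E - {g}"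
    then show "continuous_on (ball x \<rho>) (\<lambda>a. wn h a)"
      using avoid[of h] arcE[of h]
      by (intro continuous_at_imp_continuous_on ballI continuous_at_winding_number) (auto simp: arc_imp_path)
  qed
  let ?U = "ball x \<rho> \<inter> chain_wn f -` (- \<int>)"
  have U: "open ?U"
    using cont by (intro continuous_open_preimage) (auto simp: open_Compl)
  have all_int: "chain_wn f c \<in> \<int>" if c: "c \<in> ball x \<rho>" for c
  proof (rule ccontr)
    assume "chain_wn f c \<notin> \<int>"
    then have "?U \<noteq> {}" using c by blast
    then obtain d where "d \<in> ?U" "d \<notin> im g" by (rule arc_misses_open[OF arcE[OF g] U])
    then show False using int[of d] by blast
  qed
  have "chain_wn f constant_on ball x \<rho>"
  proof (rule continuous_discrete_range_constant[OF connected_ball cont])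
    fix c assume c: "c \<in> ball x \<rho>"
    have "1 \<le> norm (chain_wn f d - chain_wn f c)" if d: "d \<in> ball x \<rho>" "chain_wn f d \<noteq> chain_wn f c" for d
    proof -
      obtain m n where mn: "chain_wn f c = of_int m" "chain_wn f d = of_int n"
        using all_int[OF c] all_int[OF d(1)] by (auto elim!: Ints_cases)
      then have "n \<noteq> m" using d(2) by auto
      then have "1 \<le> \<bar>n - m\<bar>" by simp
      moreover have "norm (chain_wn f d - chain_wn f c) = real_of_int \<bar>n - m\<bar>"
        unfolding mn by (metis norm_of_int of_int_diff of_int_abs)
      ultimately show ?thesis by linarith
    qed
    then show "\<exists>e>0. \<forall>d. d \<in> ball x \<rho> \<and> chain_wn f d \<noteq> chain_wn f c \<longrightarrow> e \<le> norm (chain_wn f d - chain_wn f c)"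
      by (intro exI[of _ 1]) auto
  qed
  then show ?thesis using ab unfolding constant_on_def by metis
qed

text \<open>If some fundamental cycle \<open>C e0\<close> passes through \<open>g\<close>, then points inside and outside it occur
  arbitrarily close to the midpoint of \<open>g\<close>. For every other cycle, subtracting the multiple of
  \<open>C e0\<close> that cancels \<open>g\<close> leaves a chain whose winding number does not jump there, so all jumps are
  determined by that of \<open>C e0\<close>. If no cycle passes through \<open>g\<close>, both sides may be the same point.\<close>

lemma edge_sides:
  assumes g: "g \<in> E"
  obtains a b where "a \<notin> K (E - T)" "b \<notin> K (E - T)"
    "\<And>e. e \<in> E - T \<Longrightarrow> odd (nu e a - nu e b) \<longleftrightarrow> g \<in> supp (z e)"
proof -
  let ?x = "\<gamma> g (1/2)"
  let ?rest = "(p ` W - p ` g) \<union> (\<Union>h\<in>E - {g}. im h)"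
  have "compact (\<Union>h\<in>E - {g}. im h)" using finE by (intro compact_UN) (auto intro: compact_im)
  moreover have "compact (p ` W - p ` g)" using tree_facts(1) by (intro finite_imp_compact) simp
  ultimately have "compact ?rest" by (intro compact_Un)
  then have op: "open (- ?rest)" by (intro open_Compl compact_imp_closed)
  have xr: "?x \<in> - ?rest" using midpoint[OF g] tree_facts(5) by blast
  obtain r where r: "r > 0" "ball ?x r \<subseteq> - ?rest"
    using bspec[OF iffD1[OF open_contains_ball op] xr] by (elim exE conjE)
  let ?N = "ball ?x r - im g"
  have gim: "p ` g \<subseteq> im g" using im_vertices[OF g] by blast
  have off: "a \<notin> p ` W - p ` g" "h \<in> E \<Longrightarrow> h \<noteq> g \<Longrightarrow> a \<notin> im h" if "a \<in> ball ?x r" for a h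
    using subsetD[OF r(2) that] by auto
  have NK: "a \<notin> K (E - T)" if a: "a \<in> ?N" for a
  proof
    assume "a \<in> K (E - T)"
    then consider "a \<in> p ` W" | h where "h \<in> E" "a \<in> im h"
      using tree_facts(3) by (auto simp: drawn_def)
    then show False
    proof cases
      case 1
      then show ?thesis using off(1)[of a] a gim by auto
    next
      case 2
      then show ?thesis using off(2)[of a h] a by (cases "h = g") auto
    qed
  qed
  have avoid: "ball ?x r \<inter> im h = {}" if "h \<in> E" "h \<noteq> g" for h
    using off(2)[OF _ that] by auto
  have NC: "a \<notin> path_image (C e)" if "a \<in> ?N" "e \<in> E - T" for a e
  proof -
    have "path_image (C e) \<subseteq> K (E - T)"
      using C_in_drawing[OF that(2)] that(2) by (auto simp: drawn_def)
    then show ?thesis using NK[OF that(1)] by blast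
  qed
  obtain b0 where b0: "b0 \<in> ?N"
    using arc_misses_open[OF arcE[OF g] open_ball, of ?x r] r(1) by (metis DiffI ball_eq_empty not_le)
  show thesis
  proof (cases "\<exists>e0\<in>E - T. g \<in> supp (z e0)")
    case False
    have "odd (nu e b0 - nu e b0) \<longleftrightarrow> g \<in> supp (z e)" if "e \<in> E - T" for e using False that by simp
    then show ?thesis using that[OF NK[OF b0] NK[OF b0]] by blast
  next
    case True
    then obtain e0 where e0: "e0 \<in> E - T" "g \<in> supp (z e0)" by blast
    note J = Jordan_inside_outside[OF C_simple(1,2)[OF e0(1)]]
    have xC: "?x \<in> path_image (C e0)" using C_image(1)[OF e0(1)] e0(2) midpoint(1)[OF g] by blast
    have gC: "im g \<subseteq> path_image (C e0)" using C_image(1)[OF e0(1)] e0(2) by blast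
    have "?x \<in> closure (inside (path_image (C e0)))" "?x \<in> closure (outside (path_image (C e0)))"
      using J xC unfolding frontier_def by blast+
    then obtain a b where a: "a \<in> inside (path_image (C e0))" "dist a ?x < r"
      and b: "b \<in> outside (path_image (C e0))" "dist b ?x < r"
      using r(1) unfolding closure_approachable by meson
    have "a \<notin> path_image (C e0)" "b \<notin> path_image (C e0)"
      using a(1) b(1) inside_Un_outside[of "path_image (C e0)"] by blast+
    then have aN: "a \<in> ?N" and bN: "b \<in> ?N" using a(2) b(2) gC by (auto simp: dist_commute)
    obtain \<epsilon> where \<epsilon>: "\<epsilon> = 1 \<or> \<epsilon> = -1" "nu e0 a = \<epsilon>" "nu e0 b = 0"
      by (rule nu_sign[OF e0(1)]) (use a b in blast)
    let ?s = "z e0 g"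
    have s: "?s = 1 \<or> ?s = -1" using z_vals(2)[OF e0(1), of g] e0(2) by (auto simp: supp_def)
    have "odd (nu e a - nu e b) \<longleftrightarrow> g \<in> supp (z e)" if e: "e \<in> E - T" for e
    proof -
      \<comment> \<open>The coefficient of \<open>g\<close> cancels because \<open>?s * ?s = 1\<close>.\<close>
      let ?f = "\<lambda>h. z e h - ?s * z e g * z e0 h"
      have fsum: "chain_wn ?f c = chain_wn (z e) c - of_int (?s * z e g) * chain_wn (z e0) c" for c
        unfolding chain_wn_def sum_distrib_left sum_subtractf[symmetric]
        by (intro sum.cong) (simp_all add: algebra_simps)
      have val: "chain_wn ?f c = of_int (nu e c - ?s * z e g * nu e0 c)" if "c \<in> ?N" for c
        unfolding fsum using nu_wn(2)[OF e NC[OF that e]] nu_wn(2)[OF e0(1) NC[OF that e0(1)]] by simp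
      have "chain_wn ?f a = chain_wn ?f b"
      proof (rule chain_wn_near_edge[OF g _ r(1) avoid])
        show "z e g - ?s * z e g * ?s = 0" using s by auto
        show "\<And>c. c \<in> ?N \<Longrightarrow> chain_wn ?f c \<in> \<int>" using val by simp
      qed (use aN bN in auto)
      then have "(of_int (nu e a - ?s * z e g * nu e0 a) :: complex) = of_int (nu e b - ?s * z e g * nu e0 b)"
        using val[OF aN] val[OF bN] by simp
      then have "nu e a - ?s * z e g * nu e0 a = nu e b - ?s * z e g * nu e0 b" by (simp only: of_int_eq_iff)
      then have "nu e a - nu e b = ?s * z e g * \<epsilon>" using \<epsilon> by simp
      then have "odd (nu e a - nu e b) \<longleftrightarrow> odd (z e g)" using s \<epsilon>(1) by auto
      moreover have "odd (z e g) \<longleftrightarrow> z e g \<noteq> 0" using z_vals(2)[OF e, of g] by auto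
      ultimately show ?thesis by (simp add: supp_def)
    qed
    then show ?thesis using that[OF NK[OF aN] NK[OF bN]] by blast
  qed
qed

lemma two_basis_exists: "\<exists>F. two_basis E F"
proof -
  let ?S = "E - T" and ?Cd = "code (E - T) ` (- K (E - T))"
  have finS: "finite ?S" using finE by simp
  have "\<exists>a b. a \<notin> K ?S \<and> b \<notin> K ?S \<and> (\<forall>e\<in>?S. odd (nu e a - nu e b) \<longleftrightarrow> g \<in> supp (z e))"
    if "g \<in> E" for g
    by (rule edge_sides[OF that]) blast
  then obtain A B where AB: "\<And>g. g \<in> E \<Longrightarrow> A g \<notin> K ?S" "\<And>g. g \<in> E \<Longrightarrow> B g \<notin> K ?S"
    "\<And>g e. g \<in> E \<Longrightarrow> e \<in> ?S \<Longrightarrow> odd (nu e (A g) - nu e (B g)) \<longleftrightarrow> g \<in> supp (z e)"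
    by metis
  have card: "finite ?Cd" "card ?Cd \<le> card ?S + 1" using card_codes[OF finS subset_refl] by blast+
  have "compact (K ?S)" using tree_facts by (intro compact_drawn) auto
  then have "- K ?S \<noteq> {}" using not_compact_UNIV by (metis Compl_empty_eq double_complement)
  then have ne: "?Cd \<noteq> {}" by blast
  show ?thesis
  proof (rule two_basis_of_codes[of E ?S "\<lambda>e. supp (z e)" ?Cd "\<lambda>g. code ?S (B g)" "\<lambda>g. code ?S (A g)"])
    show "finite E" by (rule finE)
    show "?S \<subseteq> E" by blast
    show "supp (z e) \<subseteq> E" if "e \<in> ?S" for e using C_image(2)[OF that] that tree_facts(3) by blast
    show "even_set (supp (z e))" if "e \<in> ?S" for e using z_vals(3)[OF that] .
    show "e' \<in> supp (z e) \<longleftrightarrow> e' = e" if "e \<in> ?S" "e' \<in> ?S" for e e'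
      using z_vals(1)[OF that(1)] z_other[OF that] by (auto simp: supp_def)
    show "Z = {}" if "Z \<subseteq> E" "even_set Z" "Z \<inter> ?S = {}" for Z
      using tree_in_acyclic[OF tree _ that(2)] that by blast
    show "finite ?Cd" "card ?Cd \<le> card ?S + 1" "?Cd \<noteq> {}" by (fact card ne)+
    show "code ?S (B g) \<in> ?Cd" "code ?S (A g) \<in> ?Cd" if "g \<in> E" for g using AB(1,2)[OF that] by blast+
    show "odd (code ?S (A g) e - code ?S (B g) e) \<longleftrightarrow> g \<in> supp (z e)" if "g \<in> E" "e \<in> ?S" for g e
      using AB(3)[OF that] that by (simp add: code_def)
  qed
qed

end

lemma plane_drawing_mono:
  assumes "plane_drawing V E p \<gamma>" "E' \<subseteq> E"
  shows "plane_drawing V E' p \<gamma>"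
  using assms(1) subsetD[OF assms(2)] unfolding plane_drawing_def by simp

lemma maclane_empty: "maclane {}"
proof -
  have "two_basis {} {}" by (simp add: two_basis_def span2_empty)
  then show ?thesis by (auto simp: maclane_def graph_edges_def)
qed

text \<open>Vertex-disjoint pieces are split off one at a time, each being spanned by a largest tree.\<close>

theorem maclane_of_drawing:
  assumes "finite V" "finite E" "\<And>e. e \<in> E \<Longrightarrow> e \<subseteq> V \<and> card e = 2" "plane_drawing V E p \<gamma>"
  shows "maclane E"
  using assms(2-4)
proof (induction "card E" arbitrary: E rule: less_induct)
  case less
  show ?case
  proof (cases "E = {}")
    case True
    then show ?thesis by (simp add: maclane_empty)
  next
    case False
    then obtain e0 where e0: "e0 \<in> E" by blast
    then have "e0 \<noteq> {}" using less.prems(2)[OF e0] by auto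
    then obtain r where r: "r \<in> e0" by blast
    have c2: "card e = 2" if "e \<in> E" for e using less.prems(2)[OF that] by simp
    obtain W T where WT: "tree_in E r W T" "\<And>e. e \<in> E \<Longrightarrow> e \<inter> W \<noteq> {} \<Longrightarrow> e \<subseteq> W"
    proof (rule tree_in_spanning[OF less.prems(1) c2, of r])
      fix W T assume WT: "tree_in E r W T" "\<And>e. e \<in> E \<Longrightarrow> e \<inter> W \<noteq> {} \<Longrightarrow> e \<subseteq> W"
      show thesis by (rule that[OF WT])
    qed
    define E1 where "E1 = {e \<in> E. e \<subseteq> W}"
    define E2 where "E2 = E - E1"
    note B = tree_in_basic[OF WT(1)]
    have e01: "e0 \<in> E1" using WT(2)[OF e0] B(1) r e0 by (auto simp: E1_def)
    have sub: "E1 \<subseteq> E" "E2 \<subseteq> E" by (auto simp: E1_def E2_def)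
    have "E2 \<subset> E" using e01 e0 by (auto simp: E2_def)
    then have lt: "card E2 < card E" using less.prems(1) by (rule psubset_card_mono[rotated])
    have m2: "maclane E2"
      using less.hyps[OF lt] finite_subset[OF sub(2) less.prems(1)] less.prems(2) sub(2)
        plane_drawing_mono[OF less.prems(3) sub(2)] by blast
    have tr1: "tree_in E1 r W T"
      using WT(1) by (rule tree_in_restrict) (use B(4,5) in \<open>auto simp: E1_def\<close>)
    interpret plane_graph V E1 p \<gamma>
      using assms(1) less.prems(2) plane_drawing_mono[OF less.prems(3) sub(1)] sub(1)
      by unfold_locales auto
    have "\<exists>z c. fund_cycle T e z c" if "e \<in> E1 - T" for e
      using fund_cycle_exists[OF tr1, of e] that by (auto simp: E1_def)
    then obtain z C where zC: "\<And>e. e \<in> E1 - T \<Longrightarrow> fund_cycle T e (z e) (C e)" by metis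
    interpret connected_plane_graph V E1 p \<gamma> r W T z C
      using tr1 zC r less.prems(2)[OF e0] by unfold_locales (auto simp: E1_def)
    have "graph_edges E1" using finE less.prems(2) sub(1) by (auto simp: graph_edges_def)
    then have m1: "maclane E1" using two_basis_exists by (auto simp: maclane_def)
    have "\<Union>E1 \<inter> \<Union>E2 = {}" using WT(2) by (auto simp: E1_def E2_def)
    then have "maclane (E1 \<union> E2)" by (rule maclane_Un[OF m1 m2])
    moreover have "E1 \<union> E2 = E" using sub by (auto simp: E2_def)
    ultimately show ?thesis by simp
  qed
qed

section \<open>Systems of distinct representatives\<close>

text \<open>Hall's theorem by the argument of Halmos and Vaughan: split off a critical subfamily if there is one,
  otherwise choose any representative for one index.\<close>

lemma hall_marriage:
  fixes A :: "'i \<Rightarrow> 'c set"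
  assumes "finite I" "\<And>i. i \<in> I \<Longrightarrow> finite (A i)" "\<And>X. X \<subseteq> I \<Longrightarrow> card X \<le> card (\<Union>i\<in>X. A i)"
  shows "\<exists>f. inj_on f I \<and> (\<forall>i\<in>I. f i \<in> A i)"
  using assms
proof (induction "card I" arbitrary: I A rule: less_induct)
  case less
  note fin = less.prems(1) and finA = less.prems(2) and H = less.prems(3)
  have finU: "finite (\<Union>i\<in>X. A i)" if "X \<subseteq> I" for X
    using that fin finA finite_subset by (intro finite_UN_I) blast+
  show ?case
  proof (cases "I = {}")
    case False
    then obtain i where i: "i \<in> I" by blast
    show ?thesis
    proof (cases "\<exists>X. X \<noteq> {} \<and> X \<subset> I \<and> card (\<Union>j\<in>X. A j) = card X")
      case True
      then obtain X where X: "X \<noteq> {}" "X \<subset> I" "card (\<Union>j\<in>X. A j) = card X" by blast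
      let ?N = "\<Union>j\<in>X. A j"
      have XI: "X \<subseteq> I" and finX: "finite X" using X(2) fin finite_subset by blast+
      have "\<exists>f. inj_on f X \<and> (\<forall>j\<in>X. f j \<in> A j)"
      proof (rule less.hyps)
        show "card X < card I" using X(2) fin by (rule psubset_card_mono[rotated])
        show "finite X" by (rule finX)
        show "finite (A j)" if "j \<in> X" for j using finA that XI by blast
        show "card Y \<le> card (\<Union>j\<in>Y. A j)" if "Y \<subseteq> X" for Y using H[of Y] that XI by blast
      qed
      then obtain f where f: "inj_on f X" "\<And>j. j \<in> X \<Longrightarrow> f j \<in> A j" by blast
      have "\<exists>g. inj_on g (I - X) \<and> (\<forall>j\<in>I - X. g j \<in> A j - ?N)"
      proof (rule less.hyps)
        show "card (I - X) < card I" using X(1) XI fin by (intro psubset_card_mono) auto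
        show "finite (I - X)" using fin by simp
        show "finite (A j - ?N)" if "j \<in> I - X" for j using finA that by simp
        show "card Y \<le> card (\<Union>j\<in>Y. A j - ?N)" if Y: "Y \<subseteq> I - X" for Y
        proof -
          have YI: "Y \<subseteq> I" and YX: "Y \<inter> X = {}" and finY: "finite Y"
            using Y fin finite_subset by blast+
          have "card Y + card X = card (Y \<union> X)" using YX finX finY by (simp add: card_Un_disjoint)
          also have "\<dots> \<le> card (\<Union>j\<in>Y \<union> X. A j)" using H[of "Y \<union> X"] YI XI by blast
          also have "(\<Union>j\<in>Y \<union> X. A j) = (\<Union>j\<in>Y. A j - ?N) \<union> ?N" by blast
          also have "card \<dots> \<le> card (\<Union>j\<in>Y. A j - ?N) + card ?N" by (rule card_Un_le)
          finally show ?thesis using X(3) by simp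
        qed
      qed
      then obtain g where g: "inj_on g (I - X)" "\<And>j. j \<in> I - X \<Longrightarrow> g j \<in> A j - ?N" by blast
      let ?h = "\<lambda>j. if j \<in> X then f j else g j"
      have "inj_on ?h I"
      proof (rule inj_onI)
        fix a b assume ab: "a \<in> I" "b \<in> I" "?h a = ?h b"
        show "a = b"
        proof (cases "a \<in> X"; cases "b \<in> X")
          assume "a \<in> X" "b \<in> X" then show ?thesis using ab(3) f(1) by (simp add: inj_on_eq_iff)
        next
          assume "a \<in> X" "b \<notin> X" then show ?thesis using ab f(2)[of a] g(2)[of b] by auto
        next
          assume "a \<notin> X" "b \<in> X" then show ?thesis using ab f(2)[of b] g(2)[of a] by auto
        next
          assume "a \<notin> X" "b \<notin> X" then show ?thesis using ab g(1) by (simp add: inj_on_eq_iff)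
        qed
      qed
      moreover have "\<forall>j\<in>I. ?h j \<in> A j" using f(2) g(2) by auto
      ultimately show ?thesis by blast
    next
      case False
      have "card {i} \<le> card (\<Union>j\<in>{i}. A j)" using H[of "{i}"] i by blast
      then have "A i \<noteq> {}" by auto
      then obtain a where a: "a \<in> A i" by blast
      have "\<exists>g. inj_on g (I - {i}) \<and> (\<forall>j\<in>I - {i}. g j \<in> A j - {a})"
      proof (rule less.hyps)
        show "card (I - {i}) < card I" using fin i by (rule card_Diff1_less)
        show "finite (I - {i})" using fin by simp
        show "finite (A j - {a})" if "j \<in> I - {i}" for j using finA that by simp
        show "card Y \<le> card (\<Union>j\<in>Y. A j - {a})" if Y: "Y \<subseteq> I - {i}" for Y
        proof (cases "Y = {}")
          case Yne: False
          have YI: "Y \<subseteq> I" "Y \<subset> I" using Y i by blast+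
          have "card Y \<noteq> card (\<Union>j\<in>Y. A j)" using False Yne YI by metis
          then have "card Y < card (\<Union>j\<in>Y. A j)" using H[OF YI(1)] by simp
          moreover have "(\<Union>j\<in>Y. A j) - {a} = (\<Union>j\<in>Y. A j - {a})" by blast
          moreover have "card (\<Union>j\<in>Y. A j) - 1 \<le> card ((\<Union>j\<in>Y. A j) - {a})"
            using finU[OF YI(1)] by (simp add: card_Diff_singleton_if)
          ultimately show ?thesis by simp
        qed simp
      qed
      then obtain g where g: "inj_on g (I - {i})" "\<And>j. j \<in> I - {i} \<Longrightarrow> g j \<in> A j - {a}" by blast
      have "inj_on (g(i := a)) I"
      proof (rule inj_onI)
        fix x y assume xy: "x \<in> I" "y \<in> I" "(g(i := a)) x = (g(i := a)) y"
        show "x = y"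
        proof (cases "x = i"; cases "y = i")
          assume "x = i" "y \<noteq> i" then show ?thesis using xy g(2)[of y] by auto
        next
          assume "x \<noteq> i" "y = i" then show ?thesis using xy g(2)[of x] by auto
        next
          assume "x \<noteq> i" "y \<noteq> i" then show ?thesis using xy g(1) by (simp add: inj_on_eq_iff)
        qed simp
      qed
      moreover have "\<forall>j\<in>I. (g(i := a)) j \<in> A j" using a g(2) by auto
      ultimately show ?thesis by blast
    qed
  qed simp
qed

lemma greedy_choice:
  fixes A :: "'i \<Rightarrow> 'c set"
  assumes "finite I" "\<And>i. i \<in> I \<Longrightarrow> finite (A i)" "\<And>i. i \<in> I \<Longrightarrow> card I \<le> card (A i)"
  shows "\<exists>f. inj_on f I \<and> (\<forall>i\<in>I. f i \<in> A i)"
proof (rule hall_marriage[OF assms(1,2)])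
  fix X assume X: "X \<subseteq> I"
  show "card X \<le> card (\<Union>i\<in>X. A i)"
  proof (cases "X = {}")
    case False
    then obtain i where i: "i \<in> X" by blast
    have "card X \<le> card I" using X assms(1) by (rule card_mono[rotated])
    also have "\<dots> \<le> card (A i)" using assms(3) i X by blast
    also have "\<dots> \<le> card (\<Union>i\<in>X. A i)"
      using X assms(1,2) finite_subset[OF X assms(1)] i by (intro card_mono finite_UN_I) auto
    finally show ?thesis .
  qed simp
qed

section \<open>A vertex with few near predecessors\<close>

definition nb :: "'a set set \<Rightarrow> 'a \<Rightarrow> 'a set" where "nb E v = {u. {v, u} \<in> E}"

lemma nb_sym: "u \<in> nb E v \<longleftrightarrow> v \<in> nb E u"
  by (simp add: nb_def insert_commute)

lemma card_incident:
  assumes "\<And>e. e \<in> F \<Longrightarrow> card e = 2"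
  shows "card {e \<in> F. v \<in> e} = card (nb F v)"
proof (rule bij_betw_same_card[symmetric])
  show "bij_betw (\<lambda>u. {v, u}) (nb F v) {e \<in> F. v \<in> e}"
    unfolding bij_betw_def
  proof
    show "inj_on (\<lambda>u. {v, u}) (nb F v)" by (rule inj_onI) (auto simp: doubleton_eq_iff)
    show "(\<lambda>u. {v, u}) ` nb F v = {e \<in> F. v \<in> e}"
    proof
      show "{e \<in> F. v \<in> e} \<subseteq> (\<lambda>u. {v, u}) ` nb F v"
      proof
        fix e assume e: "e \<in> {e \<in> F. v \<in> e}"
        then obtain a b where "e = {a, b}" using assms[of e] by (auto simp: card_2_iff)
        then obtain u where "e = {v, u}" using e by auto
        then show "e \<in> (\<lambda>u. {v, u}) ` nb F v" using e by (auto simp: nb_def)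
      qed
    qed (auto simp: nb_def)
  qed
qed

context simple_graph
begin

lemma card_edge: "e \<in> E \<Longrightarrow> card e = 2" using edges by blast

lemma finite_E: "finite E"
proof -
  have "E \<subseteq> Pow V" using edges by blast
  then show ?thesis using finite_V finite_subset by blast
qed

lemma nb_V: "nb E v \<subseteq> V"
  using edges by (auto simp: nb_def)

lemma finite_nb: "finite (nb E v)" using nb_V finite_V finite_subset by blast

lemma nb_irrefl: "v \<notin> nb E v" using card_edge[of "{v}"] by (auto simp: nb_def)

lemma nb_in_V: "u \<in> nb E v \<Longrightarrow> v \<in> V" using nb_V[of u] nb_sym[of u E v] by blast

lemma degree_nb: "vertex_degree E v = card (nb E v)"
  unfolding vertex_degree_def using card_edge by (rule card_incident)

text \<open>The members of \<open>B\<close> that are adjacent to \<open>v\<close> or become adjacent to it when the neighbours in \<open>B\<close> of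
  every outside vertex with at most three of them are joined.\<close>

definition near :: "'a set \<Rightarrow> 'a \<Rightarrow> 'a set" where
  "near B v = {v' \<in> B - {v}. v' \<in> nb E v \<or> (\<exists>u\<in>nb E v \<inter> nb E v' - B. card (nb E u \<inter> B) \<le> 3)}"

text \<open>The neighbours of \<open>v\<close> outside \<open>B\<close> that are kept as vertices in the auxiliary plane graph.\<close>

definition hubs :: "'a set \<Rightarrow> 'a \<Rightarrow> 'a set" where
  "hubs B v = {u \<in> nb E v - B. card (nb E u \<inter> B) \<ge> 4}"

text \<open>The auxiliary graph on \<open>B\<close> and the hubs is planar: chords across vertices of degree at most
  three are added, and these vertices are then deleted. It has \<open>card M\<close> edges inside \<open>B\<close> and
  \<open>card E4 \<ge> 4 * card W4\<close> edges between \<open>B\<close> and the hubs. If the bound failed everywhere, then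
  \<open>4 * card M + card E4 \<ge> 12 * card B\<close>, against \<open>card M + card E4 < 3 * (card B + card W4)\<close>.\<close>

lemma sparse_vertex:
  assumes ml: "maclane E" and B: "B \<subseteq> V" "B \<noteq> {}"
  shows "\<exists>v\<in>B. 2 * card (near B v) + card (hubs B v) \<le> 11"
proof (rule ccontr)
  assume "\<not> ?thesis"
  then have neg: "12 \<le> 2 * card (near B v) + card (hubs B v)" if "v \<in> B" for v using that by force
  define EB where "EB = {e \<in> E. e \<inter> B \<noteq> {}}"
  define W4 where "W4 = {w \<in> V - B. card (nb E w \<inter> B) \<ge> 4}"
  define Q where "Q = {{a, b} | a b. \<exists>w\<in>V - B. card (nb E w \<inter> B) \<le> 3 \<and> a \<noteq> b \<and> a \<in> nb E w \<inter> B \<and> b \<in> nb E w \<inter> B}"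
  have finB: "finite B" using B(1) finite_V finite_subset by blast
  have finW4: "finite W4" using finite_V by (simp add: W4_def)
  have QB: "Q \<subseteq> Pow B" by (auto simp: Q_def)
  have finQ: "finite Q" using QB finB by (meson finite_Pow_iff finite_subset)
  have mlQ: "maclane (EB \<union> Q')" if "finite Q'" "Q' \<subseteq> Q" for Q'
    using that
  proof (induction Q' rule: finite_induct)
    case empty
    show ?case using maclane_subset[OF ml, of EB] by (simp add: EB_def)
  next
    case (insert q Q')
    have IH: "maclane (EB \<union> Q')" using insert by simp
    obtain a b w where q: "q = {a, b}" "w \<in> V - B" "card (nb E w \<inter> B) \<le> 3" "a \<noteq> b"
      "a \<in> nb E w \<inter> B" "b \<in> nb E w \<inter> B"
      using insert.prems by (auto simp: Q_def)
    have aw: "{a,w} \<in> EB" "{b,w} \<in> EB" using q by (auto simp: EB_def nb_def insert_commute)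
    have "{e \<in> EB \<union> Q'. w \<in> e} \<subseteq> (\<lambda>x. {w, x}) ` (nb E w \<inter> B)"
    proof
      fix e assume e: "e \<in> {e \<in> EB \<union> Q'. w \<in> e}"
      then have "e \<notin> Q'" using QB insert.prems q(2) by blast
      then have eE: "e \<in> E" "e \<inter> B \<noteq> {}" "w \<in> e" using e by (auto simp: EB_def)
      obtain c d where "e = {c, d}" using card_edge[OF eE(1)] by (auto simp: card_2_iff)
      then obtain x where x: "e = {w, x}" using eE(3) by auto
      then have "x \<in> nb E w \<inter> B" using eE q(2) by (auto simp: nb_def)
      then show "e \<in> (\<lambda>x. {w, x}) ` (nb E w \<inter> B)" using x by blast
    qed
    then have "card {e \<in> EB \<union> Q'. w \<in> e} \<le> card ((\<lambda>x. {w, x}) ` (nb E w \<inter> B))"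
      using finB by (intro card_mono) simp_all
    also have "\<dots> \<le> card (nb E w \<inter> B)" using finB by (intro card_image_le) simp
    finally have "card {e \<in> EB \<union> Q'. w \<in> e} \<le> 3" using q(3) by simp
    then have "maclane (insert {a,b} (EB \<union> Q'))"
      using q aw by (intro maclane_add_chord[OF IH, of a w b]) auto
    then show ?case using q(1) by simp
  qed
  define M where "M = {e \<in> E. e \<subseteq> B} \<union> Q"
  define E4 where "E4 = {{v, w} | v w. v \<in> B \<and> w \<in> W4 \<and> {v, w} \<in> E}"
  have sub: "M \<union> E4 \<subseteq> EB \<union> Q"
  proof
    fix e assume "e \<in> M \<union> E4"
    then consider "e \<in> Q" | "e \<in> E" "e \<subseteq> B" | "e \<in> E4" by (auto simp: M_def)
    then show "e \<in> EB \<union> Q"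
    proof cases
      case 2
      then have "e \<noteq> {}" using card_edge[of e] by auto
      then show ?thesis using 2 by (auto simp: EB_def)
    next
      case 3
      then show ?thesis by (auto simp: E4_def EB_def)
    qed simp
  qed
  have mlH: "maclane (M \<union> E4)" by (rule maclane_subset[OF mlQ[OF finQ subset_refl] sub])
  have E4E: "E4 \<subseteq> E" by (auto simp: E4_def)
  have finM: "finite M" "finite E4" using finite_E finQ finite_subset[OF E4E] by (auto simp: M_def)
  have "card (M \<union> E4) + 3 \<le> 3 * card (B \<union> W4)"
    using finB finW4 QB B(2) mlH by (intro card_edges_planar) (auto simp: M_def E4_def)
  moreover have "card (M \<union> E4) = card M + card E4"
  proof (rule card_Un_disjoint[OF finM])
    show "M \<inter> E4 = {}" using QB by (auto simp: M_def E4_def W4_def)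
  qed
  moreover have "card (B \<union> W4) = card B + card W4"
    using finB finW4 by (intro card_Un_disjoint) (auto simp: W4_def)
  ultimately have count: "card M + card E4 + 3 \<le> 3 * card B + 3 * card W4" by simp
  have M2: "e \<subseteq> B \<and> card e = 2" if "e \<in> M" for e
    using that QB card_edge by (auto simp: M_def Q_def)
  have nbM: "nb M v = near B v" if "v \<in> B" for v
  proof (rule set_eqI)
    fix x
    have "{v, x} \<in> Q \<longleftrightarrow> x \<noteq> v \<and> x \<in> B \<and> (\<exists>u\<in>nb E v \<inter> nb E x - B. card (nb E u \<inter> B) \<le> 3)"
      (is "?L \<longleftrightarrow> ?R")
    proof
      assume ?L
      then obtain a b w where ab: "{v, x} = {a, b}" "w \<in> V - B" "card (nb E w \<inter> B) \<le> 3" "a \<noteq> b"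
        "a \<in> nb E w \<inter> B" "b \<in> nb E w \<inter> B"
        by (auto simp: Q_def)
      then have "v \<in> nb E w" "x \<in> nb E w" "x \<noteq> v" "x \<in> B" by (auto simp: doubleton_eq_iff)
      then show ?R using ab(2,3) nb_sym[of v E w] nb_sym[of x E w] by blast
    next
      assume R: ?R
      then obtain u where u: "u \<in> nb E v \<inter> nb E x - B" "card (nb E u \<inter> B) \<le> 3" by blast
      then have "u \<in> V - B" "v \<in> nb E u \<inter> B" "x \<in> nb E u \<inter> B"
        using R that nb_V[of v] nb_sym[of u E v] nb_sym[of u E x] by auto
      then show ?L using R u(2) by (auto simp: Q_def)
    qed
    moreover have "x \<noteq> v" if "{v, x} \<in> E" using card_edge[OF that] by auto
    ultimately show "x \<in> nb M v \<longleftrightarrow> x \<in> near B v"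
      using that by (auto simp: nb_def M_def near_def)
  qed
  have E42: "card e = 2" if "e \<in> E4" for e using that E4E card_edge by blast
  have nbE4: "nb E4 v = hubs B v" if "v \<in> B" for v
  proof (rule set_eqI)
    fix x
    have "{v, x} \<in> E4 \<longleftrightarrow> x \<in> W4 \<and> {v, x} \<in> E"
    proof
      assume "{v, x} \<in> E4"
      then obtain a b where ab: "{v, x} = {a, b}" "a \<in> B" "b \<in> W4" "{a, b} \<in> E" by (auto simp: E4_def)
      then have "v = a \<and> x = b" using that by (auto simp: doubleton_eq_iff W4_def)
      then show "x \<in> W4 \<and> {v, x} \<in> E" using ab by simp
    qed (use that in \<open>auto simp: E4_def\<close>)
    then show "x \<in> nb E4 v \<longleftrightarrow> x \<in> hubs B v"
      using nb_V[of v] by (auto simp: nb_def hubs_def W4_def)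
  qed
  have sumM: "(\<Sum>v\<in>B. card (near B v)) = 2 * card M"
  proof -
    have "(\<Sum>v\<in>B. card (near B v)) = (\<Sum>v\<in>B. card {e \<in> M. v \<in> e})"
      using M2 nbM card_incident[of M] by (intro sum.cong) simp_all
    also have "\<dots> = 2 * card M" using finB finM(1) M2 by (rule sum_degree_edges)
    finally show ?thesis .
  qed
  have sum4: "(\<Sum>v\<in>B. card (hubs B v)) = card E4"
  proof -
    have one: "\<forall>e\<in>E4. card {v \<in> B. v \<in> e} = 1"
    proof
      fix e assume "e \<in> E4"
      then obtain v w where "v \<in> B" "w \<in> W4" "e = {v, w}" by (auto simp: E4_def)
      then have "{v \<in> B. v \<in> e} = {v}" by (auto simp: W4_def)
      then show "card {v \<in> B. v \<in> e} = 1" by simp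
    qed
    have "(\<Sum>v\<in>B. card (hubs B v)) = (\<Sum>v\<in>B. card {e \<in> E4. v \<in> e})"
      using E42 nbE4 card_incident[of E4] by (intro sum.cong) simp_all
    also have "\<dots> = 1 * card E4" by (rule sum_multicount[OF finB finM(2) one])
    finally show ?thesis by simp
  qed
  have "4 * card W4 \<le> (\<Sum>w\<in>W4. card (nb E w \<inter> B))"
  proof -
    have "4 * card W4 = (\<Sum>w\<in>W4. 4)" by simp
    also have "\<dots> \<le> (\<Sum>w\<in>W4. card (nb E w \<inter> B))" by (rule sum_mono) (simp add: W4_def)
    finally show ?thesis .
  qed
  also have "\<dots> = (\<Sum>v\<in>B. card (hubs B v))"
  proof -
    have "\<forall>w\<in>W4. card {v \<in> B. w \<in> nb E v} = card (nb E w \<inter> B)"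
    proof
      fix w
      have "{v \<in> B. w \<in> nb E v} = nb E w \<inter> B" by (auto simp: nb_sym[of w])
      then show "card {v \<in> B. w \<in> nb E v} = card (nb E w \<inter> B)" by simp
    qed
    then have "(\<Sum>v\<in>B. card {w \<in> W4. w \<in> nb E v}) = (\<Sum>w\<in>W4. card (nb E w \<inter> B))"
      by (rule sum_multicount_gen[OF finB finW4])
    moreover have "{w \<in> W4. w \<in> nb E v} = hubs B v" for v
      using nb_V[of v] by (auto simp: hubs_def W4_def)
    ultimately show ?thesis by simp
  qed
  finally have w4: "4 * card W4 \<le> card E4" using sum4 by simp
  have "12 * card B = (\<Sum>v\<in>B. 12)" by simp
  also have "\<dots> \<le> (\<Sum>v\<in>B. 2 * card (near B v) + card (hubs B v))" by (rule sum_mono) (rule neg)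
  also have "\<dots> = 2 * (\<Sum>v\<in>B. card (near B v)) + (\<Sum>v\<in>B. card (hubs B v))"
    by (simp add: sum.distrib sum_distrib_left)
  finally have "12 * card B \<le> 4 * card M + card E4" using sumM sum4 by simp
  then show False using count w4 by linarith
qed

end

section \<open>Colouring the star of a vertex\<close>

context simple_graph
begin

text \<open>Opposite edges of a 4-cycle of the whole graph conflict even while the other two edges are still
  uncoloured; otherwise extending a colouring could create a bad cycle among old edges.\<close>

definition conflict :: "'a set \<Rightarrow> 'a set \<Rightarrow> bool" where
  "conflict e f \<longleftrightarrow> e \<noteq> f \<and> (e \<inter> f \<noteq> {} \<or>
     (\<exists>a b x y. four_cycle E a b x y \<and> e = {a, b} \<and> f = {x, y}))"

lemma conflict_sym: "conflict e f \<Longrightarrow> conflict f e"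
proof -
  assume c: "conflict e f"
  have fc: "four_cycle E x y a b" if "four_cycle E a b x y" for a b x y
    using that unfolding four_cycle_def by auto
  consider "e \<inter> f \<noteq> {}" | a b x y where "four_cycle E a b x y" "e = {a, b}" "f = {x, y}"
    using c unfolding conflict_def by (elim conjE disjE exE)
  then show ?thesis
  proof cases
    case 1
    then show ?thesis using c by (auto simp: conflict_def)
  next
    case 2
    then show ?thesis using fc[OF 2(1)] c unfolding conflict_def by metis
  qed
qed

text \<open>The edges coloured when the vertices in \<open>B\<close> have been processed.\<close>

definition edges_at :: "'a set \<Rightarrow> 'a set set" where
  "edges_at B = {e \<in> E. e \<inter> B \<noteq> {}}"

definition good_on :: "nat \<Rightarrow> 'a set \<Rightarrow> ('a set \<Rightarrow> nat) \<Rightarrow> bool" where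
  "good_on k B c \<longleftrightarrow> (\<forall>e\<in>edges_at B. c e < k) \<and>
     (\<forall>e\<in>edges_at B. \<forall>f\<in>edges_at B. conflict e f \<longrightarrow> c e \<noteq> c f)"

text \<open>A coloured edge has an end in \<open>B0\<close>, and neither \<open>v\<close> nor \<open>u\<close> is one. So an edge opposite to \<open>v u\<close>
  is determined by an earlier neighbour of \<open>v\<close> or of \<open>u\<close> and one common neighbour.\<close>

lemma star_conflicts:
  assumes vu: "{v, u} \<in> E" and f: "f \<in> edges_at B0" and cf: "conflict {v, u} f"
    and v: "v \<notin> B0" and u: "u \<notin> B0"
  shows "(\<exists>x\<in>nb E v \<inter> B0. f = {v, x}) \<or> (\<exists>b\<in>nb E u \<inter> B0. f = {u, b}) \<or>
    (\<exists>x\<in>nb E v \<inter> B0. \<exists>b\<in>nb E u \<inter> nb E x - {v}. f = {x, b}) \<or>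
    (\<exists>b\<in>nb E u \<inter> B0. \<exists>x\<in>nb E v \<inter> nb E b - {u}. f = {x, b})"
proof -
  have fE: "f \<in> E" "f \<inter> B0 \<noteq> {}" using f by (auto simp: edges_at_def)
  obtain s t where st: "f = {s, t}" "s \<in> B0" using fE card_edge[OF fE(1)] by (auto simp: card_2_iff insert_commute)
  have nst: "t \<in> nb E s" "s \<in> nb E t" using fE(1) st by (auto simp: nb_def insert_commute)
  consider "v \<in> f" | "u \<in> f" | a b x y where "four_cycle E a b x y" "{v,u} = {a, b}" "f = {x, y}"
    using cf unfolding conflict_def
  proof (elim conjE disjE exE)
    assume "{v, u} \<inter> f \<noteq> {}"
    then show thesis using that(1,2) by blast
  next
    fix a b x y assume "four_cycle E a b x y" "{v, u} = {a, b}" "f = {x, y}"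
    then show thesis by (rule that(3))
  qed
  then show ?thesis
  proof cases
    case 1
    then have "v = t" using st v by auto
    then have "f = {v, s}" "s \<in> nb E v \<inter> B0" using st nst by auto
    then show ?thesis by blast
  next
    case 2
    then have "u = t" using st u by auto
    then have "f = {u, s}" "s \<in> nb E u \<inter> B0" using st nst by auto
    then show ?thesis by blast
  next
    case 3
    have d: "distinct [a,b,x,y]" "{a,b} \<in> E" "{b,x} \<in> E" "{x,y} \<in> E" "{y,a} \<in> E"
      using 3(1) by (simp_all add: four_cycle_def)
    have main: ?thesis if q: "q \<in> nb E v" "r \<in> nb E u" "r \<in> nb E q" "r \<noteq> v" "q \<noteq> u" "f = {q, r}" for q r
    proof -
      have "q \<in> B0 \<or> r \<in> B0" using fE(2) q(6) by blast
      then show ?thesis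
      proof
        assume "q \<in> B0"
        then have "q \<in> nb E v \<inter> B0" "r \<in> nb E u \<inter> nb E q - {v}" using q by auto
        then show ?thesis using q(6) by blast
      next
        assume "r \<in> B0"
        then have "r \<in> nb E u \<inter> B0" "q \<in> nb E v \<inter> nb E r - {u}" using q nb_sym[of r E q] by auto
        then show ?thesis using q(6) by blast
      qed
    qed
    have "(a = v \<and> b = u) \<or> (a = u \<and> b = v)" using 3(2) by (auto simp: doubleton_eq_iff)
    then show ?thesis
    proof
      assume "a = v \<and> b = u"
      then show ?thesis using d 3(3) by (intro main[of y x]) (auto simp: nb_def insert_commute)
    next
      assume "a = u \<and> b = v"
      then show ?thesis using d 3(3) by (intro main[of x y]) (auto simp: nb_def insert_commute)
    qed
  qed
qed

lemma card_Sigma_le: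
  assumes "finite A" "\<And>a. a \<in> A \<Longrightarrow> card (F a) \<le> m" "\<And>a. a \<in> A \<Longrightarrow> finite (F a)"
  shows "card (\<Union>a\<in>A. F a) \<le> card A * m"
proof -
  have "card (\<Union>a\<in>A. F a) \<le> (\<Sum>a\<in>A. card (F a))" by (rule card_UN_le[OF assms(1)])
  also have "\<dots> \<le> (\<Sum>a\<in>A. m)" using assms(2) by (rule sum_mono)
  finally show ?thesis by simp
qed

text \<open>\<open>\<beta> u\<close> counts the earlier neighbours of \<open>u\<close>. Outside the edges at \<open>v\<close> itself, the edge \<open>v u\<close> has at
  most \<open>\<beta> u * \<tau> + card P * (\<tau> - 1)\<close> coloured conflicts. The few \<open>u\<close> with \<open>\<beta> u \<ge> 2\<close> are coloured
  greedily. For the others, Hall's condition is checked. Suppose all colours in \<open>F\<close> are forbidden on all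
  of \<open>X\<close>. A colour \<open>c0\<close> can be forbidden through an earlier neighbour \<open>x\<close> of \<open>v\<close> (at most \<open>\<tau> - 1\<close> edges
  for each \<open>x\<close>) or through an earlier neighbour \<open>v'\<close> of \<open>u\<close>, and the latter only if \<open>c0\<close> occurs between
  \<open>v'\<close> and the neighbourhood of \<open>v\<close>; call \<open>v'\<close> bad for \<open>c0\<close> then. A vertex \<open>v'\<close> is bad for at most \<open>\<tau>\<close>
  colours, so if \<open>F\<close> has at least \<open>2 * \<tau>\<close> colours, then averaging over \<open>F\<close> halves the contribution \<open>s1\<close>
  of the bad vertices; if \<open>F\<close> is smaller, then its size is a gain by itself.\<close>

lemma star_extension:
  assumes v: "v \<in> B" and B: "B \<subseteq> V" and k: "14 * \<tau> \<le> k" and \<tau>: "2 \<le> \<tau>"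
    and K2: "\<And>a b. a \<in> V \<Longrightarrow> b \<in> V \<Longrightarrow> a \<noteq> b \<Longrightarrow> card (nb E a \<inter> nb E b) \<le> \<tau>"
    and deg: "card (nb E v) \<le> k"
    and inv: "\<And>u. u \<in> V - B \<Longrightarrow> card (nb E u \<inter> B) \<le> 5"
    and sparse: "2 * card (near B v) + card (hubs B v) \<le> 11"
    and c: "good_on k (B - {v}) c"
  shows "\<exists>\<phi>. inj_on \<phi> (nb E v - B) \<and> (\<forall>u\<in>nb E v - B. \<phi> u < k \<and>
    (\<forall>f\<in>edges_at (B - {v}). conflict {v, u} f \<longrightarrow> \<phi> u \<noteq> c f))"
proof -
  define B0 where "B0 = B - {v}"
  define N where "N = nb E v - B"
  define P where "P = nb E v \<inter> B0"
  define R where "R = near B v"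
  define \<beta> where "\<beta> u = card (nb E u \<inter> B0)" for u
  have finB: "finite B" "finite B0" using B finite_V finite_subset by (auto simp: B0_def)
  have finN: "finite N" and finP: "finite P" using finite_nb by (simp_all add: N_def P_def)
  have finR: "finite R" using finB by (simp add: R_def near_def)
  have vB0: "v \<notin> B0" "v \<in> V" and B0V: "B0 \<subseteq> V" using v B by (auto simp: B0_def)
  have NB: "u \<notin> B" "u \<in> V" "u \<in> nb E v" "v \<in> nb E u" "u \<noteq> v" "u \<notin> B0" if "u \<in> N" for u
    using that nb_V[of v] nb_sym[of u E v] v by (auto simp: N_def B0_def)
  have PR: "P \<subseteq> R" by (auto simp: P_def R_def near_def B0_def)
  have RB: "R \<subseteq> B0" by (auto simp: R_def near_def B0_def)
  have nbB: "nb E u \<inter> B = insert v (nb E u \<inter> B0)" if "u \<in> N" for u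
    using NB[OF that] v by (auto simp: B0_def)
  have card_nbB: "card (nb E u \<inter> B) = \<beta> u + 1" if "u \<in> N" for u
    unfolding nbB[OF that] \<beta>_def using finB vB0 by simp
  have \<beta>4: "\<beta> u \<le> 4" if "u \<in> N" for u
    using inv[of u] card_nbB[OF that] NB[OF that] by simp
  \<comment> \<open>The conflicts of \<open>v u\<close> apart from the coloured edges at \<open>v\<close>; these exclude the same colours, \<open>Cv\<close>,
    for the whole star.\<close>
  define side where "side u = (\<lambda>b. {u, b}) ` (nb E u \<inter> B0) \<union>
    ((\<Union>x\<in>P. (\<lambda>b. {x, b}) ` (nb E u \<inter> nb E x - {v})) \<union>
     (\<Union>b\<in>nb E u \<inter> B0. (\<lambda>x. {x, b}) ` (nb E v \<inter> nb E b - {u})))" for u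
  define S where "S u = c ` side u" for u
  define Cv where "Cv = c ` ((\<lambda>x. {v, x}) ` P)"
  have finside: "finite (side u)" for u
    unfolding side_def using finite_nb finB finP by (intro finite_UnI finite_imageI finite_UN_I) auto
  have finS: "finite (S u)" and finCv: "finite Cv" for u
    using finside finP by (simp_all add: S_def Cv_def)
  have forb: "c f \<in> Cv \<union> S u" if "u \<in> N" "f \<in> edges_at B0" "conflict {v, u} f" for u f
  proof -
    have "{v, u} \<in> E" using NB(3)[OF that(1)] by (simp add: nb_def)
    from star_conflicts[OF this that(2,3) vB0(1) NB(6)[OF that(1)]]
    have "f \<in> (\<lambda>x. {v, x}) ` P \<or> f \<in> side u"
    proof (elim disjE bexE)
      fix x assume "x \<in> nb E v \<inter> B0" "f = {v, x}"
      then show ?thesis by (simp add: P_def)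
    next
      fix b assume "b \<in> nb E u \<inter> B0" "f = {u, b}"
      then show ?thesis by (simp add: side_def)
    next
      fix x b assume "x \<in> nb E v \<inter> B0" "b \<in> nb E u \<inter> nb E x - {v}" "f = {x, b}"
      then show ?thesis unfolding side_def P_def by (intro disjI2 UnI2 UnI1 UN_I[of x] image_eqI)
    next
      fix b x assume "b \<in> nb E u \<inter> B0" "x \<in> nb E v \<inter> nb E b - {u}" "f = {x, b}"
      then show ?thesis unfolding side_def by (intro disjI2 UnI2 UN_I[of b] image_eqI)
    qed
    then show ?thesis by (auto simp: Cv_def S_def)
  qed
  have cardCv: "card Cv \<le> card P"
    unfolding Cv_def image_image using finP by (rule card_image_le)
  have cn: "card (nb E a \<inter> nb E b - {d}) \<le> \<tau> - 1"
    if "a \<in> V" "b \<in> V" "a \<noteq> b" "d \<in> nb E a" "d \<in> nb E b" for a b d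
    using K2[OF that(1-3)] that(4,5) by (simp add: card_Diff_singleton)
  have cardside: "card (side u) \<le> \<beta> u * \<tau> + card P * (\<tau> - 1)" if u: "u \<in> N" for u
  proof -
    have 1: "card ((\<lambda>b. {u, b}) ` (nb E u \<inter> B0)) \<le> \<beta> u"
      unfolding \<beta>_def using finB by (intro card_image_le) simp
    have 2: "card (\<Union>x\<in>P. (\<lambda>b. {x, b}) ` (nb E u \<inter> nb E x - {v})) \<le> card P * (\<tau> - 1)"
    proof (rule card_Sigma_le[OF finP])
      fix x assume x: "x \<in> P"
      have "card ((\<lambda>b. {x, b}) ` (nb E u \<inter> nb E x - {v})) \<le> card (nb E u \<inter> nb E x - {v})"
        using finite_nb by (intro card_image_le) simp
      also have "\<dots> \<le> \<tau> - 1"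
        using x NB[OF u] B0V nb_sym[of x E v] by (intro cn) (auto simp: P_def)
      finally show "card ((\<lambda>b. {x, b}) ` (nb E u \<inter> nb E x - {v})) \<le> \<tau> - 1" .
    qed (use finite_nb in simp)
    have 3: "card (\<Union>b\<in>nb E u \<inter> B0. (\<lambda>x. {x, b}) ` (nb E v \<inter> nb E b - {u})) \<le> \<beta> u * (\<tau> - 1)"
      unfolding \<beta>_def
    proof (rule card_Sigma_le)
      fix b assume b: "b \<in> nb E u \<inter> B0"
      have "card ((\<lambda>x. {x, b}) ` (nb E v \<inter> nb E b - {u})) \<le> card (nb E v \<inter> nb E b - {u})"
        using finite_nb by (intro card_image_le) simp
      also have "\<dots> \<le> \<tau> - 1"
        using b NB[OF u] B0V vB0 nb_sym[of b E u] by (intro cn) auto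
      finally show "card ((\<lambda>x. {x, b}) ` (nb E v \<inter> nb E b - {u})) \<le> \<tau> - 1" .
    qed (use finite_nb finB in simp_all)
    have "card (side u) \<le> \<beta> u + (card P * (\<tau> - 1) + \<beta> u * (\<tau> - 1))"
      unfolding side_def
      by (rule order_trans[OF card_Un_le add_mono[OF 1 order_trans[OF card_Un_le add_mono[OF 2 3]]]])
    moreover have "\<beta> u * \<tau> = \<beta> u + \<beta> u * (\<tau> - 1)" using \<tau> by (cases \<tau>) simp_all
    ultimately show ?thesis by simp
  qed
  have cardS: "card (S u) \<le> \<beta> u * \<tau> + card P * (\<tau> - 1)" if "u \<in> N" for u
    using cardside[OF that] card_image_le[OF finside[of u], of c] by (simp add: S_def)
  define U1 where "U1 = {u \<in> N. \<beta> u \<le> 1}"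
  define U2 where "U2 = {u \<in> N. \<beta> u = 2}"
  define U3 where "U3 = {u \<in> N. \<beta> u \<ge> 3}"
  have finU: "finite U1" "finite U2" "finite U3" using finN by (simp_all add: U1_def U2_def U3_def)
  have Nsplit: "N = U1 \<union> (U2 \<union> U3)" "U1 \<inter> (U2 \<union> U3) = {}" "U2 \<inter> U3 = {}"
    by (auto simp: U1_def U2_def U3_def)
  have U3h: "card U3 = card (hubs B v)"
  proof -
    have "U3 = hubs B v"
      using card_nbB by (auto simp: U3_def hubs_def N_def)
    then show ?thesis by simp
  qed
  define r where "r = card R"
  define p where "p = card P"
  define D2 where "D2 = card U2"
  define D3 where "D3 = card U3"
  have rD: "2 * r + D3 \<le> 11" using sparse U3h by (simp add: r_def D3_def R_def)
  have pr: "p \<le> r" using card_mono[OF finR PR] by (simp add: p_def r_def)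
  have inR: "b \<in> R" if "u \<in> N" "\<beta> u \<le> 2" "b \<in> nb E u \<inter> B0" for u b
  proof -
    have "u \<in> nb E v \<inter> nb E b - B" using NB[OF that(1)] that(3) nb_sym[of b E u] by auto
    moreover have "card (nb E u \<inter> B) \<le> 3" using card_nbB[OF that(1)] that(2) by simp
    ultimately show ?thesis using that(3) unfolding R_def near_def B0_def by blast
  qed
  \<comment> \<open>The total room for vertices \<open>u\<close> with one earlier neighbour. It is shared with \<open>U2\<close>, whose members use
    two of the at most \<open>r * \<tau>\<close> places each.\<close>
  define s1 where "s1 = (\<Sum>v'\<in>R. card {u \<in> U1. u \<in> nb E v'})"
  have RV: "v' \<in> V" "v' \<noteq> v" if "v' \<in> R" for v' using that RB B0V vB0 by auto
  have s1D: "s1 + 2 * D2 \<le> r * \<tau>"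
  proof -
    have "2 * D2 = (\<Sum>u\<in>U2. 2)" by (simp add: D2_def)
    also have "\<dots> \<le> (\<Sum>u\<in>U2. card {v' \<in> R. u \<in> nb E v'})"
    proof (rule sum_mono)
      fix u assume u: "u \<in> U2"
      then have uN: "u \<in> N" "\<beta> u = 2" by (auto simp: U2_def)
      have "nb E u \<inter> B0 \<subseteq> {v' \<in> R. u \<in> nb E v'}"
        using inR[OF uN(1)] uN(2) nb_sym[of _ E u] by auto
      then have "card (nb E u \<inter> B0) \<le> card {v' \<in> R. u \<in> nb E v'}" using finR by (intro card_mono) simp_all
      then show "2 \<le> card {v' \<in> R. u \<in> nb E v'}" using uN(2) by (simp add: \<beta>_def)
    qed
    also have "\<dots> = (\<Sum>v'\<in>R. card {u \<in> U2. u \<in> nb E v'})"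
      by (rule sum_multicount_gen[OF finR finU(2), symmetric]) simp
    finally have "s1 + 2 * D2 \<le> (\<Sum>v'\<in>R. card {u \<in> U1. u \<in> nb E v'} + card {u \<in> U2. u \<in> nb E v'})"
      by (simp add: s1_def sum.distrib)
    also have "\<dots> \<le> (\<Sum>v'\<in>R. \<tau>)"
    proof (rule sum_mono)
      fix v' assume v': "v' \<in> R"
      have "card {u \<in> U1. u \<in> nb E v'} + card {u \<in> U2. u \<in> nb E v'} =
          card ({u \<in> U1. u \<in> nb E v'} \<union> {u \<in> U2. u \<in> nb E v'})"
        using finU Nsplit(2) by (intro card_Un_disjoint[symmetric]) auto
      also have "\<dots> \<le> card (nb E v \<inter> nb E v')"
        using finite_nb by (intro card_mono) (auto simp: U1_def U2_def N_def)
      also have "\<dots> \<le> \<tau>" using K2[of v v'] RV[OF v'] vB0 by simp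
      finally show "card {u \<in> U1. u \<in> nb E v'} + card {u \<in> U2. u \<in> nb E v'} \<le> \<tau>" .
    qed
    finally show ?thesis by (simp add: r_def)
  qed
  have r5: "r \<le> 5" using rD by simp
  \<comment> \<open>For fixed \<open>r\<close> the estimates below are linear in \<open>\<tau>\<close>.\<close>
  then have rcases: "r = 0 \<or> r = 1 \<or> r = 2 \<or> r = 3 \<or> r = 4 \<or> r = 5" by arith
  have p\<tau>: "p * \<tau> = p + p * (\<tau> - 1)" using \<tau> by (cases \<tau>) simp_all
  have pr\<tau>: "p * \<tau> \<le> r * \<tau>" using pr by simp
  have "\<exists>f. inj_on f (U2 \<union> U3) \<and> (\<forall>u\<in>U2 \<union> U3. f u \<in> {..<k} - (Cv \<union> S u))"
  proof (rule greedy_choice)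
    fix u assume u: "u \<in> U2 \<union> U3"
    then have uN: "u \<in> N" by (auto simp: U2_def U3_def)
    have "card (Cv \<union> S u) \<le> card Cv + card (S u)" by (rule card_Un_le)
    also have "\<dots> \<le> p + (\<beta> u * \<tau> + p * (\<tau> - 1))"
      using cardCv cardS[OF uN] by (simp add: p_def)
    also have "\<dots> \<le> p * \<tau> + 4 * \<tau>" using p\<tau> mult_right_mono[OF \<beta>4[OF uN], of \<tau>] by simp
    finally have "card (Cv \<union> S u) \<le> r * \<tau> + 4 * \<tau>" using pr\<tau> by linarith
    moreover have "card (U2 \<union> U3) = D2 + D3"
      using finU Nsplit(3) by (simp add: D2_def D3_def card_Un_disjoint)
    moreover have "r * \<tau> + 4 * \<tau> + (D2 + D3) \<le> k"
      using rcases s1D rD k \<tau> by (elim disjE) simp_all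
    moreover have "card {..<k} - card (Cv \<union> S u) \<le> card ({..<k} - (Cv \<union> S u))"
      using finCv finS by (intro diff_card_le_card_Diff) simp
    ultimately show "card (U2 \<union> U3) \<le> card ({..<k} - (Cv \<union> S u))" by simp
  qed (use finU in simp_all)
  then obtain \<phi>2 where \<phi>2: "inj_on \<phi>2 (U2 \<union> U3)" "\<And>u. u \<in> U2 \<union> U3 \<Longrightarrow> \<phi>2 u \<in> {..<k} - (Cv \<union> S u)" by blast
  define Cu where "Cu = Cv \<union> \<phi>2 ` (U2 \<union> U3)"
  have finCu: "finite Cu" using finCv finU by (simp add: Cu_def)
  have cardCu: "card Cu \<le> p + D2 + D3"
  proof -
    have "card Cu \<le> card Cv + card (\<phi>2 ` (U2 \<union> U3))" unfolding Cu_def by (rule card_Un_le)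
    also have "card (\<phi>2 ` (U2 \<union> U3)) \<le> card (U2 \<union> U3)" using finU by (intro card_image_le) simp
    also have "\<dots> \<le> D2 + D3" unfolding D2_def D3_def by (rule card_Un_le)
    finally show ?thesis using cardCv by (simp add: p_def)
  qed
  have "\<exists>f. inj_on f U1 \<and> (\<forall>u\<in>U1. f u \<in> {..<k} - Cu - S u)"
  proof (rule hall_marriage[OF finU(1)], simp, rule ccontr)
    fix X assume X: "X \<subseteq> U1" and viol: "\<not> card X \<le> card (\<Union>u\<in>X. {..<k} - Cu - S u)"
    have finX: "finite X" using X finU finite_subset by blast
    define F where "F = {..<k} - Cu - (\<Union>u\<in>X. {..<k} - Cu - S u)"
    have finF: "finite F" by (simp add: F_def)
    have FS: "c0 \<in> S u" if "c0 \<in> F" "u \<in> X" for c0 u using that by (auto simp: F_def)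
    have Fv: "c0 \<notin> Cv" if "c0 \<in> F" for c0 using that by (auto simp: F_def Cu_def)
    have XF: "k + 1 \<le> card X + card F + (p + D2 + D3)"
    proof -
      have "{..<k} \<subseteq> Cu \<union> ((\<Union>u\<in>X. {..<k} - Cu - S u) \<union> F)" by (auto simp: F_def)
      then have "card {..<k} \<le> card (Cu \<union> ((\<Union>u\<in>X. {..<k} - Cu - S u) \<union> F))"
        using finCu finX finF by (intro card_mono) auto
      also have "\<dots> \<le> card Cu + (card (\<Union>u\<in>X. {..<k} - Cu - S u) + card F)"
        by (rule order_trans[OF card_Un_le add_left_mono[OF card_Un_le]])
      finally show ?thesis using cardCu viol by simp
    qed
    have cX: "card X + (p + D2 + D3) \<le> k"
    proof -
      have "nb E v = P \<union> N" using v nb_irrefl[of v] by (auto simp: P_def N_def B0_def)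
      moreover have "P \<inter> N = {}" by (auto simp: P_def N_def B0_def)
      ultimately have "card (nb E v) = card P + card N" using finP finN by (simp add: card_Un_disjoint)
      moreover have "card N = card U1 + (card U2 + card U3)"
        unfolding Nsplit(1) using finU Nsplit(2,3) by (simp add: card_Un_disjoint Int_Un_distrib)
      moreover have "card X \<le> card U1" using X finU by (intro card_mono)
      ultimately show ?thesis using deg by (simp add: p_def D2_def D3_def)
    qed
    then have "F \<noteq> {}" using XF by auto
    have "X \<noteq> {}" using viol by auto
    then obtain u0 where u0: "u0 \<in> X" by blast
    have F1: "card F \<le> \<tau> + p * (\<tau> - 1)"
    proof -
      have uN: "u0 \<in> N" "\<beta> u0 \<le> 1" using u0 X by (auto simp: U1_def)
      have "card F \<le> card (S u0)" using FS[OF _ u0] finS by (intro card_mono) auto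
      also have "\<dots> \<le> \<beta> u0 * \<tau> + p * (\<tau> - 1)" using cardS[OF uN(1)] by (simp add: p_def)
      also have "\<beta> u0 * \<tau> \<le> 1 * \<tau>" using uN(2) by (rule mult_right_mono) simp
      finally show ?thesis by simp
    qed
    \<comment> \<open>The star edges forbidden for \<open>c0\<close> through an earlier neighbour \<open>x\<close> of \<open>v\<close> are collected in \<open>T c0 x\<close>.\<close>
    define bad where "bad c0 v' \<longleftrightarrow> (\<exists>x\<in>nb E v \<inter> nb E v'. c {x, v'} = c0)" for c0 v'
    define T where "T c0 x = {u. \<exists>b\<in>nb E x - {v}. c {x, b} = c0 \<and> u \<in> nb E b \<inter> nb E v - {x}}" for c0 x
    have finT: "finite (T c0 x)" for c0 x
      by (rule finite_subset[OF _ finite_nb[of v]]) (auto simp: T_def)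
    have good: "c e \<noteq> c f" if "e \<in> edges_at B0" "f \<in> edges_at B0" "conflict e f" for e f
      using c that unfolding good_on_def B0_def by blast
    have cardT: "card (T c0 x) \<le> \<tau> - 1" if x: "x \<in> P" for c0 x
    proof (cases "\<exists>b\<in>nb E x - {v}. c {x, b} = c0")
      case True
      then obtain b where b: "b \<in> nb E x - {v}" "c {x, b} = c0" by blast
      have uniq: "b' = b" if b': "b' \<in> nb E x - {v}" "c {x, b'} = c0" for b'
      proof (rule ccontr)
        assume "b' \<noteq> b"
        then have "conflict {x, b'} {x, b}" unfolding conflict_def by (auto simp: doubleton_eq_iff)
        moreover have "{x, b'} \<in> edges_at B0" "{x, b} \<in> edges_at B0"
          using b b' x by (auto simp: edges_at_def nb_def P_def)
        ultimately show False using good[of "{x, b'}" "{x, b}"] b b' by simp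
      qed
      have "T c0 x \<subseteq> nb E b \<inter> nb E v - {x}" using uniq by (auto simp: T_def)
      then have "card (T c0 x) \<le> card (nb E b \<inter> nb E v - {x})" using finite_nb by (intro card_mono) simp_all
      also have "\<dots> \<le> \<tau> - 1"
        using b x vB0 nb_V[of x] nb_sym[of b E x] by (intro cn) (auto simp: P_def)
      finally show ?thesis .
    next
      case False
      then have "T c0 x = {}" by (auto simp: T_def)
      then show ?thesis by simp
    qed
    have Xbound: "card X \<le> p * (\<tau> - 1) + (\<Sum>v'\<in>R. if bad c0 v' then card {u \<in> U1. u \<in> nb E v'} else 0)"
      if c0: "c0 \<in> F" for c0
    proof -
      let ?Bad = "{v' \<in> R. bad c0 v'}"
      have "X \<subseteq> (\<Union>x\<in>P. T c0 x) \<union> (\<Union>v'\<in>?Bad. {u \<in> U1. u \<in> nb E v'})"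
      proof
        fix u assume u: "u \<in> X"
        then have u1: "u \<in> U1" "u \<in> N" "\<beta> u \<le> 2" using X by (auto simp: U1_def)
        obtain f where f: "f \<in> side u" "c f = c0" using FS[OF c0 u] by (auto simp: S_def)
        have viaR: "u \<in> (\<Union>v'\<in>?Bad. {u \<in> U1. u \<in> nb E v'})"
          if b: "b \<in> nb E u \<inter> B0" and x: "x \<in> nb E v \<inter> nb E b" "c {x, b} = c0" for b x
        proof -
          have "b \<in> R" by (rule inR[OF u1(2,3) b])
          moreover have "bad c0 b" using x unfolding bad_def by blast
          moreover have "u \<in> nb E b" using b nb_sym[of b E u] by blast
          ultimately show ?thesis using u1(1) by blast
        qed
        consider b where "b \<in> nb E u \<inter> B0" "f = {u, b}"
          | x b where "x \<in> P" "b \<in> nb E u \<inter> nb E x - {v}" "f = {x, b}"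
          | b x where "b \<in> nb E u \<inter> B0" "x \<in> nb E v \<inter> nb E b - {u}" "f = {x, b}"
          using f(1) unfolding side_def by (elim UnE UN_E imageE) (rule that(1) that(2) that(3); assumption)+
        then show "u \<in> (\<Union>x\<in>P. T c0 x) \<union> (\<Union>v'\<in>?Bad. {u \<in> U1. u \<in> nb E v'})"
        proof cases
          case 1
          then show ?thesis using viaR[of b u] NB[OF u1(2)] f(2) nb_sym[of b E u] by auto
        next
          case 2
          have "u \<noteq> x" using 2(1) NB(6)[OF u1(2)] by (auto simp: P_def)
          then have "u \<in> T c0 x"
            using 2 f(2) NB[OF u1(2)] nb_sym[of b E u] unfolding T_def by blast
          then show ?thesis using 2(1) by blast
        next
          case 3
          then show ?thesis using viaR[of b x] f(2) by blast
        qed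
      qed
      then have "card X \<le> card ((\<Union>x\<in>P. T c0 x) \<union> (\<Union>v'\<in>?Bad. {u \<in> U1. u \<in> nb E v'}))"
        using finP finT finR finU by (intro card_mono) auto
      also have "\<dots> \<le> card (\<Union>x\<in>P. T c0 x) + card (\<Union>v'\<in>?Bad. {u \<in> U1. u \<in> nb E v'})"
        by (rule card_Un_le)
      also have "\<dots> \<le> p * (\<tau> - 1) + (\<Sum>v'\<in>?Bad. card {u \<in> U1. u \<in> nb E v'})"
      proof (rule add_mono)
        show "card (\<Union>x\<in>P. T c0 x) \<le> p * (\<tau> - 1)"
          unfolding p_def by (rule card_Sigma_le[OF finP cardT finT])
        have "finite ?Bad" using finR by simp
        then show "card (\<Union>v'\<in>?Bad. {u \<in> U1. u \<in> nb E v'}) \<le> (\<Sum>v'\<in>?Bad. card {u \<in> U1. u \<in> nb E v'})"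
          by (rule card_UN_le)
      qed
      also have "(\<Sum>v'\<in>?Bad. card {u \<in> U1. u \<in> nb E v'}) =
          (\<Sum>v'\<in>R. if bad c0 v' then card {u \<in> U1. u \<in> nb E v'} else 0)"
        using finR by (rule sum.inter_filter)
      finally show ?thesis .
    qed
    show False
    proof (cases "card F < 2 * \<tau>")
      case True
      obtain c0 where c0: "c0 \<in> F" using \<open>F \<noteq> {}\<close> by blast
      have "card X \<le> p * (\<tau> - 1) + (\<Sum>v'\<in>R. if bad c0 v' then card {u \<in> U1. u \<in> nb E v'} else 0)"
        by (rule Xbound[OF c0])
      also have "(\<Sum>v'\<in>R. if bad c0 v' then card {u \<in> U1. u \<in> nb E v'} else 0) \<le> s1"
        unfolding s1_def by (rule sum_mono) simp
      finally have "card X \<le> p * (\<tau> - 1) + s1" by simp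
      then have "k + 2 \<le> 2 * \<tau> + p * \<tau> + s1 + D2 + D3" using XF True p\<tau> by linarith
      then have "k + 2 \<le> 2 * \<tau> + r * \<tau> + (s1 + 2 * D2) + D3" using pr\<tau> by linarith
      then have "k + 2 \<le> 2 * \<tau> + r * \<tau> + r * \<tau> + D3" using s1D by linarith
      then show False using rcases rD k \<tau> by (elim disjE) simp_all
    next
      case False
      have badcount: "card {c0 \<in> F. bad c0 v'} \<le> \<tau>" if v': "v' \<in> R" for v'
      proof -
        have "{c0 \<in> F. bad c0 v'} \<subseteq> (\<lambda>x. c {x, v'}) ` (nb E v \<inter> nb E v')" by (auto simp: bad_def)
        then have "card {c0 \<in> F. bad c0 v'} \<le> card ((\<lambda>x. c {x, v'}) ` (nb E v \<inter> nb E v'))"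
          using finite_nb by (intro card_mono) simp_all
        also have "\<dots> \<le> card (nb E v \<inter> nb E v')" using finite_nb by (intro card_image_le) simp
        also have "\<dots> \<le> \<tau>" using K2[of v v'] RV[OF v'] vB0 by simp
        finally show ?thesis .
      qed
      have "card F * card X = (\<Sum>c0\<in>F. card X)" by simp
      also have "\<dots> \<le> (\<Sum>c0\<in>F. p * (\<tau> - 1) + (\<Sum>v'\<in>R. if bad c0 v' then card {u \<in> U1. u \<in> nb E v'} else 0))"
        by (rule sum_mono) (rule Xbound)
      also have "\<dots> = card F * (p * (\<tau> - 1)) +
          (\<Sum>c0\<in>F. \<Sum>v'\<in>R. if bad c0 v' then card {u \<in> U1. u \<in> nb E v'} else 0)"
        by (simp add: sum.distrib)
      also have "(\<Sum>c0\<in>F. \<Sum>v'\<in>R. if bad c0 v' then card {u \<in> U1. u \<in> nb E v'} else 0) =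
          (\<Sum>v'\<in>R. \<Sum>c0\<in>F. if bad c0 v' then card {u \<in> U1. u \<in> nb E v'} else 0)"
        by (rule sum.swap)
      also have "\<dots> = (\<Sum>v'\<in>R. card {c0 \<in> F. bad c0 v'} * card {u \<in> U1. u \<in> nb E v'})"
        using finF by (intro sum.cong refl) (simp add: sum.inter_filter[symmetric])
      also have "\<dots> \<le> (\<Sum>v'\<in>R. \<tau> * card {u \<in> U1. u \<in> nb E v'})"
        using badcount by (intro sum_mono mult_right_mono) simp_all
      also have "\<dots> = \<tau> * s1" by (simp add: s1_def sum_distrib_left)
      finally have FX: "card F * card X \<le> card F * (p * (\<tau> - 1)) + \<tau> * s1" by simp
      have "2 * card X \<le> 2 * (p * (\<tau> - 1)) + s1"
      proof (rule ccontr)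
        assume neg: "\<not> ?thesis"
        define y where "y = card X - p * (\<tau> - 1)"
        have y: "card X = y + p * (\<tau> - 1)" "s1 < 2 * y" using neg by (auto simp: y_def)
        then have "card F * y \<le> \<tau> * s1" using FX by (simp add: algebra_simps)
        moreover have "(2 * \<tau>) * y \<le> card F * y" using False by (intro mult_right_mono) simp_all
        moreover have "\<tau> * s1 < \<tau> * (2 * y)" using y(2) \<tau> by simp
        ultimately show False by simp
      qed
      then have "2 * (k + 1) \<le> 2 * \<tau> + 4 * (p * (\<tau> - 1)) + 2 * p + (s1 + 2 * D2) + 2 * D3"
      proof -
        define q where "q = p * (\<tau> - 1)"
        assume "2 * card X \<le> 2 * (p * (\<tau> - 1)) + s1"
        then have "2 * card X \<le> 2 * q + s1" by (simp add: q_def)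
        moreover have "card F \<le> \<tau> + q" using F1 by (simp add: q_def)
        moreover have "2 * (k + 1) \<le> 2 * card X + 2 * card F + 2 * p + 2 * D2 + 2 * D3" using XF by simp
        ultimately have "2 * (k + 1) \<le> 2 * \<tau> + 4 * q + 2 * p + (s1 + 2 * D2) + 2 * D3" by presburger
        then show ?thesis by (simp only: q_def)
      qed
      then have "2 * (k + 1) \<le> 2 * \<tau> + 4 * (p * (\<tau> - 1)) + 2 * p + r * \<tau> + 2 * D3"
        by (rule order_trans) (use s1D in simp)
      moreover have "p * (\<tau> - 1) \<le> r * (\<tau> - 1)" using pr by simp
      moreover have "r * \<tau> = r + r * (\<tau> - 1)" using \<tau> by (cases \<tau>) simp_all
      ultimately have "2 * (k + 1) + 2 * r \<le> 2 * \<tau> + 5 * (r * \<tau>) + 2 * D3" using pr by linarith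
      then show False using rcases rD k \<tau> by (elim disjE) simp_all
    qed
  qed
  then obtain \<phi>1 where \<phi>1: "inj_on \<phi>1 U1" "\<And>u. u \<in> U1 \<Longrightarrow> \<phi>1 u \<in> {..<k} - Cu - S u" by blast
  let ?\<phi> = "\<lambda>u. if u \<in> U1 then \<phi>1 u else \<phi>2 u"
  have N2: "u \<in> U2 \<union> U3" if "u \<in> N" "u \<notin> U1" for u using that Nsplit(1) by blast
  have \<phi>val: "?\<phi> u < k \<and> ?\<phi> u \<notin> Cv \<union> S u" if "u \<in> N" for u
    using \<phi>1(2)[of u] \<phi>2(2)[of u] N2[OF that] by (auto simp: Cu_def)
  have "inj_on ?\<phi> N"
  proof (rule inj_onI)
    fix a b assume ab: "a \<in> N" "b \<in> N" "?\<phi> a = ?\<phi> b"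
    have mixed: False if "x \<in> U1" "y \<in> U2 \<union> U3" "\<phi>1 x = \<phi>2 y" for x y
      using \<phi>1(2)[OF that(1)] that(2,3) unfolding Cu_def by auto
    show "a = b"
    proof (cases "a \<in> U1"; cases "b \<in> U1")
      assume "a \<in> U1" "b \<in> U1" then show ?thesis using ab(3) \<phi>1(1) by (simp add: inj_on_eq_iff)
    next
      assume "a \<in> U1" "b \<notin> U1" then show ?thesis using ab mixed[of a b] N2 by auto
    next
      assume "a \<notin> U1" "b \<in> U1" then show ?thesis using ab mixed[of b a] N2 by auto
    next
      assume "a \<notin> U1" "b \<notin> U1"
      then show ?thesis using ab N2 \<phi>2(1) by (simp add: inj_on_eq_iff)
    qed
  qed
  moreover have "\<forall>u\<in>N. ?\<phi> u < k \<and> (\<forall>f\<in>edges_at B0. conflict {v, u} f \<longrightarrow> ?\<phi> u \<noteq> c f)"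
  proof (intro ballI conjI impI)
    fix u assume u: "u \<in> N"
    show "?\<phi> u < k" using \<phi>val[OF u] by blast
    fix f assume f: "f \<in> edges_at B0" "conflict {v, u} f"
    show "?\<phi> u \<noteq> c f" using forb[OF u f] \<phi>val[OF u] by metis
  qed
  ultimately show ?thesis unfolding N_def B0_def by blast
qed

end

section \<open>Colouring planar graphs with few common neighbours\<close>

context simple_graph
begin

text \<open>Induction along the order given by \<open>sparse_vertex\<close>, from its end. The last hypothesis is
  preserved because the vertex removed from \<open>B\<close> has at most five near vertices, and for
  \<open>B = V\<close> it is void.\<close>

lemma good_on_exists:
  assumes ml: "maclane E" and k: "14 * \<tau> \<le> k" and \<tau>: "2 \<le> \<tau>"
    and K2: "\<And>a b. a \<in> V \<Longrightarrow> b \<in> V \<Longrightarrow> a \<noteq> b \<Longrightarrow> card (nb E a \<inter> nb E b) \<le> \<tau>"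
    and deg: "\<And>v. v \<in> V \<Longrightarrow> card (nb E v) \<le> k"
    and "B \<subseteq> V" "\<And>u. u \<in> V - B \<Longrightarrow> card (nb E u \<inter> B) \<le> 5"
  shows "\<exists>c. good_on k B c"
  using assms(6,7)
proof (induction "card B" arbitrary: B rule: less_induct)
  case less
  have finB: "finite B" using less.prems(1) finite_V finite_subset by blast
  show ?case
  proof (cases "B = {}")
    case True
    then have "good_on k B (\<lambda>_. 0)" by (simp add: good_on_def edges_at_def)
    then show ?thesis by blast
  next
    case False
    obtain v where v: "v \<in> B" "2 * card (near B v) + card (hubs B v) \<le> 11"
      using sparse_vertex[OF ml less.prems(1) False] by blast
    let ?B0 = "B - {v}" and ?N = "nb E v - B"
    have inv0: "card (nb E u \<inter> ?B0) \<le> 5" if u: "u \<in> V - ?B0" for u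
    proof (cases "u = v")
      case True
      have "nb E v \<inter> ?B0 \<subseteq> near B v" by (auto simp: near_def)
      then have "card (nb E v \<inter> ?B0) \<le> card (near B v)"
        using finB by (intro card_mono) (auto simp: near_def)
      then show ?thesis using True v(2) by simp
    next
      case False
      then have "card (nb E u \<inter> B) \<le> 5" using less.prems(2) u by simp
      moreover have "card (nb E u \<inter> ?B0) \<le> card (nb E u \<inter> B)" using finB by (intro card_mono) auto
      ultimately show ?thesis by simp
    qed
    have "card ?B0 < card B" using finB v(1) by (rule card_Diff1_less)
    then obtain c where c: "good_on k ?B0 c"
      using less.hyps[of ?B0] inv0 less.prems(1) by blast
    have "card (nb E v) \<le> k" using deg v(1) less.prems(1) by blast
    from star_extension[OF v(1) less.prems(1) k \<tau> K2 this less.prems(2) v(2) c]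
    obtain \<phi> where \<phi>: "inj_on \<phi> ?N" "\<And>u. u \<in> ?N \<Longrightarrow> \<phi> u < k"
      "\<And>u f. u \<in> ?N \<Longrightarrow> f \<in> edges_at ?B0 \<Longrightarrow> conflict {v, u} f \<Longrightarrow> \<phi> u \<noteq> c f"
      by blast
    \<comment> \<open>The description picks the end of a star edge that differs from \<open>v\<close>.\<close>
    define c' where "c' e = (if e \<in> edges_at ?B0 then c e else \<phi> (THE u. u \<in> e \<and> u \<noteq> v))" for e
    have star: "{v, u} \<notin> edges_at ?B0" "c' {v, u} = \<phi> u" if u: "u \<in> ?N" for u
    proof -
      have uv: "u \<noteq> v" using u nb_irrefl by blast
      show 1: "{v, u} \<notin> edges_at ?B0" using u by (auto simp: edges_at_def)
      have "(THE w. w \<in> {v, u} \<and> w \<noteq> v) = u" using uv by (intro the_equality) auto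
      then show "c' {v, u} = \<phi> u" unfolding c'_def using 1 by simp
    qed
    have split: "e \<in> edges_at ?B0 \<or> (\<exists>u\<in>?N. e = {v, u})" if e: "e \<in> edges_at B" for e
    proof (cases "e \<in> edges_at ?B0")
      case False
      then have "v \<in> e" "e \<in> E" "e \<inter> ?B0 = {}" using e by (auto simp: edges_at_def)
      moreover obtain a b where "e = {a, b}" using card_edge[OF \<open>e \<in> E\<close>] by (auto simp: card_2_iff)
      ultimately obtain u where u: "e = {v, u}" by auto
      have "u \<in> nb E v" using \<open>e \<in> E\<close> u by (simp add: nb_def)
      moreover have "u \<noteq> v" using calculation nb_irrefl by blast
      ultimately have "u \<in> ?N" using \<open>e \<inter> ?B0 = {}\<close> u by auto
      then show ?thesis using u by blast
    qed simp
    have old: "c' e = c e" if "e \<in> edges_at ?B0" for e using that by (simp add: c'_def)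
    have "good_on k B c'"
      unfolding good_on_def
    proof (intro conjI ballI impI)
      fix e assume "e \<in> edges_at B"
      from split[OF this] show "c' e < k"
      proof (elim disjE bexE)
        assume "e \<in> edges_at ?B0"
        then show ?thesis using c old by (simp add: good_on_def)
      next
        fix u assume "u \<in> ?N" "e = {v, u}"
        then show ?thesis using star(2) \<phi>(2) by simp
      qed
    next
      fix e f assume e: "e \<in> edges_at B" and f: "f \<in> edges_at B" and cf: "conflict e f"
      from split[OF e] split[OF f] show "c' e \<noteq> c' f"
      proof (elim disjE bexE)
        assume "e \<in> edges_at ?B0" "f \<in> edges_at ?B0"
        then show ?thesis using c cf old by (simp add: good_on_def)
      next
        fix u assume "e \<in> edges_at ?B0" "u \<in> ?N" "f = {v, u}"
        then show ?thesis using star(2) old \<phi>(3) conflict_sym[OF cf] by metis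
      next
        fix u assume "u \<in> ?N" "e = {v, u}" "f \<in> edges_at ?B0"
        then show ?thesis using star(2) old \<phi>(3) cf by metis
      next
        fix u w assume uw: "u \<in> ?N" "e = {v, u}" "w \<in> ?N" "f = {v, w}"
        have "u \<noteq> w" using cf uw by (auto simp: conflict_def)
        then show ?thesis using uw star(2) \<phi>(1) by (simp add: inj_on_eq_iff)
      qed
    qed
    then show ?thesis by blast
  qed
qed

lemma nb_Int_common: "nb E a \<inter> nb E b = common_neighbors V E a b"
  using nb_V[of a] by (auto simp: common_neighbors_def nb_def)

text \<open>The instance \<open>B = V\<close>, in which all edges are coloured.\<close>

theorem B_coloring_of_K2_free_maclane:
  assumes "maclane E" "3 \<le> t" "14 * (t - 1) \<le> k" "K2_free t V E"
    and "\<And>v. v \<in> V \<Longrightarrow> vertex_degree E v \<le> k"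
  shows "\<exists>c. B_coloring E c \<and> c ` E \<subseteq> {..<k}"
proof -
  have "\<exists>c. good_on k V c"
  proof (rule good_on_exists[of "t - 1"])
    fix a b assume "a \<in> V" "b \<in> V" "a \<noteq> b"
    then show "card (nb E a \<inter> nb E b) \<le> t - 1"
      using assms(4) unfolding nb_Int_common K2_free_def by simp
  qed (use assms degree_nb in simp_all)
  then obtain c where c: "good_on k V c" by blast
  have at: "e \<in> edges_at V" if "e \<in> E" for e
  proof -
    have "e \<noteq> {}" "e \<subseteq> V" using card_edge[OF that] edges[OF that] by auto
    then show ?thesis using that by (auto simp: edges_at_def)
  qed
  have ne: "c e \<noteq> c f" if "e \<in> E" "f \<in> E" "conflict e f" for e f
    using c that at unfolding good_on_def by blast
  have adj: "c e \<noteq> c f" if "e \<in> E" "f \<in> E" "e \<noteq> f" "e \<inter> f \<noteq> {}" for e f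
    using ne[OF that(1,2)] that(3,4) by (simp add: conflict_def)
  have "B_coloring E c"
    unfolding B_coloring_def
  proof (intro conjI allI impI)
    show "proper_edge_coloring E c" using adj by (simp add: proper_edge_coloring_def)
  next
    fix v w x y assume cyc: "four_cycle E v w x y"
    then have d: "distinct [v,w,x,y]" "{v,w} \<in> E" "{w,x} \<in> E" "{x,y} \<in> E" "{y,v} \<in> E"
      by (simp_all add: four_cycle_def)
    have cyc': "four_cycle E w x y v" using cyc by (auto simp: four_cycle_def)
    have o1: "c {v,w} \<noteq> c {x,y}"
      using d cyc by (intro ne) (auto simp: conflict_def doubleton_eq_iff)
    have o2: "c {w,x} \<noteq> c {y,v}"
      using d cyc' by (intro ne) (auto simp: conflict_def doubleton_eq_iff)
    have "c {v,w} \<noteq> c {w,x}" "c {w,x} \<noteq> c {x,y}" "c {x,y} \<noteq> c {y,v}" "c {v,w} \<noteq> c {y,v}"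
      using d by (intro adj; auto simp: doubleton_eq_iff)+
    then show "distinct [c {v, w}, c {w, x}, c {x, y}, c {y, v}]" using o1 o2 by auto
  qed
  moreover have "c ` E \<subseteq> {..<k}" using c at by (auto simp: good_on_def)
  ultimately show ?thesis by blast
qed

end

section \<open>Kempe chains and Vizing's adjacency lemma\<close>

definition edge_colors :: "nat \<Rightarrow> 'a set set \<Rightarrow> ('a set \<Rightarrow> nat) \<Rightarrow> bool" where
  "edge_colors k F c \<longleftrightarrow> proper_edge_coloring F c \<and> c ` F \<subseteq> {..<k}"

definition missing :: "nat \<Rightarrow> 'a set set \<Rightarrow> ('a set \<Rightarrow> nat) \<Rightarrow> 'a \<Rightarrow> nat set" where
  "missing k F c v = {\<alpha>. \<alpha> < k \<and> (\<forall>e\<in>F. v \<in> e \<longrightarrow> c e \<noteq> \<alpha>)}"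

lemma edge_colorsD:
  assumes "edge_colors k F c"
  shows "e \<in> F \<Longrightarrow> c e < k"
    "e \<in> F \<Longrightarrow> f \<in> F \<Longrightarrow> v \<in> e \<Longrightarrow> v \<in> f \<Longrightarrow> c e = c f \<Longrightarrow> e = f"
  using assms by (auto simp: edge_colors_def proper_edge_coloring_def)

lemma edge_colorsI:
  assumes "\<And>e. e \<in> F \<Longrightarrow> c e < k"
    "\<And>e f v. e \<in> F \<Longrightarrow> f \<in> F \<Longrightarrow> v \<in> e \<Longrightarrow> v \<in> f \<Longrightarrow> c e = c f \<Longrightarrow> e = f"
  shows "edge_colors k F c"
  unfolding edge_colors_def proper_edge_coloring_def
proof (intro conjI ballI impI)
  fix e f assume ef: "e \<in> F" "f \<in> F" "e \<noteq> f \<and> e \<inter> f \<noteq> {}"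
  then obtain v where "v \<in> e" "v \<in> f" by blast
  then show "c e \<noteq> c f" using assms(2)[of e f v] ef by blast
qed (use assms(1) in auto)

lemma card_missing:
  assumes "edge_colors k F c" "finite F" "\<And>e. e \<in> F \<Longrightarrow> card e = 2"
  shows "card (missing k F c v) + card (nb F v) = k"
proof -
  let ?I = "{e \<in> F. v \<in> e}"
  have inj: "inj_on c ?I" by (rule inj_onI) (use edge_colorsD(2)[OF assms(1)] in blast)
  have sub: "c ` ?I \<subseteq> {..<k}" using edge_colorsD(1)[OF assms(1)] by auto
  have "missing k F c v = {..<k} - c ` ?I" by (auto simp: missing_def)
  then have "card (missing k F c v) = k - card (c ` ?I)"
    using sub assms(2) by (simp add: card_Diff_subset)
  moreover have "card (c ` ?I) = card (nb F v)"
    using inj card_incident[OF assms(3), of F v] by (simp add: card_image)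
  moreover have "card (c ` ?I) \<le> k" using card_mono[OF _ sub] by simp
  ultimately show ?thesis by simp
qed

text \<open>Stated for an edge that may be new or already coloured, so that it serves both for extending a
  colouring and for recolouring in a fan.\<close>

lemma edge_colors_extend:
  assumes c: "edge_colors k F c" and \<alpha>: "\<alpha> \<in> missing k (F - {{u, v}}) c u" "\<alpha> \<in> missing k (F - {{u, v}}) c v"
    and F: "\<And>e. e \<in> F' \<Longrightarrow> e \<noteq> {u, v} \<Longrightarrow> e \<in> F"
  shows "edge_colors k F' (c({u, v} := \<alpha>))"
proof (rule edge_colorsI)
  fix e assume "e \<in> F'"
  then show "(c({u, v} := \<alpha>)) e < k"
    using F[of e] edge_colorsD(1)[OF c, of e] \<alpha>(1) by (auto simp: missing_def)
next
  fix e f w assume ef: "e \<in> F'" "f \<in> F'" "w \<in> e" "w \<in> f" "(c({u,v} := \<alpha>)) e = (c({u,v} := \<alpha>)) f"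
  have new: False if h: "h \<in> F'" "h \<noteq> {u, v}" "w \<in> h" "w \<in> {u, v}" "c h = \<alpha>" for h
  proof -
    have "h \<in> F - {{u, v}}" using F h by blast
    then show False using h(3-5) \<alpha> by (auto simp: missing_def)
  qed
  show "e = f"
  proof (cases "e = {u, v}"; cases "f = {u, v}")
    assume "e = {u, v}" "f \<noteq> {u, v}" then show ?thesis using new[of f] ef by simp
  next
    assume "e \<noteq> {u, v}" "f = {u, v}" then show ?thesis using new[of e] ef by simp
  next
    assume "e \<noteq> {u, v}" "f \<noteq> {u, v}"
    then show ?thesis using ef F edge_colorsD(2)[OF c, of e f w] by simp
  qed simp
qed

lemma tree_in_closed:
  assumes "tree_in H v W T" "\<And>e. e \<in> H \<Longrightarrow> e \<inter> C \<noteq> {} \<Longrightarrow> e \<subseteq> C" "W \<inter> C \<noteq> {}"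
  shows "W \<subseteq> C"
  using assms(1,3)
proof (induction rule: tree_in.induct)
  case (leaf W T x u)
  have "W \<inter> C \<noteq> {}"
  proof
    assume "W \<inter> C = {}"
    then have "u \<in> C" using leaf.prems by blast
    then show False using assms(2)[OF leaf.hyps(4)] leaf.hyps(2) \<open>W \<inter> C = {}\<close> by blast
  qed
  then have "W \<subseteq> C" using leaf.IH by blast
  then show ?case using assms(2)[OF leaf.hyps(4)] leaf.hyps(2) by blast
qed simp

definition kempe_closed :: "'a set set \<Rightarrow> ('a set \<Rightarrow> nat) \<Rightarrow> nat \<Rightarrow> nat \<Rightarrow> 'a set \<Rightarrow> bool" where
  "kempe_closed F c \<alpha> \<beta> C \<longleftrightarrow> (\<forall>e\<in>F. c e \<in> {\<alpha>, \<beta>} \<longrightarrow> e \<inter> C \<noteq> {} \<longrightarrow> e \<subseteq> C)"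

text \<open>The edges of colours \<open>\<alpha>\<close> and \<open>\<beta>\<close> have maximum degree two, and a vertex missing one of the colours has
  degree at most one. A component with \<open>m\<close> vertices has at least \<open>m - 1\<close> edges, so by counting
  degrees it has at most two such vertices.\<close>

lemma kempe_component:
  assumes c: "edge_colors k F c" and fin: "finite F" and c2: "\<And>e. e \<in> F \<Longrightarrow> card e = 2"
    and ab: "\<alpha> < k" "\<beta> < k"
  obtains C where "u \<in> C" "kempe_closed F c \<alpha> \<beta> C"
    "\<And>D. kempe_closed F c \<alpha> \<beta> D \<Longrightarrow> C \<inter> D \<noteq> {} \<Longrightarrow> C \<subseteq> D"
    "\<And>a b d. {a, b, d} \<subseteq> C \<Longrightarrow> distinct [a, b, d] \<Longrightarrow>
      \<exists>w\<in>{a, b, d}. \<alpha> \<notin> missing k F c w \<and> \<beta> \<notin> missing k F c w"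
proof -
  define H where "H = {e \<in> F. c e \<in> {\<alpha>, \<beta>}}"
  have finH: "finite H" and H2: "\<And>e. e \<in> H \<Longrightarrow> card e = 2" using fin c2 by (auto simp: H_def)
  obtain W T where WT: "tree_in H u W T" "\<And>e. e \<in> H \<Longrightarrow> e \<inter> W \<noteq> {} \<Longrightarrow> e \<subseteq> W"
  proof (rule tree_in_spanning[OF finH H2, of u])
    fix W T assume WT: "tree_in H u W T" "\<And>e. e \<in> H \<Longrightarrow> e \<inter> W \<noteq> {} \<Longrightarrow> e \<subseteq> W"
    show thesis by (rule that[OF WT])
  qed
  note B = tree_in_basic[OF WT(1)]
  let ?def = "{w \<in> W. \<alpha> \<in> missing k F c w \<or> \<beta> \<in> missing k F c w}"
  define HW where "HW = {e \<in> H. e \<subseteq> W}"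
  have finHW: "finite HW" using finH by (simp add: HW_def)
  have HW2: "e \<subseteq> W \<and> card e = 2" if "e \<in> HW" for e using that H2 by (simp add: HW_def)
  have degW: "{e \<in> HW. w \<in> e} = {e \<in> H. w \<in> e}" if "w \<in> W" for w
    using WT(2) that by (auto simp: HW_def)
  have bound: "card {e \<in> HW. w \<in> e} + (if w \<in> ?def then 1 else 0) \<le> 2" if w: "w \<in> W" for w
  proof -
    have inj: "inj_on c {e \<in> H. w \<in> e}"
      by (rule inj_onI) (use edge_colorsD(2)[OF c] in \<open>auto simp: H_def\<close>)
    have "c ` {e \<in> H. w \<in> e} \<subseteq> {\<alpha>, \<beta>} - missing k F c w"
      by (auto simp: H_def missing_def)
    then have "card (c ` {e \<in> H. w \<in> e}) \<le> card ({\<alpha>, \<beta>} - missing k F c w)" by (intro card_mono) simp_all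
    then have le: "card {e \<in> H. w \<in> e} \<le> card ({\<alpha>, \<beta>} - missing k F c w)" using inj by (simp add: card_image)
    show ?thesis
    proof (cases "w \<in> ?def")
      case True
      then have "{\<alpha>, \<beta>} - missing k F c w \<subseteq> {\<alpha>} \<or> {\<alpha>, \<beta>} - missing k F c w \<subseteq> {\<beta>}" by auto
      then have "card ({\<alpha>, \<beta>} - missing k F c w) \<le> 1"
        using card_mono[of "{\<alpha>}"] card_mono[of "{\<beta>}"] by fastforce
      then show ?thesis using le True degW[OF w] by simp
    next
      case False
      have "card ({\<alpha>, \<beta>} - missing k F c w) \<le> card {\<alpha>, \<beta>}" by (intro card_mono) auto
      also have "\<dots> \<le> 2" by (simp add: card_insert_if)
      finally show ?thesis unfolding if_not_P[OF False] degW[OF w] using le by linarith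
    qed
  qed
  have "T \<subseteq> HW" using B(4,5) by (auto simp: HW_def)
  then have "card T \<le> card HW" using finHW by (rule card_mono[rotated])
  then have "2 * card W \<le> 2 * card HW + 2" using B(6) by simp
  moreover have "(\<Sum>w\<in>W. card {e \<in> HW. w \<in> e}) = 2 * card HW"
    by (rule sum_degree_edges[OF B(2) finHW HW2])
  moreover have "(\<Sum>w\<in>W. card {e \<in> HW. w \<in> e} + (if w \<in> ?def then 1 else 0)) \<le> (\<Sum>w\<in>W. 2)"
    using bound by (rule sum_mono)
  moreover have "(\<Sum>w\<in>W. if w \<in> ?def then 1 else 0) = card ?def"
    using B(2) by (simp add: sum.inter_filter[symmetric])
  ultimately have def2: "card ?def \<le> 2" by (simp add: sum.distrib)
  show thesis
  proof (rule that)
    show "u \<in> W" by (rule B(1))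
    show "kempe_closed F c \<alpha> \<beta> W" using WT(2) by (simp add: kempe_closed_def H_def)
    show "W \<subseteq> D" if "kempe_closed F c \<alpha> \<beta> D" "W \<inter> D \<noteq> {}" for D
      using that by (intro tree_in_closed[OF WT(1)]) (auto simp: kempe_closed_def H_def)
    show "\<exists>w\<in>{a, b, d}. \<alpha> \<notin> missing k F c w \<and> \<beta> \<notin> missing k F c w"
      if "{a, b, d} \<subseteq> W" "distinct [a, b, d]" for a b d
    proof (rule ccontr)
      assume "\<not> ?thesis"
      then have "{a, b, d} \<subseteq> ?def" using that(1) by blast
      then have "card {a, b, d} \<le> card ?def" using B(2) by (intro card_mono) simp_all
      moreover have "card {a, b, d} = 3" using that(2) by simp
      ultimately show False using def2 by simp
    qed
  qed
qed

text \<open>For a set \<open>C\<close> closed under the two colours, an edge of either colour that meets \<open>C\<close> lies inside it.\<close>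

definition kempe_swap :: "nat \<Rightarrow> nat \<Rightarrow> 'a set \<Rightarrow> ('a set \<Rightarrow> nat) \<Rightarrow> 'a set \<Rightarrow> nat" where
  "kempe_swap \<alpha> \<beta> C c e = (if e \<inter> C \<noteq> {} \<and> c e = \<alpha> then \<beta> else if e \<inter> C \<noteq> {} \<and> c e = \<beta> then \<alpha> else c e)"

lemma kempe_swap_colors:
  assumes c: "edge_colors k F c" and C: "kempe_closed F c \<alpha> \<beta> C" and ab: "\<alpha> < k" "\<beta> < k"
  shows "edge_colors k F (kempe_swap \<alpha> \<beta> C c)"
proof (rule edge_colorsI)
  fix e assume "e \<in> F"
  then show "kempe_swap \<alpha> \<beta> C c e < k" using edge_colorsD(1)[OF c] ab by (simp add: kempe_swap_def)
next
  fix e f v assume ef: "e \<in> F" "f \<in> F" "v \<in> e" "v \<in> f"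
    and eq: "kempe_swap \<alpha> \<beta> C c e = kempe_swap \<alpha> \<beta> C c f"
  have side: "h \<inter> C \<noteq> {} \<longleftrightarrow> v \<in> C" if "h \<in> F" "v \<in> h" "c h = \<alpha> \<or> c h = \<beta>" for h
    using C that unfolding kempe_closed_def by blast
  have val: "kempe_swap \<alpha> \<beta> C c h = (if v \<in> C \<and> c h = \<alpha> then \<beta> else if v \<in> C \<and> c h = \<beta> then \<alpha> else c h)"
    if "h \<in> F" "v \<in> h" for h
    using side[OF that] unfolding kempe_swap_def by auto
  have "c e = c f" using eq unfolding val[OF ef(1,3)] val[OF ef(2,4)] by (auto split: if_splits)
  then show "e = f" using edge_colorsD(2)[OF c] ef by blast
qed

lemma kempe_swap_outside:
  assumes C: "kempe_closed F c \<alpha> \<beta> C" and v: "v \<notin> C" and e: "e \<in> F" "v \<in> e"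
  shows "kempe_swap \<alpha> \<beta> C c e = c e"
proof -
  have "e \<inter> C = {}" if "c e = \<alpha> \<or> c e = \<beta>" using C v e that unfolding kempe_closed_def by blast
  then show ?thesis unfolding kempe_swap_def by auto
qed

lemma missing_kempe_outside:
  assumes "kempe_closed F c \<alpha> \<beta> C" "v \<notin> C"
  shows "missing k F (kempe_swap \<alpha> \<beta> C c) v = missing k F c v"
  using kempe_swap_outside[OF assms] by (auto simp: missing_def)

lemma missing_kempe_other:
  assumes "\<gamma> \<noteq> \<alpha>" "\<gamma> \<noteq> \<beta>"
  shows "\<gamma> \<in> missing k F (kempe_swap \<alpha> \<beta> C c) v \<longleftrightarrow> \<gamma> \<in> missing k F c v"
proof -
  have "kempe_swap \<alpha> \<beta> C c e = \<gamma> \<longleftrightarrow> c e = \<gamma>" for e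
    unfolding kempe_swap_def using assms by (cases "c e = \<alpha>"; cases "c e = \<beta>") simp_all
  then show ?thesis by (simp add: missing_def)
qed

lemma missing_kempe_inside:
  assumes "v \<in> C" "\<beta> \<in> missing k F c v" "\<alpha> < k"
  shows "\<alpha> \<in> missing k F (kempe_swap \<alpha> \<beta> C c) v"
  unfolding missing_def
proof (intro CollectI conjI ballI impI)
  fix e assume e: "e \<in> F" "v \<in> e"
  then have "c e \<noteq> \<beta>" "e \<inter> C \<noteq> {}" using assms by (auto simp: missing_def)
  then show "kempe_swap \<alpha> \<beta> C c e \<noteq> \<alpha>" by (auto simp: kempe_swap_def)
qed (rule assms(3))

text \<open>The situation at an edge of a critical graph.\<close>

locale uncolorable_edge =
  fixes k :: nat and G :: "'a set set" and x y :: 'a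
  assumes finG: "finite G" and G2: "\<And>e. e \<in> G \<Longrightarrow> card e = 2"
    and xy: "{x, y} \<in> G" and uncol: "\<And>c. \<not> edge_colors k G c"
    and deg: "\<And>v. card (nb G v) \<le> k"
begin

definition F where "F = G - {{x, y}}"

abbreviation miss where "miss c v \<equiv> missing k F c v"

text \<open>A multifan at \<open>y\<close> starting with the uncoloured edge: the colour of each further edge is missing at some
  earlier end, not necessarily at the preceding one.\<close>

definition fan :: "('a set \<Rightarrow> nat) \<Rightarrow> (nat \<Rightarrow> 'a) \<Rightarrow> nat \<Rightarrow> bool" where
  "fan c f n \<longleftrightarrow> f 0 = x \<and> inj_on f {..n} \<and> (\<forall>i\<le>n. {y, f i} \<in> G) \<and>
     (\<forall>i\<le>n. 0 < i \<longrightarrow> (\<exists>j<i. c {y, f i} \<in> miss c (f j)))"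

lemma finF: "finite F" and F2: "\<And>e. e \<in> F \<Longrightarrow> card e = 2"
  using finG G2 by (auto simp: F_def)

lemma fan_edge: "fan c f n \<Longrightarrow> 0 < i \<Longrightarrow> i \<le> n \<Longrightarrow> {y, f i} \<in> F"
  "fan c f n \<Longrightarrow> i \<le> n \<Longrightarrow> f i \<noteq> y"
proof -
  assume f: "fan c f n" and i: "i \<le> n"
  show ny: "f i \<noteq> y"
  proof
    assume "f i = y"
    then have "{y} \<in> G" using f i by (auto simp: fan_def)
    then show False using G2 by fastforce
  qed
  assume "0 < i"
  then have "f i \<noteq> x" using f i unfolding fan_def inj_on_def by (metis atMost_iff less_irrefl zero_le)
  then have "{y, f i} \<noteq> {x, y}" using ny by (auto simp: doubleton_eq_iff)
  then show "{y, f i} \<in> F" using f i by (simp add: fan_def F_def)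
qed

lemma fan_prefix: "fan c f n \<Longrightarrow> m \<le> n \<Longrightarrow> fan c f m"
  unfolding fan_def by (auto intro: inj_on_subset)

text \<open>Recolour the last edge of the fan with \<open>\<alpha>\<close>. Its old colour is then missing at \<open>y\<close> and at an earlier
  end, so the argument repeats on a shorter fan until the uncoloured edge itself can be coloured.\<close>

lemma fan_rotation:
  assumes "edge_colors k F c" "fan c f n" "\<alpha> \<in> miss c y" "\<alpha> \<in> miss c (f n)"
  shows False
  using assms
proof (induction n arbitrary: c \<alpha> rule: less_induct)
  case (less n)
  note c = less.prems(1) and f = less.prems(2) and \<alpha> = less.prems(3,4)
  show False
  proof (cases "n = 0")
    case True
    then have "f n = x" using f by (simp add: fan_def)
    then have "edge_colors k G (c({x, y} := \<alpha>))"
      using \<alpha> by (intro edge_colors_extend[OF c]) (auto simp: F_def missing_def)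
    then show False using uncol by blast
  next
    case False
    let ?e = "{y, f n}"
    have eF: "?e \<in> F" using fan_edge(1)[OF f _ order_refl] False by simp
    obtain j where j: "j < n" "c ?e \<in> miss c (f j)" using f False unfolding fan_def by blast
    define c' where "c' = c(?e := \<alpha>)"
    have c': "edge_colors k F c'"
      unfolding c'_def using \<alpha> by (intro edge_colors_extend[OF c]) (auto simp: missing_def)
    have inj: "f i \<noteq> f n" if "i < n" for i
      using f that unfolding fan_def inj_on_def by (metis atMost_iff less_imp_le less_irrefl order_refl)
    have off: "f i \<notin> ?e" if "i < n" for i
      using inj[OF that] fan_edge(2)[OF f, of i] that by simp
    have miss_eq: "miss c' (f i) = miss c (f i)" if "i < n" for i
      using off[OF that] by (auto simp: missing_def c'_def)
    have col_eq: "c' {y, f i} = c {y, f i}" if "i < n" for i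
      using inj[OF that] by (auto simp: c'_def doubleton_eq_iff)
    have fj: "fan c' f j"
      unfolding fan_def
    proof (intro conjI allI impI)
      show "f 0 = x" "inj_on f {..j}" using fan_prefix[OF f, of j] j(1) by (simp_all add: fan_def)
    next
      fix i assume "i \<le> j" then show "{y, f i} \<in> G" using f j(1) by (simp add: fan_def)
    next
      fix i assume i: "i \<le> j" "0 < i"
      have "i \<le> n" using i j(1) by simp
      then obtain l where "l < i" "c {y, f i} \<in> miss c (f l)" using f i(2) unfolding fan_def by blast
      then show "\<exists>l<i. c' {y, f i} \<in> miss c' (f l)" using miss_eq[of l] col_eq[of i] i j(1) by auto
    qed
    have "c ?e \<in> miss c' y"
      unfolding missing_def
    proof (intro CollectI conjI ballI impI)
      show "c ?e < k" using edge_colorsD(1)[OF c eF] .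
      fix e assume e: "e \<in> F" "y \<in> e"
      show "c' e \<noteq> c ?e"
      proof (cases "e = ?e")
        case True
        then show ?thesis using \<alpha>(1) eF by (auto simp: c'_def missing_def)
      next
        case False
        then show ?thesis using edge_colorsD(2)[OF c e(1) eF e(2)] by (auto simp: c'_def)
      qed
    qed
    moreover have "c ?e \<in> miss c' (f j)" using j miss_eq by simp
    ultimately show False using less.IH[OF j(1) c' fj] by blast
  qed
qed

lemma finite_nbG: "finite (nb G v)"
proof -
  have "nb G v \<subseteq> \<Union>G" by (auto simp: nb_def)
  moreover have "finite (\<Union>G)" using finG G2 by (intro finite_Union) (auto intro: card_ge_0_finite)
  ultimately show ?thesis using finite_subset by blast
qed

lemma degF: "card (nb F y) < k" "card (nb F x) + 1 = card (nb G x)"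
  "v \<noteq> x \<Longrightarrow> v \<noteq> y \<Longrightarrow> card (nb F v) = card (nb G v)"
proof -
  note fin = finite_nbG
  have nxy: "x \<noteq> y" using G2[OF xy] by auto
  have "nb F y = nb G y - {x}" "x \<in> nb G y" using nxy xy
    by (auto simp: nb_def F_def doubleton_eq_iff insert_commute)
  then have "card (nb F y) + 1 = card (nb G y)" by (metis Suc_eq_plus1 card_Suc_Diff1 fin)
  then show "card (nb F y) < k" using deg[of y] by simp
  have "nb F x = nb G x - {y}" "y \<in> nb G x" using nxy xy
    by (auto simp: nb_def F_def doubleton_eq_iff insert_commute)
  then show "card (nb F x) + 1 = card (nb G x)" by (metis Suc_eq_plus1 card_Suc_Diff1 fin)
  show "card (nb F v) = card (nb G v)" if "v \<noteq> x" "v \<noteq> y"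
  proof -
    have "nb F v = nb G v" using that by (auto simp: nb_def F_def doubleton_eq_iff)
    then show ?thesis by simp
  qed
qed

lemma miss_y_nonempty: "edge_colors k F c \<Longrightarrow> miss c y \<noteq> {}"
  using card_missing[OF _ finF F2, of k c y] degF(1) by force

text \<open>Let \<open>m\<close> be the first index of an end missing \<open>\<beta>\<close> and \<open>\<alpha>\<close> a colour missing at \<open>y\<close>. If the Kempe chain of
  \<open>f m\<close> avoided \<open>y\<close>, exchanging colours on it would make \<open>\<alpha>\<close> missing at \<open>f m\<close> and leave the fan up to
  \<open>m\<close> intact, against \<open>fan_rotation\<close>. So the chain joins \<open>f m\<close> to \<open>y\<close> and cannot reach a second end \<open>f m'\<close>
  missing \<open>\<beta>\<close>. Exchanging on the chain of \<open>f m'\<close> then gives the same contradiction, since edges of colour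
  \<open>\<beta>\<close> in the fan are still justified by \<open>f m\<close>.\<close>

lemma fan_missing_disjoint:
  assumes c: "edge_colors k F c" and f: "fan c f n" and i: "i \<le> n" "i' \<le> n" "i \<noteq> i'"
  shows "miss c (f i) \<inter> miss c (f i') = {}"
proof (rule ccontr)
  assume "miss c (f i) \<inter> miss c (f i') \<noteq> {}"
  then obtain \<beta> where \<beta>: "\<beta> \<in> miss c (f i)" "\<beta> \<in> miss c (f i')" by blast
  obtain \<alpha> where \<alpha>: "\<alpha> \<in> miss c y" using miss_y_nonempty[OF c] by blast
  have ak: "\<alpha> < k" "\<beta> < k" using \<alpha> \<beta> by (auto simp: missing_def)
  define m where "m = (LEAST l. \<beta> \<in> miss c (f l))"
  have m: "\<beta> \<in> miss c (f m)" unfolding m_def using \<beta>(1) by (rule LeastI)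
  have least: "m \<le> l" if "\<beta> \<in> miss c (f l)" for l unfolding m_def using that by (rule Least_le)
  have "m \<noteq> i \<or> m \<noteq> i'" using i(3) by auto
  then obtain m' where m': "m < m'" "m' \<le> n" "\<beta> \<in> miss c (f m')"
    using least[OF \<beta>(1)] least[OF \<beta>(2)] \<beta> i by (metis le_neq_implies_less)
  have mn: "m \<le> n" using m' by simp
  have nofan: False
    if c': "edge_colors k F c'" and fn: "fan c f l" and \<alpha>y: "\<alpha> \<in> miss c' y" and \<alpha>l: "\<alpha> \<in> miss c' (f l)"
      and col: "\<And>h. 0 < h \<Longrightarrow> h \<le> l \<Longrightarrow> c' {y, f h} = c {y, f h}"
      and mis: "\<And>h j. 0 < h \<Longrightarrow> h \<le> l \<Longrightarrow> j < h \<Longrightarrow> c {y, f h} \<in> miss c (f j) \<Longrightarrow> \<exists>j<h. c {y, f h} \<in> miss c' (f j)"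
    for c' l
  proof -
    have "fan c' f l"
      unfolding fan_def
    proof (intro conjI allI impI)
      show "f 0 = x" "inj_on f {..l}" using fn by (simp_all add: fan_def)
    next
      fix h assume "h \<le> l" then show "{y, f h} \<in> G" using fn by (simp add: fan_def)
    next
      fix h assume h: "h \<le> l" "0 < h"
      then obtain j where "j < h" "c {y, f h} \<in> miss c (f j)" using fn unfolding fan_def by blast
      then show "\<exists>j<h. c' {y, f h} \<in> miss c' (f j)" using mis[OF h(2,1)] col[OF h(2,1)] by simp
    qed
    then show False using fan_rotation[of c' f l \<alpha>] c' \<alpha>y \<alpha>l by blast
  qed
  have yne: "c {y, f h} \<noteq> \<alpha>" if "0 < h" "h \<le> n" for h
    using fan_edge(1)[OF f that] \<alpha> by (auto simp: missing_def)
  obtain C where C: "f m \<in> C" "kempe_closed F c \<alpha> \<beta> C"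
    "\<And>D. kempe_closed F c \<alpha> \<beta> D \<Longrightarrow> C \<inter> D \<noteq> {} \<Longrightarrow> C \<subseteq> D"
    "\<And>a b d. {a, b, d} \<subseteq> C \<Longrightarrow> distinct [a, b, d] \<Longrightarrow>
      \<exists>w\<in>{a, b, d}. \<alpha> \<notin> miss c w \<and> \<beta> \<notin> miss c w"
  proof (rule kempe_component[OF c finF F2 ak, of "f m"])
    fix C assume C: "f m \<in> C" "kempe_closed F c \<alpha> \<beta> C"
      "\<And>D. kempe_closed F c \<alpha> \<beta> D \<Longrightarrow> C \<inter> D \<noteq> {} \<Longrightarrow> C \<subseteq> D"
      "\<And>a b d. {a, b, d} \<subseteq> C \<Longrightarrow> distinct [a, b, d] \<Longrightarrow>
        \<exists>w\<in>{a, b, d}. \<alpha> \<notin> miss c w \<and> \<beta> \<notin> miss c w"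
    show thesis by (rule that[OF C])
  qed
  have yC: "y \<in> C"
  proof (rule ccontr)
    assume yC: "y \<notin> C"
    let ?c = "kempe_swap \<alpha> \<beta> C c"
    show False
    proof (rule nofan)
      show "edge_colors k F ?c" by (rule kempe_swap_colors[OF c C(2) ak])
      show "fan c f m" by (rule fan_prefix[OF f mn])
      show "\<alpha> \<in> miss ?c y" using \<alpha> missing_kempe_outside[OF C(2) yC] by simp
      show "\<alpha> \<in> miss ?c (f m)" by (rule missing_kempe_inside[OF C(1) m ak(1)])
      show "?c {y, f h} = c {y, f h}" if "0 < h" "h \<le> m" for h
        using fan_edge(1)[OF f] that mn by (intro kempe_swap_outside[OF C(2) yC]) auto
      show "\<exists>j<h. c {y, f h} \<in> miss ?c (f j)"
        if h: "0 < h" "h \<le> m" "j < h" "c {y, f h} \<in> miss c (f j)" for h j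
      proof -
        have "c {y, f h} \<noteq> \<beta>" using least[of j] h by auto
        moreover have "c {y, f h} \<noteq> \<alpha>" using yne[of h] h mn by simp
        ultimately have "c {y, f h} \<in> miss ?c (f j)" using h(4) missing_kempe_other by metis
        then show ?thesis using h(3) by blast
      qed
    qed
  qed
  have inj: "f m \<noteq> f m'" using f m' mn unfolding fan_def inj_on_def by auto
  have m'C: "f m' \<notin> C"
  proof
    assume "f m' \<in> C"
    then have "\<exists>w\<in>{y, f m, f m'}. \<alpha> \<notin> miss c w \<and> \<beta> \<notin> miss c w"
      using yC C(1) inj fan_edge(2)[OF f] mn m'(2) by (intro C(4)) auto
    then show False using \<alpha> m m'(3) by blast
  qed
  obtain D where D: "f m' \<in> D" "kempe_closed F c \<alpha> \<beta> D"
    "\<And>D'. kempe_closed F c \<alpha> \<beta> D' \<Longrightarrow> D \<inter> D' \<noteq> {} \<Longrightarrow> D \<subseteq> D'"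
  proof (rule kempe_component[OF c finF F2 ak, of "f m'"])
    fix D assume D: "f m' \<in> D" "kempe_closed F c \<alpha> \<beta> D"
      "\<And>D'. kempe_closed F c \<alpha> \<beta> D' \<Longrightarrow> D \<inter> D' \<noteq> {} \<Longrightarrow> D \<subseteq> D'"
    show thesis by (rule that[OF D])
  qed
  have DC: "D \<inter> C = {}" using D(3)[OF C(2)] D(1) m'C by blast
  then have yD: "y \<notin> D" and mD: "f m \<notin> D" using yC C(1) by blast+
  let ?c = "kempe_swap \<alpha> \<beta> D c"
  show False
  proof (rule nofan)
    show "edge_colors k F ?c" by (rule kempe_swap_colors[OF c D(2) ak])
    show "fan c f m'" by (rule fan_prefix[OF f m'(2)])
    show "\<alpha> \<in> miss ?c y" using \<alpha> missing_kempe_outside[OF D(2) yD] by simp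
    show "\<alpha> \<in> miss ?c (f m')" by (rule missing_kempe_inside[OF D(1) m'(3) ak(1)])
    show "?c {y, f h} = c {y, f h}" if "0 < h" "h \<le> m'" for h
      using fan_edge(1)[OF f] that m'(2) by (intro kempe_swap_outside[OF D(2) yD]) auto
    show "\<exists>j<h. c {y, f h} \<in> miss ?c (f j)"
      if h: "0 < h" "h \<le> m'" "j < h" "c {y, f h} \<in> miss c (f j)" for h j
    proof (cases "c {y, f h} = \<beta>")
      case True
      then have "m < h" using least[of j] h by simp
      moreover have "\<beta> \<in> miss ?c (f m)" using m missing_kempe_outside[OF D(2) mD] by simp
      ultimately show ?thesis using True by auto
    next
      case False
      moreover have "c {y, f h} \<noteq> \<alpha>" using yne[of h] h m'(2) by simp
      ultimately have "c {y, f h} \<in> miss ?c (f j)" using h(4) missing_kempe_other by metis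
      then show ?thesis using h(3) by blast
    qed
  qed
qed

text \<open>In a maximal fan every colour missing at an end occurs at \<open>y\<close> on an edge of the fan, so the disjoint sets
  of missing colours have at most \<open>n\<close> elements together. Each of the \<open>n\<close> further ends of degree less than
  \<open>k\<close> contributes at least one, and \<open>x\<close> contributes \<open>k + 1\<close> minus its degree; so the ends of degree \<open>k\<close> have
  to make up for the latter.\<close>

lemma vizing_adjacency:
  assumes c: "edge_colors k F c"
  shows "k + 1 \<le> card (nb G x) + card {w \<in> nb G y - {x}. card (nb G w) = k}"
proof -
  have "fan c (\<lambda>_. x) 0" using xy by (simp add: fan_def insert_commute)
  moreover have bound: "n \<le> card (nb G y)" if "fan c f n" for f n
  proof -
    have "f ` {..n} \<subseteq> nb G y" using that by (auto simp: fan_def nb_def)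
    then have "card (f ` {..n}) \<le> card (nb G y)" using finite_nbG by (intro card_mono)
    moreover have "card (f ` {..n}) = Suc n" using that by (simp add: fan_def card_image)
    ultimately show ?thesis by simp
  qed
  ultimately have "\<exists>n. (\<exists>f. fan c f n) \<and> (\<forall>m. (\<exists>f. fan c f m) \<longrightarrow> m \<le> n)"
    by (intro Nat.ex_has_greatest_nat[of "\<lambda>n. \<exists>f. fan c f n" 0 "card (nb G y)"]) blast+
  then obtain n f where f: "fan c f n" and maxi: "\<And>m g. fan c g m \<Longrightarrow> m \<le> n" by blast
  let ?M = "\<Union>i\<in>{..n}. miss c (f i)"
  have finM: "finite (miss c v)" for v by (rule finite_subset[of _ "{..<k}"]) (auto simp: missing_def)
  have "\<exists>i\<in>{1..n}. \<gamma> = c {y, f i}" if \<gamma>: "\<gamma> \<in> ?M" for \<gamma>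
  proof -
    obtain j where j: "j \<le> n" "\<gamma> \<in> miss c (f j)" using \<gamma> by auto
    have "\<gamma> \<notin> miss c y" using fan_rotation[OF c fan_prefix[OF f j(1)]] j(2) by blast
    then obtain e where e: "e \<in> F" "y \<in> e" "c e = \<gamma>" using j(2) by (auto simp: missing_def)
    obtain a b where "e = {a, b}" using F2[OF e(1)] by (auto simp: card_2_iff)
    then obtain w where w: "e = {y, w}" using e(2) by auto
    have "w \<in> f ` {..n}"
    proof (rule ccontr)
      assume nw: "w \<notin> f ` {..n}"
      let ?g = "f(Suc n := w)"
      have "fan c ?g (Suc n)"
        unfolding fan_def
      proof (intro conjI allI impI)
        show "?g 0 = x" using f by (simp add: fan_def)
        have "inj_on ?g {..n}" using f by (simp add: fan_def inj_on_def)
        moreover have "?g ` {..n} = f ` {..n}" by (intro image_cong) auto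
        ultimately show "inj_on ?g {..Suc n}" using nw by (simp add: atMost_Suc)
      next
        fix i assume "i \<le> Suc n"
        then show "{y, ?g i} \<in> G" using f e(1) w by (auto simp: fan_def F_def le_Suc_eq)
      next
        fix i assume i: "i \<le> Suc n" "0 < i"
        show "\<exists>l<i. c {y, ?g i} \<in> miss c (?g l)"
        proof (cases "i = Suc n")
          case True
          then show ?thesis using j e(3) w by (intro exI[of _ j]) auto
        next
          case False
          then have "i \<le> n" using i by simp
          then obtain l where "l < i" "c {y, f i} \<in> miss c (f l)" using f i(2) unfolding fan_def by blast
          then show ?thesis using False i by (intro exI[of _ l]) auto
        qed
      qed
      then show False using maxi by fastforce
    qed
    then obtain i where i: "i \<le> n" "w = f i" by auto
    have "f 0 = x" using f by (simp add: fan_def)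
    then have "i \<noteq> 0" using e(1) w i(2) by (cases "i = 0") (auto simp: F_def insert_commute)
    then show ?thesis using i e(3) w by auto
  qed
  then have "?M \<subseteq> (\<lambda>i. c {y, f i}) ` {1..n}" by blast
  then have "card ?M \<le> card ((\<lambda>i. c {y, f i}) ` {1..n})" by (intro card_mono) simp_all
  also have "\<dots> \<le> n" using card_image_le[of "{1..n}" "\<lambda>i. c {y, f i}"] by simp
  finally have Mn: "card ?M \<le> n" .
  have "card ?M = (\<Sum>i\<in>{..n}. card (miss c (f i)))"
    using finM fan_missing_disjoint[OF c f] by (intro card_UN_disjoint) auto
  also have "\<dots> = card (miss c (f 0)) + (\<Sum>i\<in>{1..n}. card (miss c (f i)))"
  proof -
    have "{..n} = insert 0 {1..n}" by auto
    then show ?thesis by simp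
  qed
  finally have Msum: "card (miss c (f 0)) + (\<Sum>i\<in>{1..n}. card (miss c (f i))) \<le> n" using Mn by simp
  have f0: "card (miss c (f 0)) + card (nb G x) = k + 1"
  proof -
    have "f 0 = x" using f by (simp add: fan_def)
    then show ?thesis using card_missing[OF c finF F2, of x] degF(2) by simp
  qed
  have fi: "card (miss c (f i)) + card (nb G (f i)) = k" if i: "i \<in> {1..n}" for i
  proof -
    have "f i \<noteq> f 0" using f i unfolding fan_def inj_on_def by (metis atLeastAtMost_iff atMost_iff not_one_le_zero zero_le)
    then have "f i \<noteq> x" using f by (simp add: fan_def)
    then show ?thesis using card_missing[OF c finF F2, of "f i"] degF(3) fan_edge(2)[OF f] i by simp
  qed
  let ?full = "{i \<in> {1..n}. card (nb G (f i)) = k}"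
  have "n \<le> (\<Sum>i\<in>{1..n}. card (miss c (f i)) + (if card (nb G (f i)) = k then 1 else 0))"
  proof -
    have "n = (\<Sum>i\<in>{1..n}. 1)" by simp
    also have "\<dots> \<le> (\<Sum>i\<in>{1..n}. card (miss c (f i)) + (if card (nb G (f i)) = k then 1 else 0))"
    proof (rule sum_mono)
      fix i assume "i \<in> {1..n}"
      from fi[OF this] show "1 \<le> card (miss c (f i)) + (if card (nb G (f i)) = k then 1 else 0)"
        by (cases "card (miss c (f i))") auto
    qed
    finally show ?thesis .
  qed
  also have "\<dots> = (\<Sum>i\<in>{1..n}. card (miss c (f i))) + card ?full"
    by (simp add: sum.distrib sum.inter_filter[symmetric])
  finally have n_le: "n \<le> (\<Sum>i\<in>{1..n}. card (miss c (f i))) + card ?full" .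
  have "card ?full \<le> card {w \<in> nb G y - {x}. card (nb G w) = k}"
  proof (rule card_inj_on_le[of f])
    show "inj_on f ?full" using f by (auto simp: fan_def intro: inj_on_subset)
    show "f ` ?full \<subseteq> {w \<in> nb G y - {x}. card (nb G w) = k}"
    proof
      fix w assume "w \<in> f ` ?full"
      then obtain i where i: "i \<in> {1..n}" "w = f i" "card (nb G w) = k" by blast
      have "{y, w} \<in> F" using fan_edge(1)[OF f, of i] i by simp
      then show "w \<in> {w \<in> nb G y - {x}. card (nb G w) = k}"
        using i(3) by (auto simp: F_def nb_def insert_commute)
    qed
    show "finite {w \<in> nb G y - {x}. card (nb G w) = k}" using finite_nbG by simp
  qed
  then show ?thesis using Msum f0 n_le by linarith
qed

end

section \<open>Discharging without 4-cycles\<close>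

lemma critical_subgraph:
  assumes "finite E" "\<And>c. \<not> edge_colors k E c"
  shows "\<exists>G\<subseteq>E. (\<forall>c. \<not> edge_colors k G c) \<and> (\<forall>e\<in>G. \<exists>c. edge_colors k (G - {e}) c)"
  using assms
proof (induction E rule: finite_psubset_induct)
  case (psubset E)
  show ?case
  proof (cases "\<forall>e\<in>E. \<exists>c. edge_colors k (E - {e}) c")
    case True
    then show ?thesis using psubset.prems by blast
  next
    case False
    then obtain e where e: "e \<in> E" "\<And>c. \<not> edge_colors k (E - {e}) c" by blast
    then have "E - {e} \<subset> E" by blast
    from psubset.IH[OF this e(2)] obtain G where "G \<subseteq> E - {e}" "\<forall>c. \<not> edge_colors k G c"
      "\<forall>e\<in>G. \<exists>c. edge_colors k (G - {e}) c" by blast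
    then show ?thesis by blast
  qed
qed

text \<open>What a vertex of degree \<open>d\<close> takes from each neighbour, when a vertex of degree \<open>d\<close> starts with charge
  \<open>14 * d - 60\<close>. The values solve \<open>14 * d + d * demand d = 60\<close> for \<open>d = 2, 3, 4\<close>.\<close>

definition demand :: "nat \<Rightarrow> nat" where
  "demand d = (if d = 2 then 16 else if d = 3 then 6 else if d = 4 then 1 else 0)"

lemma demand_antimono: "2 \<le> m \<Longrightarrow> m \<le> d \<Longrightarrow> demand d \<le> demand m"
  by (simp add: demand_def)

text \<open>In a critical graph, a vertex \<open>y\<close> with a neighbour of degree \<open>m \<le> 4\<close> has large degree and at most
  \<open>m - 1\<close> neighbours of degree at most four, by Vizing's adjacency lemma. So it can satisfy their
  demands, and the total charge is nonnegative, against the sparsity of planar graphs without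
  4-cycles.\<close>

theorem edge_colors_of_C4_free_maclane:
  assumes ml: "maclane E" and deg: "\<And>v. card (nb E v) \<le> k" and k: "7 \<le> k"
    and C4: "\<And>u v w x. distinct [u,v,w,x] \<Longrightarrow> \<not> ({u,v} \<in> E \<and> {v,w} \<in> E \<and> {w,x} \<in> E \<and> {x,u} \<in> E)"
  shows "\<exists>c. edge_colors k E c"
proof (rule ccontr)
  assume "\<not> ?thesis"
  then have no: "\<And>c. \<not> edge_colors k E c" by blast
  have finE: "finite E" and E2: "\<And>e. e \<in> E \<Longrightarrow> card e = 2" using ml by (auto simp: maclane_def graph_edges_def)
  obtain G where G: "G \<subseteq> E" "\<And>c. \<not> edge_colors k G c" "\<And>e. e \<in> G \<Longrightarrow> \<exists>c. edge_colors k (G - {e}) c"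
    using critical_subgraph[OF finE no] by blast
  have finG: "finite G" using G(1) finE finite_subset by blast
  have G2: "\<And>e. e \<in> G \<Longrightarrow> card e = 2" using E2 G(1) by blast
  define V where "V = \<Union>G"
  have finV: "finite V" unfolding V_def using finG G2 by (intro finite_Union) (auto intro: card_ge_0_finite)
  have nbV: "nb G v \<subseteq> V" for v by (auto simp: nb_def V_def)
  have finnb: "finite (nb G v)" for v using nbV finV finite_subset by blast
  have nbE: "nb G v \<subseteq> nb E v" for v using G(1) by (auto simp: nb_def)
  have finnbE: "finite (nb E v)" for v
  proof -
    have "nb E v \<subseteq> \<Union>E" by (auto simp: nb_def)
    moreover have "finite (\<Union>E)" using finE E2 by (intro finite_Union) (auto intro: card_ge_0_finite)
    ultimately show ?thesis using finite_subset by blast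
  qed
  define d where "d v = card (nb G v)" for v
  have dk: "d v \<le> k" for v
    using card_mono[OF finnbE nbE] deg[of v] unfolding d_def by (rule le_trans)
  have "edge_colors k {} (\<lambda>_. 0)" by (simp add: edge_colors_def proper_edge_coloring_def)
  then have "G \<noteq> {}" using G(2) by blast
  then obtain e0 where e0: "e0 \<in> G" by blast
  have "e0 \<noteq> {}" using G2[OF e0] by auto
  then have Vne: "V \<noteq> {}" using e0 by (auto simp: V_def)
  have VAL: "k + 1 \<le> d x + card {w \<in> nb G y - {x}. d w = k}" if x: "x \<in> nb G y" for x y
  proof -
    have xy: "{x, y} \<in> G" using x by (simp add: nb_def insert_commute)
    interpret uncolorable_edge k G x y
      using finG G2 xy G(2) dk by unfold_locales (simp_all add: d_def)
    obtain c where "edge_colors k (G - {{x, y}}) c" using G(3)[OF xy] by blast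
    then show ?thesis using vizing_adjacency[of c] by (simp add: F_def d_def)
  qed
  define L where "L y = {x \<in> nb G y. d x \<le> 4}" for y
  have finL: "finite (L y)" for y using finnb by (simp add: L_def)
  have low: "card (L y) + k + 1 \<le> d y + d x" if x: "x \<in> L y" for x y
  proof -
    let ?full = "{w \<in> nb G y - {x}. d w = k}"
    have "card (L y) + card ?full = card (L y \<union> ?full)"
      using finL finnb k by (intro card_Un_disjoint[symmetric]) (auto simp: L_def)
    also have "\<dots> \<le> d y" unfolding d_def using finnb by (intro card_mono) (auto simp: L_def)
    finally show ?thesis using VAL[of x y] x by (simp add: L_def)
  qed
  have d2: "2 \<le> d x" if xV: "x \<in> V" for x
  proof (rule ccontr)
    assume n: "\<not> 2 \<le> d x"
    obtain e where e: "e \<in> G" "x \<in> e" using xV by (auto simp: V_def)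
    obtain a b where "e = {a, b}" using G2[OF e(1)] by (auto simp: card_2_iff)
    then obtain y where "e = {y, x}" using e(2) by auto
    then have "x \<in> L y" using e(1) n by (simp add: L_def nb_def)
    moreover from this have "card (L y) > 0" using finL by (auto simp: card_gt_0_iff)
    ultimately show False using low[of x y] dk[of y] n by simp
  qed
  have local: "60 + (\<Sum>x\<in>nb G y. demand (d x)) \<le> 14 * d y + d y * demand (d y)" if y: "y \<in> V" for y
  proof -
    have sumL: "(\<Sum>x\<in>nb G y. demand (d x)) = (\<Sum>x\<in>L y. demand (d x))"
      by (rule sum.mono_neutral_right) (use finnb in \<open>auto simp: L_def demand_def\<close>)
    show ?thesis
    proof (cases "L y = {}")
      case True
      have "d y = 2 \<or> d y = 3 \<or> d y = 4 \<or> d y \<ge> 5" using d2[OF y] by linarith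
      then show ?thesis unfolding sumL True by (elim disjE) (simp_all add: demand_def)
    next
      case False
      define m where "m = Min (d ` L y)"
      have "m \<in> d ` L y" unfolding m_def using finL False by (intro Min_in) simp_all
      then obtain x0 where x0: "x0 \<in> L y" "d x0 = m" by auto
      have mle: "m \<le> d x" if "x \<in> L y" for x unfolding m_def using finL that by (intro Min_le) simp_all
      have "x0 \<in> V" using x0(1) nbV by (auto simp: L_def)
      then have m: "2 \<le> m" "m \<le> 4" using d2[of x0] x0 by (auto simp: L_def)
      have "(\<Sum>x\<in>L y. demand (d x)) \<le> (\<Sum>x\<in>L y. demand m)"
        using mle m(1) by (intro sum_mono demand_antimono)
      then have "(\<Sum>x\<in>nb G y. demand (d x)) \<le> card (L y) * demand m" using sumL by simp
      moreover have lo: "card (L y) + k + 1 \<le> d y + m" using low[OF x0(1)] x0(2) by simp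
      moreover have "card (L y) > 0" using finL False by (simp add: card_gt_0_iff)
      moreover have "m = 2 \<or> m = 3 \<or> m = 4" using m by arith
      ultimately show ?thesis using dk[of y] k
        by (elim disjE) (simp_all add: demand_def)
    qed
  qed
  have swap: "(\<Sum>y\<in>V. \<Sum>x\<in>nb G y. demand (d x)) = (\<Sum>x\<in>V. d x * demand (d x))"
  proof -
    have "(\<Sum>y\<in>V. \<Sum>x\<in>nb G y. demand (d x)) = (\<Sum>y\<in>V. \<Sum>x\<in>V. if x \<in> nb G y then demand (d x) else 0)"
    proof (rule sum.cong[OF refl])
      fix y
      have "nb G y = {x \<in> V. x \<in> nb G y}" using nbV by blast
      then have "(\<Sum>x\<in>nb G y. demand (d x)) = (\<Sum>x\<in>{x \<in> V. x \<in> nb G y}. demand (d x))" by simp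
      also have "\<dots> = (\<Sum>x\<in>V. if x \<in> nb G y then demand (d x) else 0)"
        using finV by (rule sum.inter_filter)
      finally show "(\<Sum>x\<in>nb G y. demand (d x)) = (\<Sum>x\<in>V. if x \<in> nb G y then demand (d x) else 0)" .
    qed
    also have "\<dots> = (\<Sum>x\<in>V. \<Sum>y\<in>V. if x \<in> nb G y then demand (d x) else 0)" by (rule sum.swap)
    also have "\<dots> = (\<Sum>x\<in>V. d x * demand (d x))"
    proof (rule sum.cong[OF refl])
      fix x
      have "{y \<in> V. x \<in> nb G y} = nb G x" using nbV[of x] nb_sym[of x G] by auto
      moreover have "(\<Sum>y\<in>V. if x \<in> nb G y then demand (d x) else 0) = (\<Sum>y\<in>{y \<in> V. x \<in> nb G y}. demand (d x))"
        using finV by (rule sum.inter_filter[symmetric])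
      ultimately show "(\<Sum>y\<in>V. if x \<in> nb G y then demand (d x) else 0) = d x * demand (d x)"
        by (simp add: d_def)
    qed
    finally show ?thesis .
  qed
  have "(\<Sum>y\<in>V. 60 + (\<Sum>x\<in>nb G y. demand (d x))) \<le> (\<Sum>y\<in>V. 14 * d y + d y * demand (d y))"
    by (rule sum_mono) (rule local)
  then have "60 * card V + (\<Sum>x\<in>V. d x * demand (d x)) \<le> 14 * (\<Sum>y\<in>V. d y) + (\<Sum>x\<in>V. d x * demand (d x))"
    unfolding sum.distrib swap by (simp add: sum_distrib_left)
  moreover have "(\<Sum>y\<in>V. d y) = 2 * card G"
  proof -
    have "(\<Sum>y\<in>V. d y) = (\<Sum>y\<in>V. card {e \<in> G. y \<in> e})"
      using card_incident[OF G2, of G] by (intro sum.cong) (simp_all add: d_def)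
    also have "\<dots> = 2 * card G" using G2 by (intro sum_degree_edges[OF finV finG]) (auto simp: V_def)
    finally show ?thesis .
  qed
  moreover have "7 * card G + 15 \<le> 15 * card V"
  proof (rule card_edges_planar_C4_free[OF finV _ Vne maclane_subset[OF ml G(1)]])
    show "e \<subseteq> V" if "e \<in> G" for e using that by (auto simp: V_def)
    show "\<not> ({u,v} \<in> G \<and> {v,w} \<in> G \<and> {w,x} \<in> G \<and> {x,u} \<in> G)" if "distinct [u,v,w,x]" for u v w x
      using C4[OF that] G(1) by blast
  qed
  ultimately show False by linarith
qed

text \<open>A B-colouring with \<open>\<Delta>\<close> colours exists by the two colouring theorems; for the lower bound, the edges at
  a vertex of degree \<open>\<Delta>\<close> have distinct colours.\<close>

theorem theoremA:
  fixes V :: "'a set" and E :: "'a set set" and t \<Delta> :: nat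
  assumes "t \<ge> 2"
    and "simple_graph V E"
    and "K2_free t V E"
    and "planar V E"
    and "max_degree V E = \<Delta>"
    and "(t = 2 \<and> \<Delta> \<ge> 7) \<or> (t \<ge> 3 \<and> \<Delta> \<ge> 14 * (t - 1))"
  shows "B_coloring_number E = \<Delta>"
proof -
  interpret simple_graph V E by (rule assms(2))
  obtain p \<gamma> where draw: "plane_drawing V E p \<gamma>" using assms(4) by (auto simp: planar_def)
  have ml: "maclane E" by (rule maclane_of_drawing[OF finite_V finite_E edges draw])
  have deg: "vertex_degree E v \<le> \<Delta>" if "v \<in> V" for v
    unfolding assms(5)[symmetric] max_degree_def using finite_V that by (intro Max_ge) auto
  have "\<exists>c. B_coloring E c \<and> c ` E \<subseteq> {..<\<Delta>}"
    using assms(6)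
  proof (elim disjE conjE)
    assume "t \<ge> 3" "\<Delta> \<ge> 14 * (t - 1)"
    then show ?thesis using B_coloring_of_K2_free_maclane[OF ml _ _ assms(3) deg] by blast
  next
    assume t: "t = 2" and D: "\<Delta> \<ge> 7"
    have no4: "\<not> ({u,v} \<in> E \<and> {v,w} \<in> E \<and> {w,x} \<in> E \<and> {x,u} \<in> E)" if "distinct [u,v,w,x]" for u v w x
    proof
      assume e: "{u,v} \<in> E \<and> {v,w} \<in> E \<and> {w,x} \<in> E \<and> {x,u} \<in> E"
      then have V: "u \<in> V" "v \<in> V" "w \<in> V" "x \<in> V" using edges by blast+
      then have "{v, x} \<subseteq> common_neighbors V E u w"
        using e by (auto simp: common_neighbors_def insert_commute)
      then have "card {v, x} \<le> card (common_neighbors V E u w)"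
        using finite_V by (intro card_mono) (auto simp: common_neighbors_def)
      moreover have "card (common_neighbors V E u w) \<le> 1"
        using assms(3) V that t by (auto simp: K2_free_def)
      ultimately show False using that by simp
    qed
    have "card (nb E v) \<le> \<Delta>" for v
    proof (cases "v \<in> V")
      case True
      then show ?thesis using deg degree_nb by simp
    next
      case False
      then have "nb E v = {}" using nb_in_V by blast
      then show ?thesis by simp
    qed
    then obtain c where c: "edge_colors \<Delta> E c"
      using edge_colors_of_C4_free_maclane[OF ml _ D no4] by blast
    have "B_coloring E c"
      unfolding B_coloring_def
    proof (intro conjI allI impI)
      show "proper_edge_coloring E c" using c by (simp add: edge_colors_def)
      fix v w x y assume "four_cycle E v w x y"
      then have False using no4[of v w x y] by (simp add: four_cycle_def)
      then show "distinct [c {v, w}, c {w, x}, c {x, y}, c {y, v}]" ..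
    qed
    then show ?thesis using c by (auto simp: edge_colors_def)
  qed
  then have upper: "B_coloring_number E \<le> \<Delta>"
    unfolding B_coloring_number_def by (rule Least_le)
  obtain c where c: "B_coloring E c" "c ` E \<subseteq> {..<B_coloring_number E}"
    using ex_B_coloring_number by blast
  have "\<Delta> \<noteq> 0" using assms(6) by auto
  moreover have "\<Delta> \<in> insert 0 (vertex_degree E ` V)"
    unfolding assms(5)[symmetric] max_degree_def using finite_V by (intro Max_in) simp_all
  ultimately obtain v where v: "v \<in> V" "vertex_degree E v = \<Delta>" by auto
  have "inj_on c {e \<in> E. v \<in> e}"
  proof (rule inj_onI)
    fix e f assume "e \<in> {e \<in> E. v \<in> e}" "f \<in> {e \<in> E. v \<in> e}" "c e = c f"
    then show "e = f" using c(1) unfolding B_coloring_def proper_edge_coloring_def by blast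
  qed
  moreover have "c ` {e \<in> E. v \<in> e} \<subseteq> {..<B_coloring_number E}" using c(2) by blast
  ultimately have "card {e \<in> E. v \<in> e} \<le> card {..<B_coloring_number E}"
    by (intro card_inj_on_le) auto
  then have "\<Delta> \<le> B_coloring_number E" using v(2) by (simp add: vertex_degree_def)
  then show ?thesis using upper by simp
qed

end
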